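(* Let $p>0$, and let $A,B\in M_n(\mathbb C)$ with $A\ne 0$. There are a finite set $J_+\subset\mathbb N$, positive numbers $a_k$ for $k\in J_+$, and $b\ge 0$ such that, as $t\downarrow 0$, $$\frac{1}{2\pi}\int_0^{2\pi}\|A+te^{i\theta}B\|_p^p\,d\theta=\|A\|_p^p+\sum_{\substack{k\in J_+\\ kp\le 2}}a_kt^{kp}+bt^2+o(t^2).$$ Moreover, in singular-value coordinates in which $A=\operatorname{diag}(s_1,\ldots,s_h,0,\ldots,0)$ with $s_i>0$ for $1\le i\le h$ (that is, writing $A=U\operatorname{diag}(s_1,\ldots,s_h,0,\ldots,0)V^*$ with $U,V$ unitary and replacing $B$ by $U^*BV$), the coefficient $b$ vanishes if and only if $B$ is supported entirely in the bottom-right $(n-h)\times(n-h)$ block.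
   Context: For $X\in M_n(\mathbb C)$, $\|X\|_p^p=\operatorname{Tr}|X|^p=\sum_j s_j(X)^p$, where $s_j(X)$ are the singular values of $X$. $\mathbb N=\{1,2,3,\dots\}$. "Supported in the bottom-right $(n-h)\times(n-h)$ block" means all entries $b_{ij}$ with $i\le h$ or $j\le h$ are zero. *)

theory Defs
  imports
    "HOL-Analysis.Analysis"
    "HOL-Library.Landau_Symbols"
    "HOL-Computational_Algebra.Fundamental_Theorem_Algebra"
    "Jordan_Normal_Form.Schur_Decomposition"
begin

text \<open>
  The library's \<open>mat_adjoint\<close> is the conjugate transpose. The eigenvalues of
  \<open>X\<^sup>* X\<close> are real and nonnegative, so \<open>Re\<close> loses nothing; \<open>proots\<close> counts each of them
  with its algebraic multiplicity, hence an \<open>n \<times> n\<close> matrix has exactly \<open>n\<close> singular values.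
\<close>
definition singular_values :: "complex mat \<Rightarrow> real multiset" where
  "singular_values X = image_mset (\<lambda>z. sqrt (Re z)) (proots (char_poly (mat_adjoint X * X)))"

text \<open>
  The \<open>p\<close>-th power of the Schatten (quasi-)norm, \<open>Tr |X|\<^sup>p\<close>. For \<open>p > 0\<close> zero singular
  values contribute \<open>0 powr p = 0\<close>.
\<close>
definition schatten_powr :: "real \<Rightarrow> complex mat \<Rightarrow> real" where
  "schatten_powr p X = (\<Sum>s\<in>#singular_values X. s powr p)"

definition unitary_mat :: "nat \<Rightarrow> complex mat \<Rightarrow> bool" where
  "unitary_mat n U \<longleftrightarrow> U \<in> carrier_mat n n \<and>
     mat_adjoint U * U = 1\<^sub>m n \<and> U * mat_adjoint U = 1\<^sub>m n"

text \<open>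
  \<open>A = U diag(s\<^sub>1, \<dots>, s\<^sub>h, 0, \<dots>, 0) V\<^sup>*\<close> with exactly \<open>h\<close> positive singular values.
  Indices start at \<open>0\<close>, so the positive entries are \<open>s 0, \<dots>, s (h - 1)\<close>; the values
  \<open>s i\<close> for \<open>i \<ge> h\<close> are irrelevant.
\<close>
definition is_svd :: "nat \<Rightarrow> complex mat \<Rightarrow> complex mat \<Rightarrow> nat \<Rightarrow> (nat \<Rightarrow> real) \<Rightarrow> complex mat \<Rightarrow> bool" where
  "is_svd n A U h s V \<longleftrightarrow> unitary_mat n U \<and> unitary_mat n V \<and> h \<le> n \<and> (\<forall>i<h. s i > 0) \<and>
     A = U * mat_diag n (\<lambda>i. if i < h then complex_of_real (s i) else 0) * mat_adjoint V"

definition supported_bottom_right :: "nat \<Rightarrow> nat \<Rightarrow> complex mat \<Rightarrow> bool" where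
  "supported_bottom_right n h B \<longleftrightarrow> (\<forall>i<n. \<forall>j<n. i < h \<or> j < h \<longrightarrow> B $$ (i, j) = 0)"

end

theory Submission
  imports Defs
begin

text \<open>
  The squared singular values $x_j(z)$ of $A + zB$ are sorted by size. For a fixed $k$, the numbers
  $\nu_j = 1 / (1 + x_j(z) / |z|^{2k})$ lie in $[0,1]$, and by the Cauchy--Binet formula the
  coefficients of $\prod_j (1 - w \nu_j)$ are quotients of sums of squared moduli of polynomials
  in $z$. Hence the power sums of the $\nu_j$ are even up to $O(|z|^2)$, and so is, by polynomial
  interpolation, the sum of $(x_j(z) / |z|^{2k})^{p/2}$ over the $x_j(z)$ of exact order $|z|^{2k}$.
  After averaging over the circle, that sum contributes $a_k t^{kp} + O(t^{kp+2})$.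

  For $k = 0$ the sum is, up to $O(|z|^3)$, the trace of a polynomial $q$ in $(A+zB)^*(A+zB)$. In
  singular-value coordinates, with $\lambda_i = s_i^2$ and $f(\lambda) = \lambda^{p/2}$, its
  averaged second-order coefficient is
  $b = \sum_{i,j} |b_{ij}|^2 (\lambda_i f'(\lambda_i) - \lambda_j f'(\lambda_j)) / (\lambda_i - \lambda_j)$,
  where $f$ is replaced by $0$ near $0$. As $\lambda f'(\lambda)$ is strictly increasing, every
  coefficient is nonnegative, and it vanishes only for $\lambda_i = \lambda_j = 0$.
\<close>

section \<open>Hermite interpolation\<close>

text \<open>The Gram matrix of A + zB depends on z and on its conjugate, and in such a two-parameter
  family the eigenvalues need not be differentiable: for A = 1 and B a nilpotent 2 x 2 block with a
  single entry 1, they are 1 + |z| and 1 - |z| to first order. So no branch x_j(z) is ever followed.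
  Only symmetric functions of the x_j are expanded, and single values are controlled through sums of
  nonnegative terms. The exponents kp arise because a value x of exact order |z|^{2k} contributes
  x^{p/2}, of order |z|^{kp}. The map x -> 1 / (1 + x / |z|^{2k}) sends values of smaller order
  towards 1 and values of larger order towards 0; everything stays in a compact interval, and the
  values of exact order |z|^{2k} are those in a middle interval, the window. The two orders of
  precision reflect the prefactor |z|^{kp}: it tends to 0 for k \<ge> 1, which makes an error
  O(|z|^2) harmless there, but it is 1 for k = 0, where the coefficient of |z|^2 itself is
  required.\<close>

lemma exists_poly_mult_congruent:
  fixes P S :: "'a::field poly"
  assumes "poly P c \<noteq> 0"
  shows "\<exists>r. [:-c, 1:] ^ N dvd S - r * P"
proof (induction N)
  case 0
  show ?case by simp
next
  case (Suc N)
  then obtain r s where rs: "S - r * P = [:-c, 1:] ^ N * s" by (auto elim!: dvdE)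
  \<comment> \<open>P is invertible modulo powers of X - c because P(c) is nonzero. The constant
    \<alpha> is the next coefficient of S / P in powers of X - c, chosen so that the remainder s
    gains a factor X - c.\<close>
  define \<alpha> where "\<alpha> = poly s c / poly P c"
  have "poly (s - [:\<alpha>:] * P) c = 0" using assms by (simp add: \<alpha>_def)
  then obtain u where u: "s - [:\<alpha>:] * P = [:-c, 1:] * u"
    by (auto simp only: poly_eq_0_iff_dvd elim!: dvdE)
  have "S - (r + [:\<alpha>:] * [:-c, 1:] ^ N) * P = [:-c, 1:] ^ N * (s - [:\<alpha>:] * P)"
    using rs by (simp only: algebra_simps)
  also have "\<dots> = [:-c, 1:] ^ Suc N * u" unfolding u by (simp only: power_Suc algebra_simps)
  finally show ?case by (metis dvd_triv_left)
qed

text \<open>Chinese remaindering, one node at a time: adding a multiple of the product P of the old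
  factors leaves the conditions at the old nodes intact, and P is invertible at the new
  node.\<close>

lemma hermite_interpolation:
  fixes T :: "'a::field \<Rightarrow> 'a poly"
  assumes "finite C"
  shows "\<exists>q. \<forall>c\<in>C. [:-c, 1:] ^ N dvd q - T c"
  using assms
proof induction
  case empty
  show ?case by simp
next
  case (insert c C)
  then obtain q where q: "\<forall>d\<in>C. [:-d, 1:] ^ N dvd q - T d" by blast
  define P where "P = (\<Prod>d\<in>C. [:-d, 1:] ^ N)"
  have "poly P c \<noteq> 0" using insert by (auto simp: P_def poly_prod)
  from exists_poly_mult_congruent[OF this, of N "T c - q"]
  obtain r where r: "[:-c, 1:] ^ N dvd T c - q - r * P" by blast
  have "[:-d, 1:] ^ N dvd q + r * P - T d" if d: "d \<in> insert c C" for d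
  proof (cases "d = c")
    case True
    have "q + r * P - T c = - (T c - q - r * P)" by simp
    then show ?thesis using r True by (metis dvd_minus_iff)
  next
    case False
    with d have "d \<in> C" by auto
    then have "[:-d, 1:] ^ N dvd P" using insert(1) unfolding P_def by (rule dvd_prodI[rotated])
    then have "[:-d, 1:] ^ N dvd (q - T d) + r * P" using q \<open>d \<in> C\<close> by (intro dvd_add) auto
    then show ?thesis by (simp add: algebra_simps)
  qed
  then show ?case by blast
qed

text \<open>A finite subcover makes the local constants uniform. The inequality is stated without
  dividing by \<open>w\<close>, because \<open>w\<close> may vanish in S.\<close>

lemma compact_locally_bounded_ratio:
  fixes h w :: "'a::metric_space \<Rightarrow> real"
  assumes S: "compact S"
    and loc: "\<And>y. y \<in> S \<Longrightarrow> \<exists>\<delta>>0. \<exists>K. \<forall>x\<in>S. dist x y < \<delta> \<longrightarrow> h x \<le> K * w x"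
    and w: "\<And>x. x \<in> S \<Longrightarrow> w x \<ge> 0"
  shows "\<exists>K\<ge>0. \<forall>x\<in>S. h x \<le> K * w x"
proof -
  from loc obtain \<delta> K where dK: "\<And>y. y \<in> S \<Longrightarrow> \<delta> y > 0"
    "\<And>y x. \<lbrakk>y \<in> S; x \<in> S; dist x y < \<delta> y\<rbrakk> \<Longrightarrow> h x \<le> K y * w x" by metis
  have "S \<subseteq> (\<Union>y\<in>S. ball y (\<delta> y))" using dK(1) by force
  then obtain F where F: "F \<subseteq> S" "finite F" "S \<subseteq> (\<Union>y\<in>F. ball y (\<delta> y))"
    using compactE_image[OF S, of S "\<lambda>y. ball y (\<delta> y)"] by blast
  define L where "L = (\<Sum>y\<in>F. \<bar>K y\<bar>)"
  have "h x \<le> L * w x" if x: "x \<in> S" for x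
  proof -
    from F(3) x obtain y where y: "y \<in> F" "dist y x < \<delta> y" by auto
    have "h x \<le> K y * w x" using dK(2)[of y x] y F(1) x by (auto simp: dist_commute)
    also have "\<dots> \<le> \<bar>K y\<bar> * w x" using w[OF x] by (intro mult_right_mono) auto
    also have "\<dots> \<le> L * w x" unfolding L_def using w[OF x] y(1) F(2)
      by (intro mult_right_mono member_le_sum) auto
    finally show ?thesis .
  qed
  moreover have "L \<ge> 0" unfolding L_def by (intro sum_nonneg) auto
  ultimately show ?thesis by blast
qed

text \<open>Away from the nodes the weight is bounded below, so boundedness of \<open>g\<close>
  suffices; at a node the Taylor hypothesis and divisibility by (X - c)^3 give the cubic bound.
  Continuity of \<open>g\<close> is not assumed, since the lemma is applied to functions cut off at
  the edges of a window.\<close>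

lemma hermite_interpolation_bound:
  fixes g :: "real \<Rightarrow> real" and T :: "real \<Rightarrow> real poly"
  assumes C: "finite C"
    and G: "\<And>x. x \<in> {lo..hi} \<Longrightarrow> \<bar>g x\<bar> \<le> G"
    and T: "\<And>c. c \<in> C \<Longrightarrow> \<exists>\<delta>>0. \<exists>K. \<forall>x. \<bar>x - c\<bar> < \<delta> \<longrightarrow> \<bar>g x - poly (T c) x\<bar> \<le> K * \<bar>x - c\<bar> ^ 3"
  shows "\<exists>q. (\<forall>c\<in>C. [:-c, 1:] ^ 3 dvd q - T c) \<and>
           (\<exists>K\<ge>0. \<forall>x\<in>{lo..hi}. \<bar>g x - poly q x\<bar> \<le> K * (\<Prod>c\<in>C. \<bar>x - c\<bar> ^ 3))"
proof -
  from hermite_interpolation[OF C] obtain q where q: "\<forall>c\<in>C. [:-c, 1:] ^ 3 dvd q - T c" by metis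
  have "compact {lo..hi}" by simp
  then have "bounded (poly q ` {lo..hi})"
    by (intro compact_imp_bounded compact_continuous_image continuous_intros)
  then obtain Q where Q: "\<And>x. x \<in> {lo..hi} \<Longrightarrow> \<bar>poly q x\<bar> \<le> Q"
    unfolding bounded_iff by (metis imageI real_norm_def)
  let ?w = "\<lambda>C x. \<Prod>c\<in>C. \<bar>x - c\<bar> ^ 3 :: real"
  \<comment> \<open>Applied to all nodes at a point that is not a node, and to the other nodes at a
    point that is one.\<close>
  have away: "\<exists>\<delta>>0. \<exists>m>0. \<forall>x. dist x y < \<delta> \<longrightarrow> ?w D x \<ge> m" if D: "finite D" "y \<notin> D" for D y
  proof -
    have "?w D y > 0" using that by (intro prod_pos) auto
    moreover have "isCont (?w D) y" by (intro continuous_intros)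
    ultimately obtain \<delta> where "\<delta> > 0" "\<And>x. dist x y < \<delta> \<Longrightarrow> dist (?w D x) (?w D y) < ?w D y / 2"
      unfolding continuous_at_eps_delta by (metis half_gt_zero)
    then have "\<forall>x. dist x y < \<delta> \<longrightarrow> ?w D x \<ge> ?w D y / 2"
      by (auto simp: dist_real_def abs_if split: if_splits) (smt (verit) field_sum_of_halves)+
    then show ?thesis using \<open>\<delta> > 0\<close> \<open>?w D y > 0\<close> half_gt_zero by blast
  qed
  have "\<exists>K\<ge>0. \<forall>x\<in>{lo..hi}. \<bar>g x - poly q x\<bar> \<le> K * ?w C x"
  proof (rule compact_locally_bounded_ratio)
    fix y assume y: "y \<in> {lo..hi}"
    show "\<exists>\<delta>>0. \<exists>K. \<forall>x\<in>{lo..hi}. dist x y < \<delta> \<longrightarrow> \<bar>g x - poly q x\<bar> \<le> K * ?w C x"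
    proof (cases "y \<in> C")
      case False
      from away[OF C False] obtain \<delta> m where dm: "\<delta> > 0" "m > 0"
        "\<And>x. dist x y < \<delta> \<Longrightarrow> ?w C x \<ge> m" by blast
      have "\<bar>g x - poly q x\<bar> \<le> (G + Q) / m * ?w C x" if "x \<in> {lo..hi}" "dist x y < \<delta>" for x
      proof -
        have "\<bar>g x - poly q x\<bar> \<le> G + Q" using G[OF that(1)] Q[OF that(1)] by linarith
        also have "\<dots> = (G + Q) / m * m" using dm by simp
        also have "\<dots> \<le> (G + Q) / m * ?w C x" using G[OF that(1)] Q[OF that(1)] dm that
          by (intro mult_left_mono divide_nonneg_pos) auto
        finally show ?thesis .
      qed
      then show ?thesis using dm(1) by blast
    next
      case True
      from T[OF True] obtain d1 K1 where dK: "d1 > 0"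
        "\<And>x. \<bar>x - y\<bar> < d1 \<Longrightarrow> \<bar>g x - poly (T y) x\<bar> \<le> K1 * \<bar>x - y\<bar> ^ 3" by blast
      from q True obtain s where s: "q - T y = [:-y, 1:] ^ 3 * s" by (auto elim!: dvdE)
      have "bounded (poly s ` {lo..hi})"
        by (intro compact_imp_bounded compact_continuous_image continuous_intros compact_Icc)
      then obtain B where B: "\<And>x. x \<in> {lo..hi} \<Longrightarrow> \<bar>poly s x\<bar> \<le> B"
        unfolding bounded_iff by (metis imageI real_norm_def)
      from away[of "C - {y}" y] C obtain d2 m where dm: "d2 > 0" "m > 0"
        "\<And>x. dist x y < d2 \<Longrightarrow> ?w (C - {y}) x \<ge> m" by blast
      have "\<bar>g x - poly q x\<bar> \<le> (\<bar>K1\<bar> + B) / m * ?w C x"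
        if x: "x \<in> {lo..hi}" "dist x y < min d1 d2" for x
      proof -
        have "poly q x - poly (T y) x = (x - y) ^ 3 * poly s x"
          using arg_cong[OF s, of "\<lambda>r. poly r x"] by (simp add: poly_power)
        then have "\<bar>poly q x - poly (T y) x\<bar> = \<bar>x - y\<bar> ^ 3 * \<bar>poly s x\<bar>"
          by (simp add: abs_mult power_abs)
        also have "\<dots> \<le> \<bar>x - y\<bar> ^ 3 * B" using B[OF x(1)] by (intro mult_left_mono) auto
        finally have 1: "\<bar>poly q x - poly (T y) x\<bar> \<le> B * \<bar>x - y\<bar> ^ 3" by (simp add: mult.commute)
        have "\<bar>g x - poly (T y) x\<bar> \<le> K1 * \<bar>x - y\<bar> ^ 3" using dK(2)[of x] x(2) by (auto simp: dist_real_def)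
        also have "\<dots> \<le> \<bar>K1\<bar> * \<bar>x - y\<bar> ^ 3" by (intro mult_right_mono) auto
        finally have "\<bar>g x - poly q x\<bar> \<le> (\<bar>K1\<bar> + B) * \<bar>x - y\<bar> ^ 3" using 1 by (simp add: distrib_right)
        also have "\<dots> = (\<bar>K1\<bar> + B) / m * (\<bar>x - y\<bar> ^ 3 * m)" using dm by simp
        also have "\<dots> \<le> (\<bar>K1\<bar> + B) / m * (\<bar>x - y\<bar> ^ 3 * ?w (C - {y}) x)"
          using dm x B[OF x(1)] by (intro mult_left_mono divide_nonneg_pos) auto
        also have "\<bar>x - y\<bar> ^ 3 * ?w (C - {y}) x = ?w C x"
          using C True by (simp add: prod.remove)
        finally show ?thesis .
      qed
      then show ?thesis using dK(1) dm(1) by (intro exI[of _ "min d1 d2"] conjI exI[of _ "(\<bar>K1\<bar> + B) / m"]) auto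
    qed
  qed (auto intro!: prod_nonneg)
  with q show ?thesis by blast
qed

section \<open>Cubic Taylor remainders of powers\<close>

lemma taylor_cubic_remainder:
  fixes f :: "real \<Rightarrow> real"
  assumes S: "open S" "c \<in> S"
    and f0: "\<And>x. x \<in> S \<Longrightarrow> (f has_real_derivative f1 x) (at x)"
    and f1: "\<And>x. x \<in> S \<Longrightarrow> (f1 has_real_derivative f2 x) (at x)"
    and f2: "\<And>x. x \<in> S \<Longrightarrow> (f2 has_real_derivative f3 x) (at x)"
    and f3: "continuous_on S f3"
  shows "\<exists>\<delta>>0. \<exists>K. \<forall>x. \<bar>x - c\<bar> < \<delta> \<longrightarrow>
           \<bar>f x - (f c + f1 c * (x - c) + f2 c / 2 * (x - c) ^ 2)\<bar> \<le> K * \<bar>x - c\<bar> ^ 3"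
proof -
  from S obtain d where d: "d > 0" "cball c d \<subseteq> S" by (meson open_contains_cball)
  have "bounded (f3 ` cball c d)"
    using d f3 by (intro compact_imp_bounded compact_continuous_image) (auto intro: continuous_on_subset)
  then obtain K where K: "\<And>x. x \<in> cball c d \<Longrightarrow> \<bar>f3 x\<bar> \<le> K" unfolding bounded_iff by (metis imageI real_norm_def)
  define D where "D m = (if m = 0 then f else if m = 1 then f1 else if m = 2 then f2 else f3)" for m :: nat
  have "\<bar>f x - (f c + f1 c * (x - c) + f2 c / 2 * (x - c) ^ 2)\<bar> \<le> K * \<bar>x - c\<bar> ^ 3"
    if x: "\<bar>x - c\<bar> < d" for x
  proof (cases "x = c")
    case False
    have sub: "t \<in> S" if "c - d \<le> t" "t \<le> c + d" for t
      using d(2) that by (auto simp: dist_real_def subset_iff abs_le_iff)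
    have "\<exists>t. (if x < c then x < t \<and> t < c else c < t \<and> t < x) \<and>
      f x = (\<Sum>m<3. (D m c / fact m) * (x - c) ^ m) + (D 3 t / fact 3) * (x - c) ^ 3"
    proof (rule Taylor[where a = "c - d" and b = "c + d"])
      show "\<forall>m t. m < 3 \<and> c - d \<le> t \<and> t \<le> c + d \<longrightarrow> DERIV (D m) t :> D (Suc m) t"
      proof (intro allI impI, elim conjE)
        fix m :: nat and t assume "m < 3" and t: "c - d \<le> t" "t \<le> c + d"
        then have "m = 0 \<or> m = 1 \<or> m = 2" by auto
        then show "DERIV (D m) t :> D (Suc m) t"
          using f0[OF sub[OF t]] f1[OF sub[OF t]] f2[OF sub[OF t]] by (auto simp: D_def)
      qed
    qed (use x d False in \<open>auto simp: D_def\<close>)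
    then obtain t where t: "if x < c then x < t \<and> t < c else c < t \<and> t < x"
      "f x = (\<Sum>m<3. (D m c / fact m) * (x - c) ^ m) + (D 3 t / fact 3) * (x - c) ^ 3" by blast
    have "t \<in> cball c d" using t(1) x by (auto simp: dist_real_def split: if_splits)
    have "f x - (f c + f1 c * (x - c) + f2 c / 2 * (x - c) ^ 2) = f3 t / 6 * (x - c) ^ 3"
      using t(2) by (simp add: D_def eval_nat_numeral)
    then have "\<bar>f x - (f c + f1 c * (x - c) + f2 c / 2 * (x - c) ^ 2)\<bar> = \<bar>f3 t\<bar> / 6 * \<bar>x - c\<bar> ^ 3"
      by (simp only:) (simp add: abs_mult power_abs)
    also have "\<dots> \<le> K * \<bar>x - c\<bar> ^ 3" using K[OF \<open>t \<in> cball c d\<close>] by (intro mult_right_mono) auto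
    finally show ?thesis .
  qed auto
  then show ?thesis using d(1) by blast
qed

text \<open>\<open>L1\<close> is the logarithmic derivative of \<open>f\<close>, and
  \<open>L2\<close>, \<open>L3\<close> are its derivatives, so each derivative of \<open>f\<close>
  is \<open>f\<close> times a polynomial in them. Two cases occur later: \<alpha> = -\<beta> with R
  = 1, which is ((1 - x) / x)^\<beta>, and exponent 0 on the second factor, which is a pure
  power.\<close>

lemma powr_mult_powr_derivs:
  fixes \<alpha> \<beta> R :: real
  defines "f \<equiv> \<lambda>x. x powr \<alpha> * (R - x) powr \<beta>"
    and "L1 \<equiv> \<lambda>x. \<alpha> / x - \<beta> / (R - x)"
    and "L2 \<equiv> \<lambda>x. - \<alpha> / x ^ 2 - \<beta> / (R - x) ^ 2"
    and "L3 \<equiv> \<lambda>x. 2 * \<alpha> / x ^ 3 - 2 * \<beta> / (R - x) ^ 3"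
  assumes x: "0 < x" "x < R"
  shows "(f has_real_derivative f x * L1 x) (at x)"
    and "((\<lambda>x. f x * L1 x) has_real_derivative f x * (L1 x ^ 2 + L2 x)) (at x)"
    and "((\<lambda>x. f x * (L1 x ^ 2 + L2 x)) has_real_derivative
            f x * (L1 x ^ 3 + 3 * L1 x * L2 x + L3 x)) (at x)"
proof -
  show f: "(f has_real_derivative f x * L1 x) (at x)"
    unfolding f_def L1_def using x
    by (auto intro!: derivative_eq_intros simp: powr_diff field_simps)
  have L1: "(L1 has_real_derivative L2 x) (at x)"
    unfolding L1_def L2_def using x
    by (auto intro!: derivative_eq_intros simp: field_simps power2_eq_square)
  have inv_square: "((\<lambda>y. \<gamma> / y ^ 2) has_real_derivative - 2 * \<gamma> / y ^ 3) (at y)" if "y \<noteq> 0" for \<gamma> y :: real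
    using that by (auto intro!: derivative_eq_intros simp: field_simps eval_nat_numeral)
  have "((\<lambda>x. R - x) has_real_derivative -1) (at x)" by (auto intro!: derivative_eq_intros)
  from DERIV_chain2[OF inv_square this, of \<beta>]
  have "((\<lambda>x. \<beta> / (R - x) ^ 2) has_real_derivative 2 * \<beta> / (R - x) ^ 3) (at x)" using x by simp
  from DERIV_diff[OF inv_square[of x "- \<alpha>"] this] 
  have L2: "(L2 has_real_derivative L3 x) (at x)" unfolding L2_def L3_def using x by simp
  show "((\<lambda>x. f x * L1 x) has_real_derivative f x * (L1 x ^ 2 + L2 x)) (at x)"
    by (rule DERIV_cong[OF DERIV_mult[OF f L1]]) (simp add: algebra_simps power2_eq_square)
  show "((\<lambda>x. f x * (L1 x ^ 2 + L2 x)) has_real_derivative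
            f x * (L1 x ^ 3 + 3 * L1 x * L2 x + L3 x)) (at x)"
    by (rule DERIV_cong[OF DERIV_mult[OF f DERIV_add[OF DERIV_power[OF L1, of 2] L2]]])
      (simp add: algebra_simps power2_eq_square power3_eq_cube)
qed

text \<open>The explicit coefficients matter: the first two derivatives of the interpolating
  polynomial are read off from them when the coefficient of |z|^2 is identified.\<close>

lemma powr_mult_powr_taylor:
  fixes \<alpha> \<beta> R c :: real
  defines "f \<equiv> \<lambda>x. x powr \<alpha> * (R - x) powr \<beta>"
    and "L1 \<equiv> \<alpha> / c - \<beta> / (R - c)"
    and "L2 \<equiv> - \<alpha> / c ^ 2 - \<beta> / (R - c) ^ 2"
  assumes c: "0 < c" "c < R"
  shows "\<exists>\<delta>>0. \<exists>K. \<forall>x. \<bar>x - c\<bar> < \<delta> \<longrightarrow>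
           \<bar>f x - poly ([:f c:] + Polynomial.smult (f c * L1) [:-c, 1:] +
             Polynomial.smult (f c * (L1 ^ 2 + L2) / 2) ([:-c, 1:] ^ 2)) x\<bar> \<le> K * \<bar>x - c\<bar> ^ 3"
proof -
  define f3 where "f3 x = f x * ((\<alpha> / x - \<beta> / (R - x)) ^ 3 +
    3 * (\<alpha> / x - \<beta> / (R - x)) * (- \<alpha> / x ^ 2 - \<beta> / (R - x) ^ 2) +
    (2 * \<alpha> / x ^ 3 - 2 * \<beta> / (R - x) ^ 3))" for x
  have "continuous_on {0<..<R} f3"
    unfolding f3_def f_def by (intro continuous_intros) auto
  have "\<exists>\<delta>>0. \<exists>K. \<forall>x. \<bar>x - c\<bar> < \<delta> \<longrightarrow>
      \<bar>f x - (f c + f c * L1 * (x - c) + f c * (L1 ^ 2 + L2) / 2 * (x - c) ^ 2)\<bar> \<le> K * \<bar>x - c\<bar> ^ 3"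
    unfolding L1_def L2_def
  proof (rule taylor_cubic_remainder[where S = "{0<..<R}" and f = f
        and ?f1.0 = "\<lambda>x. f x * (\<alpha> / x - \<beta> / (R - x))"
        and ?f2.0 = "\<lambda>x. f x * ((\<alpha> / x - \<beta> / (R - x)) ^ 2 + (- \<alpha> / x ^ 2 - \<beta> / (R - x) ^ 2))"
        and ?f3.0 = f3])
    fix x assume "x \<in> {0<..<R}"
    then have x: "0 < x" "x < R" by auto
    note d = powr_mult_powr_derivs[OF x, of \<alpha> \<beta>]
    show "(f has_real_derivative f x * (\<alpha> / x - \<beta> / (R - x))) (at x)"
      using d(1) unfolding f_def .
    show "((\<lambda>x. f x * (\<alpha> / x - \<beta> / (R - x))) has_real_derivative
        f x * ((\<alpha> / x - \<beta> / (R - x)) ^ 2 + (- \<alpha> / x ^ 2 - \<beta> / (R - x) ^ 2))) (at x)"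
      using d(2) unfolding f_def .
    show "((\<lambda>x. f x * ((\<alpha> / x - \<beta> / (R - x)) ^ 2 + (- \<alpha> / x ^ 2 - \<beta> / (R - x) ^ 2)))
        has_real_derivative f3 x) (at x)"
      using d(3) unfolding f3_def f_def .
  qed (use c \<open>continuous_on {0<..<R} f3\<close> in auto)
  moreover have "poly ([:f c:] + Polynomial.smult (f c * L1) [:-c, 1:] +
      Polynomial.smult (f c * (L1 ^ 2 + L2) / 2) ([:-c, 1:] ^ 2)) x =
      f c + f c * L1 * (x - c) + f c * (L1 ^ 2 + L2) / 2 * (x - c) ^ 2" for x
    by (simp add: poly_power) (simp add: algebra_simps)
  ultimately show ?thesis by (simp only:)
qed

section \<open>Functions that are even up to second order\<close>

lemma bigo_reflect:
  fixes f g :: "complex \<Rightarrow> 'a::real_normed_field"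
  assumes "f \<in> O[at 0](g)"
  shows "(\<lambda>z. f (-z)) \<in> O[at 0](\<lambda>z. g (-z))"
proof -
  have "filterlim (uminus :: complex \<Rightarrow> complex) (at 0) (at 0)"
    unfolding filterlim_at by (auto intro!: tendsto_eq_intros simp: eventually_at_filter)
  from landau_o.big.compose[OF assms this] show ?thesis by simp
qed

text \<open>Says F = c + odd part + O(|z|^2), the odd part being O(|z|), without any
  differentiability. The class is closed under sums, products and inverses (the latter for c
  \<noteq> 0), so it can be propagated through purely algebraic formulas.\<close>

definition even_expansion :: "(complex \<Rightarrow> 'a::real_normed_field) \<Rightarrow> 'a \<Rightarrow> bool" where
  "even_expansion F c \<longleftrightarrow>
     (\<lambda>z. F z - c) \<in> O[at 0](\<lambda>z. of_real (norm z)) \<and>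
     (\<lambda>z. F z + F (-z) - 2 * c) \<in> O[at 0](\<lambda>z. of_real (norm z) ^ 2)"

lemma even_expansion_const: "even_expansion (\<lambda>_. c) c"
  by (simp add: even_expansion_def)

lemma even_expansion_ident: "even_expansion (\<lambda>z. z) 0"
  unfolding even_expansion_def by (auto intro!: bigoI[where c = 1])

lemma even_expansion_add:
  assumes "even_expansion F c" "even_expansion G d"
  shows "even_expansion (\<lambda>z. F z + G z) (c + d)"
proof -
  have "(\<lambda>z. (F z - c) + (G z - d)) \<in> O[at 0](\<lambda>z. of_real (norm z))"
    "(\<lambda>z. (F z + F (-z) - 2 * c) + (G z + G (-z) - 2 * d)) \<in> O[at 0](\<lambda>z. of_real (norm z) ^ 2)"
    using assms unfolding even_expansion_def by (simp_all only: sum_in_bigo(1))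
  then show ?thesis unfolding even_expansion_def by (simp add: algebra_simps)
qed

lemma even_expansion_sum:
  assumes "\<And>i. i \<in> I \<Longrightarrow> even_expansion (F i) (c i)"
  shows "even_expansion (\<lambda>z. \<Sum>i\<in>I. F i z) (\<Sum>i\<in>I. c i)"
  using assms
  by (induction I rule: infinite_finite_induct) (auto intro: even_expansion_const even_expansion_add)

text \<open>Odd parts are harmless in a product: two deviations of order |z| multiply to O(|z|^2),
  and the remaining terms are linear in a single deviation.\<close>

lemma even_expansion_mult:
  assumes F: "even_expansion F c" and G: "even_expansion G d"
  shows "even_expansion (\<lambda>z. F z * G z) (c * d)"
proof -
  let ?n = "\<lambda>z::complex. of_real (norm z) :: 'a"
  define f g where "f z = F z - c" and "g z = G z - d" for z
  have f: "f \<in> O[at 0](?n)" "(\<lambda>z. f z + f (-z)) \<in> O[at 0](\<lambda>z. ?n z ^ 2)"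
    using F by (simp_all add: even_expansion_def f_def[abs_def] algebra_simps)
  have g: "g \<in> O[at 0](?n)" "(\<lambda>z. g z + g (-z)) \<in> O[at 0](\<lambda>z. ?n z ^ 2)"
    using G by (simp_all add: even_expansion_def g_def[abs_def] algebra_simps)
  have fg: "(\<lambda>z. f z * g z) \<in> O[at 0](\<lambda>z. ?n z ^ 2)"
    using landau_o.big.mult[OF f(1) g(1)] by (simp add: power2_eq_square)
  have fg': "(\<lambda>z. f (-z) * g (-z)) \<in> O[at 0](\<lambda>z. ?n z ^ 2)"
    using bigo_reflect[OF fg] by simp
  have "(\<lambda>z. ?n z ^ 2) \<in> O[at 0](?n)"
  proof (rule bigoI[where c = 1])
    have "\<forall>\<^sub>F z in at (0::complex). norm z < 1"
      using eventually_at_ball[of 1 "0::complex" UNIV] by (auto elim!: eventually_mono)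
    then show "\<forall>\<^sub>F z in at 0. norm (?n z ^ 2) \<le> 1 * norm (?n z)"
      by eventually_elim (simp add: norm_power power2_eq_square mult_left_le norm_mult)
  qed
  then have "(\<lambda>z. f z * g z) \<in> O[at 0](?n)" using fg landau_o.big_trans by blast
  then have "(\<lambda>z. c * g z + d * f z + f z * g z) \<in> O[at 0](?n)"
    using f(1) g(1) by (intro sum_in_bigo) simp_all
  moreover have "(\<lambda>z. c * (g z + g (-z)) + d * (f z + f (-z)) + f z * g z + f (-z) * g (-z))
      \<in> O[at 0](\<lambda>z. ?n z ^ 2)"
    using f(2) g(2) fg fg' by (intro sum_in_bigo) simp_all
  ultimately show ?thesis
    by (simp add: even_expansion_def f_def g_def algebra_simps)
qed

lemma even_expansion_cnj:
  "even_expansion F c \<Longrightarrow> even_expansion (\<lambda>z. cnj (F z)) (cnj c)"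
proof -
  assume F: "even_expansion F c"
  have "(\<lambda>z. cnj (F z) - cnj c) = (\<lambda>z. cnj (F z - c))"
    "(\<lambda>z. cnj (F z) + cnj (F (-z)) - 2 * cnj c) = (\<lambda>z. cnj (F z + F (-z) - 2 * c))" by auto
  with F show ?thesis unfolding even_expansion_def
    by (auto simp: bigo_def simp del: complex_cnj_diff complex_cnj_add)
qed

lemma even_expansion_tendsto:
  fixes F :: "complex \<Rightarrow> 'a::real_normed_field"
  assumes "even_expansion F c"
  shows "(F \<longlongrightarrow> c) (at 0)"
proof -
  have "(\<lambda>z. of_real (norm z) :: 'a) \<in> o[at (0::complex)](\<lambda>_. 1)"
    by (intro smalloI_tendsto) (auto intro!: tendsto_eq_intros)
  then have "(\<lambda>z. F z - c) \<in> o[at 0](\<lambda>_. 1)"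
    using assms landau_o.big_small_trans unfolding even_expansion_def by blast
  from smalloD_tendsto[OF this] show ?thesis by (simp add: LIM_zero_cancel)
qed

lemma even_expansion_inverse:
  fixes F :: "complex \<Rightarrow> 'a::real_normed_field"
  assumes F: "even_expansion F c" and c: "c \<noteq> 0"
  shows "even_expansion (\<lambda>z. inverse (F z)) (inverse c)"
proof -
  let ?n = "\<lambda>z::complex. of_real (norm z) :: 'a"
  define f where "f z = F z - c" for z
  have f: "f \<in> O[at 0](?n)" "(\<lambda>z. f z + f (-z)) \<in> O[at 0](\<lambda>z. ?n z ^ 2)"
    using F by (simp_all add: even_expansion_def f_def[abs_def] algebra_simps)
  note lim = even_expansion_tendsto[OF F]
  have ne: "\<forall>\<^sub>F z in at 0. F z \<noteq> 0" using tendsto_imp_eventually_ne[OF lim c] .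
  have refl: "filterlim (uminus :: complex \<Rightarrow> complex) (at 0) (at 0)"
    unfolding filterlim_at by (auto intro!: tendsto_eq_intros simp: eventually_at_filter)
  have ne': "\<forall>\<^sub>F z in at 0. F (-z) \<noteq> 0" using ne refl unfolding filterlim_iff by blast
  have i: "(\<lambda>z. inverse (F z)) \<in> O[at 0](\<lambda>_. 1)"
    using tendsto_inverse[OF lim c] by (intro bigoI_tendsto[where c = "inverse c"]) auto
  have i': "(\<lambda>z. inverse (F (-z))) \<in> O[at 0](\<lambda>_. 1)" using bigo_reflect[OF i] by simp
  have ff: "(\<lambda>z. f z * f z) \<in> O[at 0](\<lambda>z. ?n z ^ 2)"
    using landau_o.big.mult[OF f(1) f(1)] by (simp add: power2_eq_square)
  have ff': "(\<lambda>z. f (-z) * f (-z)) \<in> O[at 0](\<lambda>z. ?n z ^ 2)" using bigo_reflect[OF ff] by simp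
  have 1: "(\<lambda>z. - inverse c * (f z * inverse (F z))) \<in> O[at 0](?n)"
    using landau_o.big.mult[OF f(1) i] by simp
  have 2: "(\<lambda>z. - (inverse c ^ 2) * (f z + f (-z)) + inverse c ^ 2 * (f z * f z * inverse (F z))
      + inverse c ^ 2 * (f (-z) * f (-z) * inverse (F (-z)))) \<in> O[at 0](\<lambda>z. ?n z ^ 2)"
    using f(2) landau_o.big.mult[OF ff i] landau_o.big.mult[OF ff' i'] by (intro sum_in_bigo) simp_all
  \<comment> \<open>The expansion of 1 / (c + f) to first order with exact remainder. Only the term
    linear in f relies on the cancellation between z and -z; the remainder is O(|z|^2) by
    itself.\<close>
  have single: "inverse (F z) = inverse c - inverse c ^ 2 * f z + inverse c ^ 2 * (f z * f z * inverse (F z))"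
    if "F z \<noteq> 0" for z using that c by (simp add: f_def field_simps power2_eq_square)
  have "\<forall>\<^sub>F z in at 0. inverse (F z) - inverse c = - inverse c * (f z * inverse (F z))"
    using ne by eventually_elim (use c in \<open>simp add: f_def field_simps\<close>)
  moreover have "\<forall>\<^sub>F z in at 0. inverse (F z) + inverse (F (-z)) - 2 * inverse c =
      - (inverse c ^ 2) * (f z + f (-z)) + inverse c ^ 2 * (f z * f z * inverse (F z))
      + inverse c ^ 2 * (f (-z) * f (-z) * inverse (F (-z)))"
    using ne ne' by eventually_elim (subst single, assumption, subst (2) single, assumption, simp add: algebra_simps)
  ultimately show ?thesis unfolding even_expansion_def
    using 1 2 by (simp only: landau_o.big.in_cong)
qed

lemma even_expansion_poly: "even_expansion (\<lambda>z. poly P z) (poly P 0)"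
proof (induction P)
  case (pCons a P)
  from even_expansion_add[OF even_expansion_const even_expansion_mult[OF even_expansion_ident pCons(2)], of a]
  show ?case by simp
qed (simp add: even_expansion_const)

lemma even_expansion_Re: "even_expansion F c \<Longrightarrow> even_expansion (\<lambda>z. Re (F z)) (Re c)"
proof -
  assume F: "even_expansion F c"
  have Re: "(\<lambda>z. Re (f z)) \<in> O[at 0](g)"
    if "f \<in> O[at 0](\<lambda>z. complex_of_real (g z))" for f g
  proof -
    from that obtain K where "\<forall>\<^sub>F z in at 0. norm (f z) \<le> K * norm (complex_of_real (g z))"
      by (elim landau_o.bigE)
    then have "\<forall>\<^sub>F z in at 0. norm (Re (f z)) \<le> K * norm (g z)"
      by eventually_elim (use abs_Re_le_cmod order_trans in auto)
    then show ?thesis by (rule bigoI)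
  qed
  have "(\<lambda>z. Re (F z - c)) \<in> O[at 0](\<lambda>z. norm z)"
    using F by (intro Re) (simp add: even_expansion_def)
  moreover have "(\<lambda>z. Re (F z + F (-z) - 2 * c)) \<in> O[at 0](\<lambda>z. norm z ^ 2)"
    using F by (intro Re) (simp add: even_expansion_def)
  ultimately show ?thesis by (simp add: even_expansion_def)
qed

lemma even_expansion_norm_square:
  "even_expansion (\<lambda>z. (cmod (poly P z))\<^sup>2) ((cmod (poly P 0))\<^sup>2)"
  using even_expansion_Re[OF even_expansion_mult[OF even_expansion_poly even_expansion_cnj[OF even_expansion_poly]], of P P]
  unfolding complex_norm_square[symmetric] by simp

lemma even_expansion_perturb:
  fixes F G :: "complex \<Rightarrow> real"
  assumes F: "even_expansion F c" and FG: "(\<lambda>z. G z - F z) \<in> O[at 0](\<lambda>z. norm z ^ 2)"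
  shows "even_expansion G c"
proof -
  have "even_expansion (\<lambda>z. G z - F z) 0"
    unfolding even_expansion_def
  proof
    have "(\<lambda>z. norm z ^ 2) \<in> O[at (0::complex)](norm)"
    proof (rule bigoI[where c = 1])
      have "\<forall>\<^sub>F z in at (0::complex). norm z < 1"
        using eventually_at_ball[of 1 "0::complex" UNIV] by (auto elim!: eventually_mono)
      then show "\<forall>\<^sub>F z in at (0::complex). norm (norm z ^ 2) \<le> 1 * norm (norm z)"
        by eventually_elim (auto simp: norm_power power2_eq_square mult_left_le)
    qed
    then show "(\<lambda>z. G z - F z - 0) \<in> O[at 0](\<lambda>z. of_real (norm z))"
      using FG landau_o.big_trans by simp blast
    show "(\<lambda>z. G z - F z + (G (- z) - F (- z)) - 2 * 0) \<in> O[at 0](\<lambda>z. of_real (norm z) ^ 2)"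
      using sum_in_bigo(1)[OF FG] bigo_reflect[OF FG] by simp
  qed
  from even_expansion_add[OF F this] show ?thesis by simp
qed

text \<open>Positivity excludes a linear term: F(z) is at most F(z) + F(-z), which is O(|z|^2)
  because the limit is 0.\<close>

lemma even_expansion_nonneg_zero:
  fixes F :: "complex \<Rightarrow> real"
  assumes F: "even_expansion F 0" and nn: "\<And>z. F z \<ge> 0"
  shows "F \<in> O[at 0](\<lambda>z. norm z ^ 2)"
proof -
  have "F \<in> O[at 0](\<lambda>z. F z + F (-z))" using nn by (intro bigoI[where c = 1]) (auto intro!: always_eventually)
  moreover have "(\<lambda>z. F z + F (-z)) \<in> O[at 0](\<lambda>z. norm z ^ 2)" using F by (simp add: even_expansion_def)
  ultimately show ?thesis by (rule landau_o.big_trans)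
qed

text \<open>Comparison of coefficients in X Q' = - Q times the sum of the series s_j, which is the
  logarithmic derivative of Q, the product of the 1 - x_j X. No division occurs, so an integral
  domain suffices.\<close>

lemma newton_identity:
  fixes x :: "'b \<Rightarrow> 'a::idom"
  assumes J: "finite J" and m: "m \<ge> 1"
  defines "q \<equiv> \<lambda>i. poly.coeff (\<Prod>j\<in>J. [:1, - x j:]) i"
  shows "(\<Sum>j\<in>J. x j ^ m) = - of_nat m * q m - (\<Sum>i=1..<m. q i * (\<Sum>j\<in>J. x j ^ (m - i)))"
proof -
  \<comment> \<open>The geometric series without its constant term, so that (1 - x_j X) s_j = x_j X
    and the zeroth power sum stays out of the identity.\<close>
  define s where "s j = Abs_fps (\<lambda>m. if m = 0 then 0 else x j ^ m)" for j
  define Q where "Q K = (\<Prod>j\<in>K. 1 - fps_const (x j) * fps_X)" for K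
  have s: "(1 - fps_const (x j) * fps_X) * s j = fps_const (x j) * fps_X" for j
  proof (rule fps_ext)
    fix i
    have "(1 - fps_const (x j) * fps_X) * s j = s j - fps_const (x j) * (fps_X * s j)"
      by (simp add: algebra_simps)
    then show "fps_nth ((1 - fps_const (x j) * fps_X) * s j) i = fps_nth (fps_const (x j) * fps_X) i"
      by (cases i; cases "i - 1") (auto simp: s_def fps_X_nth)
  qed
  have main: "fps_X * fps_deriv (Q K) = - Q K * (\<Sum>j\<in>K. s j)" if "finite K" for K
    using that
  proof induction
    case empty
    show ?case by (simp add: Q_def)
  next
    case (insert k K)
    have Q: "Q (insert k K) = (1 - fps_const (x k) * fps_X) * Q K" using insert by (simp add: Q_def)
    have "fps_X * fps_deriv (Q (insert k K)) =
        - (fps_const (x k) * fps_X) * Q K + (1 - fps_const (x k) * fps_X) * (fps_X * fps_deriv (Q K))"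
      unfolding Q by (simp add: algebra_simps)
    also have "\<dots> = - ((1 - fps_const (x k) * fps_X) * s k) * Q K
        + (1 - fps_const (x k) * fps_X) * (- Q K * (\<Sum>j\<in>K. s j))"
      unfolding insert.IH s ..
    also have "\<dots> = - Q (insert k K) * (\<Sum>j\<in>insert k K. s j)"
      unfolding Q using insert by (simp add: algebra_simps)
    finally show ?case .
  qed
  have "Q J = fps_of_poly (\<Prod>j\<in>J. [:1, - x j:])"
    unfolding Q_def fps_of_poly_prod by (intro prod.cong) (auto simp: fps_of_poly_pCons fps_of_poly_const algebra_simps)
  then have q: "fps_nth (Q J) i = q i" for i by (simp add: q_def)
  have q0: "q 0 = 1" unfolding q_def by (simp add: poly_0_coeff_0[symmetric] poly_prod)
  have "of_nat m * q m = fps_nth (fps_X * fps_deriv (Q J)) m"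
    using m by (simp add: fps_X_mult_nth q)
  also have "\<dots> = - (\<Sum>i=0..m. q i * (\<Sum>j\<in>J. fps_nth (s j) (m - i)))"
    unfolding main[OF J] by (simp add: fps_mult_nth q fps_sum_nth)
  also have "(\<Sum>i=0..m. q i * (\<Sum>j\<in>J. fps_nth (s j) (m - i))) =
      (\<Sum>i=0..<m. q i * (\<Sum>j\<in>J. fps_nth (s j) (m - i)))"
    using m by (simp add: atLeastLessThanSuc_atLeastAtMost[symmetric] s_def)
  also have "\<dots> = (\<Sum>j\<in>J. x j ^ m) + (\<Sum>i=1..<m. q i * (\<Sum>j\<in>J. x j ^ (m - i)))"
    using m q0 by (subst sum.atLeast_Suc_lessThan) (auto simp: s_def intro!: sum.cong)
  finally have "of_nat m * q m = - ((\<Sum>j\<in>J. x j ^ m) + (\<Sum>i=1..<m. q i * (\<Sum>j\<in>J. x j ^ (m - i))))" .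
  then show ?thesis by (simp only: minus_add_distrib minus_mult_left [symmetric] minus_minus) (simp add: add.commute)
qed

text \<open>Newton's identities give each power sum from the coefficients and the lower power sums
  by additions and multiplications only, and \<open>even_expansion\<close> respects these.\<close>

lemma even_expansion_power_sum:
  fixes x :: "complex \<Rightarrow> 'b \<Rightarrow> 'a::real_normed_field"
  assumes J: "finite J"
    and Q: "\<And>i. \<exists>c. even_expansion (\<lambda>z. poly.coeff (\<Prod>j\<in>J. [:1, - x z j:]) i) c"
  shows "\<exists>c. even_expansion (\<lambda>z. \<Sum>j\<in>J. x z j ^ m) c"
proof (induction m rule: less_induct)
  case (less m)
  show ?case
  proof (cases "m = 0")
    case True
    then show ?thesis using even_expansion_const by auto
  next
    case False
    from Q obtain q where q: "\<And>i. even_expansion (\<lambda>z. poly.coeff (\<Prod>j\<in>J. [:1, - x z j:]) i) (q i)" by metis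
    from less obtain r where r: "\<And>i. i < m \<Longrightarrow> even_expansion (\<lambda>z. \<Sum>j\<in>J. x z j ^ i) (r i)" by metis
    have "even_expansion (\<lambda>z. - of_nat m * poly.coeff (\<Prod>j\<in>J. [:1, - x z j:]) m +
        (\<Sum>i=1..<m. - 1 * (poly.coeff (\<Prod>j\<in>J. [:1, - x z j:]) i * (\<Sum>j\<in>J. x z j ^ (m - i)))))
        (- of_nat m * q m + (\<Sum>i=1..<m. - 1 * (q i * r (m - i))))"
      by (intro even_expansion_add even_expansion_mult even_expansion_sum even_expansion_const q r) auto
    then show ?thesis using False by (subst newton_identity[OF J]) (auto simp: sum_negf)
  qed
qed

lemma bounded_family_convergent_subsequence:
  fixes x :: "nat \<Rightarrow> nat \<Rightarrow> real"
  assumes "\<And>i j. j < n \<Longrightarrow> x i j \<in> {a..b}"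
  shows "\<exists>y r. strict_mono (r :: nat \<Rightarrow> nat) \<and> (\<forall>j<n. y j \<in> {a..b} \<and> (\<lambda>i. x (r i) j) \<longlonglongrightarrow> y j)"
  using assms
proof (induction n)
  case 0
  show ?case by (intro exI[of _ id] exI) (auto simp: strict_mono_def)
next
  case (Suc n)
  have "\<exists>y r. strict_mono (r :: nat \<Rightarrow> nat) \<and> (\<forall>j<n. y j \<in> {a..b} \<and> (\<lambda>i. x (r i) j) \<longlonglongrightarrow> y j)"
    by (rule Suc.IH) (rule Suc.prems, simp)
  then obtain y r where r: "strict_mono (r :: nat \<Rightarrow> nat)"
    "\<forall>j<n. y j \<in> {a..b} \<and> (\<lambda>i. x (r i) j) \<longlonglongrightarrow> y j"
    by (elim exE conjE) (rule that; assumption)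
  have "seq_compact {a..b}" using compact_Icc compact_imp_seq_compact by blast
  then obtain l s where s: "l \<in> {a..b}" "strict_mono s" "((\<lambda>i. x (r i) n) \<circ> s) \<longlonglongrightarrow> l"
    using seq_compactE[of "{a..b}" "\<lambda>i. x (r i) n"] Suc.prems[of n] by blast
  have "(\<lambda>i. x (r (s i)) j) \<longlonglongrightarrow> y j" if "j < n" for j
    using LIMSEQ_subseq_LIMSEQ[OF _ s(2)] r(2) that by (force simp: o_def)
  moreover have "(\<lambda>i. x (r (s i)) n) \<longlonglongrightarrow> l" using s(3) by (simp add: o_def)
  ultimately have "\<forall>j<Suc n. (y(n := l)) j \<in> {a..b} \<and> (\<lambda>i. x ((r \<circ> s) i) j) \<longlonglongrightarrow> (y(n := l)) j"
    using r(2) s(1) by (simp add: less_Suc_eq)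
  moreover have "strict_mono (r \<circ> s)" using r(1) s(2) by (rule strict_mono_o)
  ultimately show ?case by blast
qed

section \<open>Windows of singular values\<close>

lemma linear_poly_lower_bound:
  fixes r :: "real poly"
  assumes "\<And>x. x \<in> {lo..hi} \<Longrightarrow> poly r x > 0"
  shows "\<exists>m>0. \<forall>x\<in>{lo..hi}. poly r x \<ge> m"
proof (cases "lo \<le> hi")
  case True
  then have "\<exists>x\<in>{lo..hi}. \<forall>y\<in>{lo..hi}. poly r x \<le> poly r y"
    by (intro continuous_attains_inf compact_Icc) (auto intro!: continuous_intros)
  with assms show ?thesis by blast
qed (auto intro: exI[of _ 1])

lemma even_expansion_poly_sum:
  fixes x :: "complex \<Rightarrow> nat \<Rightarrow> real"
  assumes ps: "\<And>m. \<exists>c. even_expansion (\<lambda>z. \<Sum>j<n. x z j ^ m) c"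
  shows "\<exists>c. even_expansion (\<lambda>z. \<Sum>j<n. poly q (x z j)) c"
proof -
  from ps obtain c where c: "\<And>m. even_expansion (\<lambda>z. \<Sum>j<n. x z j ^ m) (c m)" by metis
  have "even_expansion (\<lambda>z. \<Sum>m\<le>degree q. poly.coeff q m * (\<Sum>j<n. x z j ^ m))
      (\<Sum>m\<le>degree q. poly.coeff q m * c m)"
    by (intro even_expansion_sum even_expansion_mult even_expansion_const c)
  moreover have "(\<Sum>m\<le>degree q. poly.coeff q m * (\<Sum>j<n. x z j ^ m)) = (\<Sum>j<n. poly q (x z j))" for z
    by (simp add: poly_altdef sum_distrib_left) (rule sum.swap)
  ultimately show ?thesis by auto
qed

text \<open>
  The limit points of the $\nu_j$ come from compactness. The polynomial $w$ below vanishes at them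
  and is nonnegative on $[0,1]$, so $\sum_j w(\nu_j)$ is even up to $O(|z|^2)$ with minimum $0$ at
  the origin, hence $O(|z|^2)$. This controls the distance of the $\nu_j$ to their limits
  without any perturbation theory of eigenvalues.
\<close>

lemma window_sum_expansion:
  fixes \<nu> :: "complex \<Rightarrow> nat \<Rightarrow> real" and \<beta> :: real
  assumes \<nu>: "\<And>z j. j < n \<Longrightarrow> \<nu> z j \<in> {0..1}"
    and ps: "\<And>m. \<exists>c. even_expansion (\<lambda>z. \<Sum>j<n. \<nu> z j ^ m) c"
  shows "\<forall>\<^sub>F a in at_right 0.
    (\<exists>c. even_expansion (\<lambda>z. \<Sum>j<n. if \<nu> z j \<in> {a..1 - a} then ((1 - \<nu> z j) / \<nu> z j) powr \<beta> else 0) c) \<and>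
    (\<exists>K. \<forall>\<^sub>F z in at 0. \<forall>j<n. \<nu> z j \<in> {a..1 - a} \<or> \<nu> z j \<le> K * norm z ^ 2 \<or> 1 - \<nu> z j \<le> K * norm z ^ 2)"
proof -
  \<comment> \<open>Limit points along a single sequence are enough: the full limit of the sum of
    the w(\<nu>_j) exists by \<open>even_expansion\<close>, so it can be computed on a
    subsequence.\<close>
  define \<zeta> :: "nat \<Rightarrow> complex" where "\<zeta> i = of_real (inverse (real (Suc i)))" for i
  have "(\<zeta> \<longlongrightarrow> of_real 0) sequentially"
    unfolding \<zeta>_def by (intro tendsto_of_real LIMSEQ_inverse_real_of_nat)
  moreover have "\<zeta> i \<noteq> 0" for i unfolding \<zeta>_def of_real_eq_0_iff by simp
  ultimately have \<zeta>: "filterlim \<zeta> (at 0) sequentially"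
    unfolding filterlim_at by (simp add: always_eventually)
  obtain \<nu>0 r where r: "strict_mono (r :: nat \<Rightarrow> nat)"
    and \<nu>0: "\<And>j. j < n \<Longrightarrow> \<nu>0 j \<in> {0..1}" "\<And>j. j < n \<Longrightarrow> (\<lambda>i. \<nu> (\<zeta> (r i)) j) \<longlonglongrightarrow> \<nu>0 j"
    using bounded_family_convergent_subsequence[of n "\<lambda>i. \<nu> (\<zeta> i)" 0 1] \<nu> by blast
  have \<zeta>r: "filterlim (\<lambda>i. \<zeta> (r i)) (at 0) sequentially"
    using filterlim_compose[OF \<zeta> filterlim_subseq[OF r]] by (simp add: o_def)
  define C where "C = \<nu>0 ` {..<n} \<inter> {0<..<1}"
  have finC: "finite C" by (simp add: C_def)
  define v where "v = (\<Prod>c\<in>C. [:-c, 1:] ^ 2)"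
  \<comment> \<open>Interior limit points get double zeros, which keep \<open>w\<close> nonnegative
    on [0,1]. At 0 and 1 simple zeros already do so, and they yield the linear bounds on \<nu> and 1
    - \<nu> at the end.\<close>
  define w where "w = [:0, 1:] * [:1, -1:] * v"
  have v: "poly v x = (\<Prod>c\<in>C. (x - c) ^ 2)" for x by (simp add: v_def poly_prod poly_power)
  have w: "poly w x = x * (1 - x) * poly v x" for x by (simp add: w_def algebra_simps)
  have w_nonneg: "poly w x \<ge> 0" if "x \<in> {0..1}" for x
    using that unfolding w v by (auto intro!: mult_nonneg_nonneg prod_nonneg)
  from even_expansion_poly_sum[OF ps] obtain c0 where c0:
    "even_expansion (\<lambda>z. \<Sum>j<n. poly w (\<nu> z j)) c0" by blast
  have "(\<lambda>i. \<Sum>j<n. poly w (\<nu> (\<zeta> (r i)) j)) \<longlonglongrightarrow> (\<Sum>j<n. poly w (\<nu>0 j))"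
    using \<nu>0(2) by (intro tendsto_sum tendsto_poly) simp
  moreover have "(\<lambda>i. \<Sum>j<n. poly w (\<nu> (\<zeta> (r i)) j)) \<longlonglongrightarrow> c0"
    using filterlim_compose[OF even_expansion_tendsto[OF c0] \<zeta>r] .
  moreover have root: "poly w (\<nu>0 j) = 0" if "j < n" for j
  proof (cases "\<nu>0 j \<in> C")
    case True
    then show ?thesis using finC by (auto simp: w v)
  next
    case False
    then have "\<nu>0 j = 0 \<or> \<nu>0 j = 1" using \<nu>0(1)[OF that] that by (auto simp: C_def)
    then show ?thesis by (auto simp: w)
  qed
  moreover have "(\<Sum>j<n. poly w (\<nu>0 j)) = 0" by (rule sum.neutral) (use root in simp)
  ultimately have "c0 = 0" by (metis LIMSEQ_unique)
  define W where "W z = (\<Sum>j<n. poly w (\<nu> z j))" for z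
  have W0: "W z \<ge> 0" for z unfolding W_def using w_nonneg \<nu> by (intro sum_nonneg) auto
  have WO: "W \<in> O[at 0](\<lambda>z. norm z ^ 2)"
    using c0 \<open>c0 = 0\<close> W0 unfolding W_def by (intro even_expansion_nonneg_zero) auto
  then obtain KW where KW: "\<forall>\<^sub>F z in at 0. norm (W z) \<le> KW * norm (norm z ^ 2)"
    by (elim landau_o.bigE)

  \<comment> \<open>All interior limit points have to lie strictly inside the window, away from its
    edges, where the cut-off function jumps.\<close>
  have good: "(\<exists>c. even_expansion (\<lambda>z. \<Sum>j<n. if \<nu> z j \<in> {a..1 - a} then ((1 - \<nu> z j) / \<nu> z j) powr \<beta> else 0) c) \<and>
    (\<exists>K. \<forall>\<^sub>F z in at 0. \<forall>j<n. \<nu> z j \<in> {a..1 - a} \<or> \<nu> z j \<le> K * norm z ^ 2 \<or> 1 - \<nu> z j \<le> K * norm z ^ 2)"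
    if a: "0 < a" "a < 1 / 2" "\<And>c. c \<in> C \<Longrightarrow> a < c \<and> c < 1 - a" for a
  proof
    define f where "f x = x powr (-\<beta>) * (1 - x) powr \<beta>" for x :: real
    define g where "g x = (if x \<in> {a..1 - a} then ((1 - x) / x) powr \<beta> else 0)" for x :: real
    have gf: "g x = f x" if "x \<in> {a..1 - a}" for x
      using that a(1) by (auto simp: g_def f_def powr_divide powr_minus field_simps)
    have "continuous_on {a..1 - a} f" unfolding f_def using a(1) by (intro continuous_intros) auto
    then have "bounded (f ` {a..1 - a})"
      by (intro compact_imp_bounded compact_continuous_image compact_Icc)
    then obtain G where G: "\<And>x. x \<in> {a..1 - a} \<Longrightarrow> \<bar>f x\<bar> \<le> G"
      unfolding bounded_iff by (metis imageI real_norm_def)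
    have gG: "\<bar>g x\<bar> \<le> \<bar>G\<bar>" for x
      using G[of x] gf[of x] by (cases "x \<in> {a..1 - a}") (auto simp: g_def)
    have "\<exists>T. \<exists>\<delta>>0. \<exists>K. \<forall>x. \<bar>x - c\<bar> < \<delta> \<longrightarrow> \<bar>g x - poly T x\<bar> \<le> K * \<bar>x - c\<bar> ^ 3"
      if c: "c \<in> C \<union> {0, 1}" for c
    proof (cases "c \<in> C")
      \<comment> \<open>The remaining nodes are 0 and 1; the cut-off function vanishes near them, so
        its Taylor polynomial there is 0.\<close>
      case False
      then have "\<forall>x. \<bar>x - c\<bar> < a \<longrightarrow> \<bar>g x - poly 0 x\<bar> \<le> 0 * \<bar>x - c\<bar> ^ 3"
        using c by (auto simp: g_def)
      then show ?thesis using a(1) by blast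
    next
      case True
      note ac = a(3)[OF True]
      define T where "T = [:f c:] + Polynomial.smult (f c * (- \<beta> / c - \<beta> / (1 - c))) [:-c, 1:] +
        Polynomial.smult (f c * ((- \<beta> / c - \<beta> / (1 - c)) ^ 2 + (- (- \<beta>) / c ^ 2 - \<beta> / (1 - c) ^ 2)) / 2) ([:-c, 1:] ^ 2)"
      have "0 < c" "c < 1" using ac a(1) by auto
      note powr_mult_powr_taylor[OF this, of "- \<beta>" \<beta>, folded f_def, folded T_def]
      then
      obtain \<delta> K where T: "\<delta> > 0" "\<And>x. \<bar>x - c\<bar> < \<delta> \<Longrightarrow> \<bar>f x - poly T x\<bar> \<le> K * \<bar>x - c\<bar> ^ 3"
        by blast
      have "\<bar>g x - poly T x\<bar> \<le> K * \<bar>x - c\<bar> ^ 3" if "\<bar>x - c\<bar> < min \<delta> (min (c - a) (1 - a - c))" for x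
        using T(2)[of x] gf[of x] that by (smt (verit) atLeastAtMost_iff min_less_iff_conj)
      then show ?thesis using T(1) ac
        by (intro exI[of _ T] exI[of _ "min \<delta> (min (c - a) (1 - a - c))"]) auto
    qed
    then obtain T where T: "\<And>c. c \<in> C \<union> {0, 1} \<Longrightarrow> \<exists>\<delta>>0. \<exists>K. \<forall>x. \<bar>x - c\<bar> < \<delta> \<longrightarrow> \<bar>g x - poly (T c) x\<bar> \<le> K * \<bar>x - c\<bar> ^ 3"
      by metis
    have "finite (C \<union> {0, 1})" using finC by simp
    from hermite_interpolation_bound[OF this gG T, of 0 1]
    obtain q K where K: "K \<ge> 0"
      "\<And>x. x \<in> {0..1} \<Longrightarrow> \<bar>g x - poly q x\<bar> \<le> K * (\<Prod>c\<in>C \<union> {0, 1}. \<bar>x - c\<bar> ^ 3)" by blast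
    have qw: "\<bar>g x - poly q x\<bar> \<le> K * poly w x" if x: "x \<in> {0..1}" for x
    proof -
      \<comment> \<open>On [0,1] the cubic interpolation weight is dominated by \<open>w\<close>:
        cubes by squares at the interior nodes, and by first powers at 0 and 1.\<close>
      have cube: "\<bar>x - c\<bar> ^ 3 \<le> (x - c) ^ 2" if "c \<in> {0..1}" for c
      proof -
        have "\<bar>x - c\<bar> \<le> 1" using that x by auto
        then have "\<bar>x - c\<bar> ^ 3 \<le> \<bar>x - c\<bar> ^ 2" by (intro power_decreasing) auto
        then show ?thesis by simp
      qed
      have "(\<Prod>c\<in>C \<union> {0, 1}. \<bar>x - c\<bar> ^ 3) = \<bar>x - 0\<bar> ^ 3 * \<bar>x - 1\<bar> ^ 3 * (\<Prod>c\<in>C. \<bar>x - c\<bar> ^ 3)"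
        using finC by (subst prod.union_disjoint) (auto simp: C_def)
      also have "\<dots> \<le> \<bar>x - 0\<bar> ^ 1 * \<bar>x - 1\<bar> ^ 1 * (\<Prod>c\<in>C. (x - c) ^ 2)"
        using x by (intro mult_mono power_decreasing prod_mono conjI cube mult_nonneg_nonneg prod_nonneg)
          (auto simp: C_def)
      also have "\<dots> = poly w x" using x by (simp add: w v)
      finally show ?thesis using K(2)[OF x] K(1) by (meson mult_left_mono order_trans)
    qed
    from even_expansion_poly_sum[OF ps] obtain c where c:
      "even_expansion (\<lambda>z. \<Sum>j<n. poly q (\<nu> z j)) c" by blast
    have "(\<lambda>z. (\<Sum>j<n. g (\<nu> z j)) - (\<Sum>j<n. poly q (\<nu> z j))) \<in> O[at 0](W)"
    proof (rule bigoI[where c = K], rule always_eventually, rule allI)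
      fix z
      have "\<bar>(\<Sum>j<n. g (\<nu> z j)) - (\<Sum>j<n. poly q (\<nu> z j))\<bar> \<le> (\<Sum>j<n. \<bar>g (\<nu> z j) - poly q (\<nu> z j)\<bar>)"
        unfolding sum_subtractf[symmetric] by (rule sum_abs)
      also have "\<dots> \<le> (\<Sum>j<n. K * poly w (\<nu> z j))" using \<nu> by (intro sum_mono qw) auto
      also have "\<dots> = K * W z" by (simp add: W_def sum_distrib_left)
      finally show "norm ((\<Sum>j<n. g (\<nu> z j)) - (\<Sum>j<n. poly q (\<nu> z j))) \<le> K * norm (W z)"
        using W0[of z] by simp
    qed
    from even_expansion_perturb[OF c landau_o.big_trans[OF this WO]]
    show "\<exists>c. even_expansion (\<lambda>z. \<Sum>j<n. if \<nu> z j \<in> {a..1 - a} then ((1 - \<nu> z j) / \<nu> z j) powr \<beta> else 0) c"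
      unfolding g_def by blast

    have vpos: "poly v x > 0" if "x \<notin> C" for x
      unfolding v using that by (intro prod_pos) auto
    have low_eq: "poly ([:1, -1:] * v) x = (1 - x) * poly v x" for x by (simp add: algebra_simps)
    have high_eq: "poly ([:0, 1:] * v) x = x * poly v x" for x by (simp add: algebra_simps)
    \<comment> \<open>On [0,a] the only zero of \<open>w\<close> is the simple one at 0, so there
      \<nu> is at most a constant times w(\<nu>). The interval [1 - a, 1] is treated
      symmetrically.\<close>
    have "\<exists>m>0. \<forall>x\<in>{0..a}. poly ([:1, -1:] * v) x \<ge> m"
    proof (rule linear_poly_lower_bound)
      fix x assume x: "x \<in> {0..a}"
      then have "x \<notin> C" using a(3) by force
      with vpos x a show "0 < poly ([:1, -1:] * v) x" unfolding low_eq by (intro mult_pos_pos) auto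
    qed
    then obtain m1 where m1: "m1 > 0" "\<And>x. x \<in> {0..a} \<Longrightarrow> (1 - x) * poly v x \<ge> m1"
      unfolding low_eq by blast
    have "\<exists>m>0. \<forall>x\<in>{1 - a..1}. poly ([:0, 1:] * v) x \<ge> m"
    proof (rule linear_poly_lower_bound)
      fix x assume x: "x \<in> {1 - a..1}"
      then have "x \<notin> C" using a(3) by force
      with vpos x a show "0 < poly ([:0, 1:] * v) x" unfolding high_eq by (intro mult_pos_pos) auto
    qed
    then obtain m2 where m2: "m2 > 0" "\<And>x. x \<in> {1 - a..1} \<Longrightarrow> x * poly v x \<ge> m2"
      unfolding high_eq by blast
    define m where "m = min m1 m2"
    have m: "m > 0" using m1 m2 by (simp add: m_def)
    have low: "x \<le> poly w x / m" if "x \<in> {0..a}" for x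
    proof -
      have "x * m \<le> x * ((1 - x) * poly v x)" using that m1(2)[OF that] by (intro mult_left_mono) (auto simp: m_def)
      then show ?thesis using m by (simp add: w field_simps)
    qed
    have high: "1 - x \<le> poly w x / m" if "x \<in> {1 - a..1}" for x
    proof -
      have "(1 - x) * m \<le> (1 - x) * (x * poly v x)" using that m2(2)[OF that] by (intro mult_left_mono) (auto simp: m_def)
      then show ?thesis using m by (simp add: w field_simps)
    qed
    have "\<forall>\<^sub>F z in at 0. \<forall>j<n. \<nu> z j \<in> {a..1 - a} \<or> \<nu> z j \<le> KW / m * norm z ^ 2 \<or> 1 - \<nu> z j \<le> KW / m * norm z ^ 2"
      using KW
    proof eventually_elim
      case (elim z)
      show ?case
      proof (intro allI impI)
        fix j assume j: "j < n"
        have "poly w (\<nu> z j) \<le> W z"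
          unfolding W_def using j w_nonneg \<nu> by (intro member_le_sum) auto
        also have "\<dots> \<le> KW * norm z ^ 2" using elim W0[of z] by simp
        finally have "poly w (\<nu> z j) / m \<le> KW / m * norm z ^ 2" using m by (simp add: field_simps)
        then show "\<nu> z j \<in> {a..1 - a} \<or> \<nu> z j \<le> KW / m * norm z ^ 2 \<or> 1 - \<nu> z j \<le> KW / m * norm z ^ 2"
          using low[of "\<nu> z j"] high[of "\<nu> z j"] \<nu>[OF j, of z]
          by (cases "\<nu> z j \<le> a"; cases "1 - a \<le> \<nu> z j") force+
      qed
    qed
    then show "\<exists>K. \<forall>\<^sub>F z in at 0. \<forall>j<n. \<nu> z j \<in> {a..1 - a} \<or> \<nu> z j \<le> K * norm z ^ 2 \<or> 1 - \<nu> z j \<le> K * norm z ^ 2"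
      by blast
  qed
  have "\<forall>\<^sub>F a in at_right 0. \<forall>c\<in>C. (a::real) < c \<and> c < 1 - a"
  proof (intro eventually_ball_finite finC ballI)
    fix c assume "c \<in> C"
    then have "0 < min c (1 - c)" by (auto simp: C_def)
    from eventually_at_right_real[OF this] show "\<forall>\<^sub>F a in at_right 0. a < c \<and> c < 1 - a"
      by eventually_elim auto
  qed
  moreover have "\<forall>\<^sub>F a in at_right 0. (0::real) < a \<and> a < 1 / 2"
    by (auto simp: eventually_at_right_field intro!: exI[of _ "1/2"])
  ultimately show ?thesis by eventually_elim (intro good; blast)
qed

section \<open>Singular values and Gram determinants\<close>

lemma mat_adjoint_carrier [simp]:
  "A \<in> carrier_mat n m \<Longrightarrow> mat_adjoint A \<in> carrier_mat m n"
  unfolding mat_adjoint_def by auto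

lemma mat_adjoint_index [simp]:
  fixes A :: "complex mat"
  assumes "i < dim_col A" "j < dim_row A"
  shows "mat_adjoint A $$ (i, j) = cnj (A $$ (j, i))"
  using assms unfolding mat_adjoint_def by (simp add: mat_of_rows_def)

lemma mat_adjoint_dim [simp]:
  "dim_row (mat_adjoint A) = dim_col A" "dim_col (mat_adjoint A) = dim_row A"
  unfolding mat_adjoint_def by auto

lemma mat_mult_index_sum:
  assumes "A \<in> carrier_mat n k" "B \<in> carrier_mat k m" "i < n" "j < m"
  shows "(A * B) $$ (i, j) = (\<Sum>l<k. A $$ (i, l) * B $$ (l, j))"
  using assms by (simp add: scalar_prod_def lessThan_atLeast0)

lemma mat_adjoint_mult:
  fixes A B :: "complex mat"
  assumes A: "A \<in> carrier_mat n k" and B: "B \<in> carrier_mat k m"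
  shows "mat_adjoint (A * B) = mat_adjoint B * mat_adjoint A"
proof (rule eq_matI)
  fix i j assume "i < dim_row (mat_adjoint B * mat_adjoint A)" "j < dim_col (mat_adjoint B * mat_adjoint A)"
  then have ij: "i < m" "j < n" using A B by auto
  have "mat_adjoint (A * B) $$ (i, j) = cnj ((A * B) $$ (j, i))" using ij A B by simp
  also have "\<dots> = (\<Sum>l<k. cnj (A $$ (j, l)) * cnj (B $$ (l, i)))"
    by (subst mat_mult_index_sum[OF A B]) (use ij in auto)
  also have "\<dots> = (mat_adjoint B * mat_adjoint A) $$ (i, j)"
    using A B ij by (subst mat_mult_index_sum[of _ m k _ n]) (auto intro!: sum.cong)
  finally show "mat_adjoint (A * B) $$ (i, j) = (mat_adjoint B * mat_adjoint A) $$ (i, j)" .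
qed (use A B in auto)

lemma mat_adjoint_adjoint [simp]: "mat_adjoint (mat_adjoint (A :: complex mat)) = A"
  by (rule eq_matI) auto

section \<open>Traces and triangular matrices\<close>

definition mat_trace :: "nat \<Rightarrow> 'a::comm_ring_1 mat \<Rightarrow> 'a" where
  "mat_trace n A = (\<Sum>i<n. A $$ (i, i))"

lemma mat_trace_comm:
  assumes "A \<in> carrier_mat n n" "B \<in> carrier_mat n n"
  shows "mat_trace n (A * B) = mat_trace n (B * A)"
proof -
  have "mat_trace n (A * B) = (\<Sum>i<n. \<Sum>l<n. A $$ (i, l) * B $$ (l, i))"
    unfolding mat_trace_def using assms by (intro sum.cong refl mat_mult_index_sum) auto
  also have "\<dots> = (\<Sum>l<n. \<Sum>i<n. B $$ (l, i) * A $$ (i, l))"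
    by (subst sum.swap) (simp add: mult.commute)
  also have "\<dots> = mat_trace n (B * A)"
    unfolding mat_trace_def using assms by (intro sum.cong refl mat_mult_index_sum[symmetric]) auto
  finally show ?thesis .
qed

lemma upper_triangular_mult:
  fixes A B :: "'a::comm_ring_1 mat"
  assumes A: "A \<in> carrier_mat n n" "upper_triangular A" and B: "B \<in> carrier_mat n n" "upper_triangular B"
  shows "upper_triangular (A * B)" and "i < n \<Longrightarrow> (A * B) $$ (i, i) = A $$ (i, i) * B $$ (i, i)"
proof -
  show "upper_triangular (A * B)"
  proof
    fix i j assume ij: "j < i" "i < dim_row (A * B)"
    then have i: "i < n" using A by simp
    have "A $$ (i, l) * B $$ (l, j) = 0" if "l < n" for l
    proof (cases "l < i")
      case True
      then show ?thesis using upper_triangularD[OF A(2) True] i A by simp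
    next
      case False
      then have jl: "j < l" using ij by simp
      show ?thesis using upper_triangularD[OF B(2) jl] that B by simp
    qed
    then show "(A * B) $$ (i, j) = 0" using ij i A B by (subst mat_mult_index_sum[of A n n B n]) auto
  qed
  assume i: "i < n"
  have "(A * B) $$ (i, i) = (\<Sum>l<n. A $$ (i, l) * B $$ (l, i))"
    using A B i by (intro mat_mult_index_sum) auto
  also have "\<dots> = (\<Sum>l<n. if l = i then A $$ (i, i) * B $$ (i, i) else 0)"
  proof (intro sum.cong refl)
    fix l assume "l \<in> {..<n}"
    then show "A $$ (i, l) * B $$ (l, i) = (if l = i then A $$ (i, i) * B $$ (i, i) else 0)"
      using i A B upper_triangularD[OF A(2), of l i] upper_triangularD[OF B(2), of i l]
      by (cases l i rule: linorder_cases) auto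
  qed
  finally show "(A * B) $$ (i, i) = A $$ (i, i) * B $$ (i, i)" using i by simp
qed

lemma upper_triangular_pow:
  fixes A :: "'a::comm_ring_1 mat"
  assumes A: "A \<in> carrier_mat n n" "upper_triangular A"
  shows "upper_triangular (A ^\<^sub>m m) \<and> (\<forall>i<n. (A ^\<^sub>m m) $$ (i, i) = A $$ (i, i) ^ m)"
proof (induction m)
  case 0
  show ?case using A by auto
next
  case (Suc m)
  have "A ^\<^sub>m m \<in> carrier_mat n n" using A by simp
  with Suc upper_triangular_mult[of "A ^\<^sub>m m" n A] A show ?case by (simp add: mult.commute)
qed

text \<open>Pairing the eigenvector equation with v gives e |v|^2 = |Xv|^2.\<close>

lemma adjoint_mult_self_eigenvalue_nonneg:
  fixes X :: "complex mat"
  assumes X: "X \<in> carrier_mat n n" and e: "eigenvalue (mat_adjoint X * X) e"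
  shows "e = of_real (Re e)" "Re e \<ge> 0"
proof -
  let ?H = "mat_adjoint X * X"
  from e X obtain v where v: "v \<in> carrier_vec n" "v \<noteq> 0\<^sub>v n" "?H *\<^sub>v v = e \<cdot>\<^sub>v v"
    unfolding eigenvalue_def eigenvector_def by auto
  define y where "y = X *\<^sub>v v"
  have y: "y \<in> carrier_vec n" using X v by (simp add: y_def)
  have yk: "y $ k = (\<Sum>i<n. X $$ (k, i) * v $ i)" if "k < n" for k
    using that X v by (simp add: y_def scalar_prod_def lessThan_atLeast0)
  have "?H *\<^sub>v v = mat_adjoint X *\<^sub>v y"
    unfolding y_def using X v by (intro assoc_mult_mat_vec[of _ n n _ n]) auto
  then have ev: "(\<Sum>k<n. cnj (X $$ (k, i)) * y $ k) = e * v $ i" if "i < n" for i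
    using arg_cong[OF v(3), of "\<lambda>u. u $ i"] that X y v(1) by (simp add: scalar_prod_def lessThan_atLeast0)
  have "e * of_real (\<Sum>i<n. (cmod (v $ i))\<^sup>2) = (\<Sum>i<n. cnj (v $ i) * (e * v $ i))"
    by (simp only: of_real_sum sum_distrib_left complex_norm_square mult_ac)
  also have "\<dots> = (\<Sum>i<n. cnj (v $ i) * (\<Sum>k<n. cnj (X $$ (k, i)) * y $ k))"
    using ev by simp
  also have "\<dots> = (\<Sum>k<n. cnj (y $ k) * y $ k)"
    unfolding sum_distrib_left by (subst sum.swap) (simp add: yk sum_distrib_right sum_distrib_left mult_ac)
  also have "\<dots> = of_real (\<Sum>k<n. (cmod (y $ k))\<^sup>2)"
    by (simp only: of_real_sum complex_norm_square mult_ac)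
  finally have eq: "e * of_real (\<Sum>i<n. (cmod (v $ i))\<^sup>2) = of_real (\<Sum>k<n. (cmod (y $ k))\<^sup>2)" .
  have "\<exists>i<n. v $ i \<noteq> 0" using v(1,2) by (metis carrier_vecD eq_vecI index_zero_vec)
  then have pos: "(\<Sum>i<n. (cmod (v $ i))\<^sup>2) > 0" by (auto intro!: sum_pos2)
  with eq have "e = of_real ((\<Sum>k<n. (cmod (y $ k))\<^sup>2) / (\<Sum>i<n. (cmod (v $ i))\<^sup>2))"
    by (metis nonzero_eq_divide_eq of_real_divide of_real_eq_0_iff less_irrefl)
  moreover have "(\<Sum>k<n. (cmod (y $ k))\<^sup>2) / (\<Sum>i<n. (cmod (v $ i))\<^sup>2) \<ge> 0"
    by (intro divide_nonneg_nonneg sum_nonneg) auto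
  ultimately show "e = of_real (Re e)" "Re e \<ge> 0" by auto
qed

lemma proots_linear_factors:
  fixes es :: "'a::idom list"
  shows "proots (\<Prod>a\<leftarrow>es. [:-a, 1:]) = mset es"
proof (induction es)
  case (Cons a es)
  have "(\<Prod>a\<leftarrow>es. [:-a, 1:]) \<noteq> 0" by (auto simp: prod_list_zero_iff)
  then have "proots ([:-a, 1:] * (\<Prod>a\<leftarrow>es. [:-a, 1:])) = {#a#} + mset es"
    using Cons by (subst proots_mult) auto
  also have "{#a#} + mset es = mset (a # es)" by simp
  finally show ?case by (simp only: list.map prod_list.Cons)
qed simp

text \<open>A single Schur form serves all clauses, so one enumeration x computes the Schatten sum,
  the traces of powers and the determinants at once. Later arguments reach the eigenvalues only
  through these quantities.\<close>

lemma squared_singular_values_exist: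
  fixes X :: "complex mat"
  assumes X: "X \<in> carrier_mat n n"
  shows "\<exists>x :: nat \<Rightarrow> real. (\<forall>j. x j \<ge> 0) \<and>
    (\<forall>p>0. schatten_powr p X = (\<Sum>j<n. x j powr (p / 2))) \<and>
    (\<forall>m. mat_trace n ((mat_adjoint X * X) ^\<^sub>m m) = of_real (\<Sum>j<n. x j ^ m)) \<and>
    (\<forall>c. det (1\<^sub>m n + c \<cdot>\<^sub>m (mat_adjoint X * X)) = (\<Prod>j<n. 1 + c * of_real (x j)))"
proof -
  define H where "H = mat_adjoint X * X"
  have H: "H \<in> carrier_mat n n" unfolding H_def using X by (intro mult_carrier_mat[of _ n n]) auto
  from char_poly_factorized[OF H] obtain es where es: "char_poly H = (\<Prod>a\<leftarrow>es. [:-a, 1:])" "length es = n"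
    by blast
  obtain B P Q where BPQ: "schur_decomposition H es = (B, P, Q)" by (cases "schur_decomposition H es") auto
  from schur_decomposition[OF H es(1) BPQ]
  have sim: "similar_mat_wit H B P Q" and ut: "upper_triangular B" and diag: "diag_mat B = es" by auto
  from similar_mat_witD2[OF H sim]
  have PQ: "P * Q = 1\<^sub>m n" "Q * P = 1\<^sub>m n" "H = P * B * Q"
    and car: "B \<in> carrier_mat n n" "P \<in> carrier_mat n n" "Q \<in> carrier_mat n n" by auto
  have Bes: "B $$ (j, j) = es ! j" if "j < n" for j
    using that diag car by (auto simp: diag_mat_def)
  \<comment> \<open>Set to 0 beyond n, so that nonnegativity holds for every index.\<close>
  define x where "x j = (if j < n then Re (es ! j) else 0)" for j
  have "eigenvalue H (es ! j)" if "j < n" for j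
  proof -
    have "es ! j \<in> set es" using that es(2) by simp
    then show ?thesis
      unfolding eigenvalue_root_char_poly[OF H] es(1) poly_prod_list prod_list_zero_iff
      by (auto simp: image_iff)
  qed
  from adjoint_mult_self_eigenvalue_nonneg[OF X this[unfolded H_def]]
  have x: "es ! j = of_real (x j)" "x j \<ge> 0" if "j < n" for j using that by (auto simp: x_def)
  have "schatten_powr p X = (\<Sum>j<n. x j powr (p / 2))" if "p > 0" for p
  proof -
    have "proots (char_poly H) = mset es"
      unfolding es(1) by (rule proots_linear_factors)
    then have "schatten_powr p X = (\<Sum>e\<leftarrow>es. sqrt (Re e) powr p)"
      unfolding schatten_powr_def singular_values_def H_def[symmetric]
      by (simp only: mset_map[symmetric] sum_mset_sum_list map_map o_def)
    also have "\<dots> = (\<Sum>j<n. sqrt (Re (es ! j)) powr p)"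
      using es(2) by (simp add: sum_list_sum_nth lessThan_atLeast0)
    also have "\<dots> = (\<Sum>j<n. x j powr (p / 2))"
    proof (intro sum.cong refl)
      fix j assume "j \<in> {..<n}"
      then have "Re (es ! j) = x j" "x j \<ge> 0" using x(2) by (auto simp: x_def)
      then show "sqrt (Re (es ! j)) powr p = x j powr (p / 2)"
        by (simp add: powr_half_sqrt[symmetric] powr_powr)
    qed
    finally show ?thesis .
  qed
  moreover have "mat_trace n (H ^\<^sub>m m) = of_real (\<Sum>j<n. x j ^ m)" for m
  proof -
    have "H ^\<^sub>m m = P * (B ^\<^sub>m m * Q)"
      using similar_mat_wit_pow_id[OF sim, of m] car by (simp add: assoc_mult_mat[of _ n n _ n _ n])
    moreover have "B ^\<^sub>m m * Q \<in> carrier_mat n n" using car by (intro mult_carrier_mat[of _ n n]) auto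
    ultimately have "mat_trace n (H ^\<^sub>m m) = mat_trace n ((B ^\<^sub>m m * Q) * P)"
      using mat_trace_comm[OF car(2)] by (simp only:)
    also have "(B ^\<^sub>m m * Q) * P = B ^\<^sub>m m"
      using car PQ by (simp add: assoc_mult_mat[of _ n n _ n _ n])
    also have "mat_trace n (B ^\<^sub>m m) = (\<Sum>j<n. B $$ (j, j) ^ m)"
      unfolding mat_trace_def using upper_triangular_pow[OF car(1) ut, of m] by simp
    also have "\<dots> = of_real (\<Sum>j<n. x j ^ m)" using Bes x by simp
    finally show ?thesis .
  qed
  moreover have "det (1\<^sub>m n + c \<cdot>\<^sub>m H) = (\<Prod>j<n. 1 + c * of_real (x j))" for c
  proof -
    have c1: "1\<^sub>m n + c \<cdot>\<^sub>m B \<in> carrier_mat n n" "1\<^sub>m n + c \<cdot>\<^sub>m H \<in> carrier_mat n n" using car H by auto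
    have "P * (1\<^sub>m n + c \<cdot>\<^sub>m B) = P + c \<cdot>\<^sub>m (P * B)"
      using car by (simp add: mult_add_distrib_mat[of _ n n _ n] mult_smult_distrib[of _ n n _ n])
    then have "P * (1\<^sub>m n + c \<cdot>\<^sub>m B) * Q = (P + c \<cdot>\<^sub>m (P * B)) * Q" by (simp only:)
    also have "\<dots> = P * Q + (c \<cdot>\<^sub>m (P * B)) * Q"
      using car by (intro add_mult_distrib_mat[of _ n n]) auto
    also have "(c \<cdot>\<^sub>m (P * B)) * Q = c \<cdot>\<^sub>m H"
      unfolding PQ(3) using car by (intro mult_smult_assoc_mat[of _ n n]) auto
    also note PQ(1)
    finally have "similar_mat_wit (1\<^sub>m n + c \<cdot>\<^sub>m H) (1\<^sub>m n + c \<cdot>\<^sub>m B) P Q"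
      using similar_mat_witI[OF PQ(1,2) _ c1(2) c1(1) car(2,3)] by simp
    then have "det (1\<^sub>m n + c \<cdot>\<^sub>m H) = det (1\<^sub>m n + c \<cdot>\<^sub>m B)"
      by (intro det_similar) (auto simp: similar_mat_def)
    also have "upper_triangular (1\<^sub>m n + c \<cdot>\<^sub>m B)"
      using car by (intro upper_triangularI) (auto simp: upper_triangularD[OF ut])
    from det_upper_triangular[OF this c1(1)]
    have "det (1\<^sub>m n + c \<cdot>\<^sub>m B) = (\<Prod>j<n. (1\<^sub>m n + c \<cdot>\<^sub>m B) $$ (j, j))"
      using car(1) by (simp add: diag_mat_def prod.distinct_set_conv_list[symmetric] lessThan_atLeast0)
    also have "\<dots> = (\<Prod>j<n. 1 + c * of_real (x j))"
      using car Bes x by (intro prod.cong) auto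
    finally show ?thesis .
  qed
  moreover have "x j \<ge> 0" for j using x(2)[of j] by (cases "j < n") (auto simp: x_def)
  ultimately show ?thesis unfolding H_def by blast
qed

text \<open>
  The Cauchy--Binet formula, summed over all row selections (functions rather than subsets), whence
  the factor $n!$.
\<close>

lemma fact_mult_det_gram:
  fixes N :: "nat \<Rightarrow> nat \<Rightarrow> complex" and w :: "nat \<Rightarrow> complex"
  shows "of_nat (fact n) * det (mat n n (\<lambda>(i, j). \<Sum>l<L. w l * cnj (N l i) * N l j)) =
    (\<Sum>f\<in>{0..<n} \<rightarrow>\<^sub>E {..<L}. (\<Prod>i\<in>{0..<n}. w (f i)) *
      of_real ((cmod (det (mat n n (\<lambda>(i, j). N (f i) j))))\<^sup>2))"
proof -
  define U where "U = {0..<n}"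
  define F where "F = U \<rightarrow>\<^sub>E {..<L}"
  define D where "D f = det (mat n n (\<lambda>(i, j). N (f i) j))" for f
  define W where "W f = (\<Prod>i\<in>U. w (f i))" for f
  define S where "S = {\<pi>. \<pi> permutes U}"
  let ?G = "mat n n (\<lambda>(i, j). \<Sum>l<L. w l * cnj (N l i) * N l j)"
  have less: "\<pi> i < n" if "\<pi> permutes {0..<n}" "i < n" for \<pi> i
    using permutes_in_image[OF that(1), of i] that(2) by simp
  have D: "D f = (\<Sum>\<pi>\<in>S. signof \<pi> * (\<Prod>i\<in>U. N (f i) (\<pi> i)))" for f
    unfolding D_def S_def U_def
    by (subst det_def') (auto intro!: sum.cong prod.cong simp: less)
  \<comment> \<open>The Leibniz sum of the transpose; its conjugate is what appears after summation
    over \<pi>.\<close>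
  have D': "D f = (\<Sum>\<pi>\<in>S. signof \<pi> * (\<Prod>i\<in>U. N (f (\<pi> i)) i))" for f
    unfolding D_def S_def U_def
    by (subst det_transpose[symmetric, of _ n], simp, subst det_def')
      (auto intro!: sum.cong prod.cong simp: less)
  have "det ?G = (\<Sum>\<pi>\<in>S. signof \<pi> * (\<Prod>i\<in>U. \<Sum>l<L. w l * cnj (N l i) * N l (\<pi> i)))"
    unfolding S_def U_def by (subst det_def') (auto intro!: sum.cong prod.cong simp: less)
  also have "\<dots> = (\<Sum>\<pi>\<in>S. signof \<pi> * (\<Sum>f\<in>F. \<Prod>i\<in>U. w (f i) * cnj (N (f i) i) * N (f i) (\<pi> i)))"
    unfolding F_def by (subst prod_sum_PiE) (auto simp: U_def)
  also have "\<dots> = (\<Sum>f\<in>F. W f * (\<Prod>i\<in>U. cnj (N (f i) i)) * D f)"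
    unfolding sum_distrib_left D W_def
    by (subst sum.swap) (simp add: prod.distrib mult_ac)
  finally have det: "det ?G = (\<Sum>f\<in>F. W f * (\<Prod>i\<in>U. cnj (N (f i) i)) * D f)" .
  \<comment> \<open>Precomposing the selection f with \<pi> keeps the weight and multiplies D f by
    the sign of \<pi>. Summing these n! copies of the same determinant assembles the conjugate of D
    f out of the diagonal products.\<close>
  have perm: "det ?G = (\<Sum>f\<in>F. W f * D f * (signof \<pi> * (\<Prod>i\<in>U. cnj (N (f (\<pi> i)) i))))"
    if \<pi>: "\<pi> \<in> S" for \<pi>
  proof -
    have \<pi>U: "\<pi> permutes U" using \<pi> by (simp add: S_def)
    have "det ?G = (\<Sum>f\<in>F. W (f \<circ> \<pi>) * (\<Prod>i\<in>U. cnj (N ((f \<circ> \<pi>) i) i)) * D (f \<circ> \<pi>))"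
      unfolding det
    proof (rule sum.reindex_bij_witness[where i = "\<lambda>f. f \<circ> \<pi>" and j = "\<lambda>f. f \<circ> inv_into UNIV \<pi>"])
      have "f \<circ> \<sigma> \<in> F" if "\<sigma> permutes U" "f \<in> F" for f \<sigma>
        using that permutes_in_image[OF that(1)] unfolding F_def PiE_def Pi_def extensional_def by auto
      then show "\<And>f. f \<in> F \<Longrightarrow> f \<circ> \<pi> \<in> F" "\<And>f. f \<in> F \<Longrightarrow> f \<circ> inv_into UNIV \<pi> \<in> F"
        using \<pi>U permutes_inv by auto
    qed (auto simp: o_assoc[symmetric] permutes_inv_o[OF \<pi>U])
    also have "\<dots> = (\<Sum>f\<in>F. W f * D f * (signof \<pi> * (\<Prod>i\<in>U. cnj (N (f (\<pi> i)) i))))"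
    proof (intro sum.cong refl)
      fix f
      have "W (f \<circ> \<pi>) = W f"
        unfolding W_def using prod.permute[OF \<pi>U, of "\<lambda>i. w (f i)"] by (simp add: o_def)
      moreover have "mat n n (\<lambda>(i, j). N ((f \<circ> \<pi>) i) j) =
          mat n n (\<lambda>(i, j). mat n n (\<lambda>(i, j). N (f i) j) $$ (\<pi> i, j))"
        using \<pi>U by (auto simp: U_def less intro!: eq_matI)
      then have "D (f \<circ> \<pi>) = signof \<pi> * D f"
        unfolding D_def using det_permute_rows[of "mat n n (\<lambda>(i, j). N (f i) j)" n \<pi>] \<pi>U
        by (simp add: U_def)
      ultimately show "W (f \<circ> \<pi>) * (\<Prod>i\<in>U. cnj (N ((f \<circ> \<pi>) i) i)) * D (f \<circ> \<pi>) =
          W f * D f * (signof \<pi> * (\<Prod>i\<in>U. cnj (N (f (\<pi> i)) i)))" by simp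
    qed
    finally show ?thesis .
  qed
  have "of_nat (fact n) * det ?G = (\<Sum>\<pi>\<in>S. det ?G)"
    unfolding S_def using card_permutations[of U n] by (simp add: U_def)
  also have "\<dots> = (\<Sum>\<pi>\<in>S. \<Sum>f\<in>F. W f * D f * (signof \<pi> * (\<Prod>i\<in>U. cnj (N (f (\<pi> i)) i))))"
    by (intro sum.cong refl perm)
  also have "\<dots> = (\<Sum>f\<in>F. W f * D f * (\<Sum>\<pi>\<in>S. signof \<pi> * (\<Prod>i\<in>U. cnj (N (f (\<pi> i)) i))))"
    by (subst sum.swap) (simp add: sum_distrib_left)
  also have "\<dots> = (\<Sum>f\<in>F. W f * of_real ((cmod (D f))\<^sup>2))"
  proof (intro sum.cong refl)
    fix f
    have "cnj (D f) = (\<Sum>\<pi>\<in>S. signof \<pi> * (\<Prod>i\<in>U. cnj (N (f (\<pi> i)) i)))"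
      unfolding D'[of f] by simp
    then show "W f * D f * (\<Sum>\<pi>\<in>S. signof \<pi> * (\<Prod>i\<in>U. cnj (N (f (\<pi> i)) i))) =
        W f * of_real ((cmod (D f))\<^sup>2)"
      by (simp only: complex_norm_square mult.assoc)
  qed
  finally show ?thesis unfolding W_def D_def F_def U_def .
qed

section \<open>Singular values of order $|z|^k$\<close>

lemma even_expansion_cong:
  assumes F: "even_expansion F c" and FG: "\<And>z. z \<noteq> 0 \<Longrightarrow> F z = G z"
  shows "even_expansion G c"
proof -
  have "\<forall>\<^sub>F z in at 0. F z - c = G z - c" "\<forall>\<^sub>F z in at 0. F z + F (-z) - 2 * c = G z + G (-z) - 2 * c"
    using FG by (auto simp: eventually_at_filter)
  with F show ?thesis unfolding even_expansion_def by (simp only: landau_o.big.in_cong)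
qed

text \<open>Makes the sum of the |P f|^2 nonzero at 0, so that it can be inverted there. Factors X
  are removed one at a time; the degree of a nonzero member bounds their number.\<close>

lemma factor_common_power:
  fixes E :: "'b \<Rightarrow> 'a::field poly"
  assumes "f \<in> F" "E f \<noteq> 0"
  shows "\<exists>d P. (\<forall>f\<in>F. E f = [:0, 1:] ^ d * P f) \<and> (\<exists>f\<in>F. poly (P f) 0 \<noteq> 0)"
  using assms
proof (induction "degree (E f)" arbitrary: E rule: less_induct)
  case less
  show ?case
  proof (cases "\<exists>f\<in>F. poly (E f) 0 \<noteq> 0")
    case True
    then show ?thesis by (intro exI[of _ 0] exI[of _ E]) auto
  next
    case False
    have "\<exists>Q. E g = [:0, 1:] * Q" if "g \<in> F" for g
      using False that poly_eq_0_iff_dvd[of "E g" 0] by (auto elim!: dvdE)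
    then obtain E' where E': "\<And>g. g \<in> F \<Longrightarrow> E g = [:0, 1:] * E' g" by metis
    have nz: "E' f \<noteq> 0" using E'[of f] less.prems by auto
    then have "degree (E' f) < degree (E f)" using E'[of f] less.prems by (simp add: degree_mult_eq)
    from less.hyps[of E', OF this less.prems(1) nz] obtain d P where dP:
      "\<forall>g\<in>F. E' g = [:0, 1:] ^ d * P g" "\<exists>g\<in>F. poly (P g) 0 \<noteq> 0" by blast
    have "\<forall>g\<in>F. E g = [:0, 1:] ^ Suc d * P g"
      using E' bspec[OF dP(1)] by (simp only: power_Suc mult.assoc ball_simps) simp
    with dP(2) show ?thesis by blast
  qed
qed

text \<open>
  Here \<open>D f\<close> is a maximal minor of the $2n \times n$ matrix that stacks $A + zB$ on top of the
  identity, and \<open>r f\<close> counts its rows taken from $A + zB$.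
\<close>

lemma det_pencil_expansion:
  fixes A B :: "complex mat"
  assumes A: "A \<in> carrier_mat n n" and B: "B \<in> carrier_mat n n"
  shows "\<exists>(F :: (nat \<Rightarrow> nat) set) r D. finite F \<and> (\<forall>f\<in>F. r f \<le> n) \<and> (\<exists>f\<in>F. D f \<noteq> 0) \<and>
    (\<forall>z c. of_nat (fact n) * det (1\<^sub>m n + c \<cdot>\<^sub>m (mat_adjoint (A + z \<cdot>\<^sub>m B) * (A + z \<cdot>\<^sub>m B))) =
       (\<Sum>f\<in>F. c ^ r f * of_real ((cmod (poly (D f) z))\<^sup>2)))"
proof -
  define F where "F = {0..<n} \<rightarrow>\<^sub>E {..<2 * n}"
  define r where "r f = card {i \<in> {0..<n}. f i < n}" for f :: "nat \<Rightarrow> nat"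
  define R where "R f i j = (if f i < n then [:A $$ (f i, j), B $$ (f i, j):] else if f i - n = j then 1 else 0)"
    for f :: "nat \<Rightarrow> nat" and i j
  define D where "D f = det (mat n n (\<lambda>(i, j). R f i j))" for f
  define N where "N z l j = (if l < n then A $$ (l, j) + z * B $$ (l, j) else if l - n = j then 1 else 0)"
    for z and l j :: nat
  have polyD: "poly (D f) z = det (mat n n (\<lambda>(i, j). N z (f i) j))" for f z
  proof -
    have "\<pi> i < n" if "\<pi> permutes {0..<n}" "i < n" for \<pi> i
      using permutes_in_image[OF that(1), of i] that(2) by simp
    moreover have "poly (R f i j) z = N z (f i) j" for i j by (simp add: R_def N_def)
    ultimately show ?thesis
      unfolding D_def
      by (subst (1 2) det_def') (auto simp: poly_sum poly_prod intro!: sum.cong prod.cong)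
  qed
  have "finite F" unfolding F_def by (intro finite_PiE) auto
  moreover have "\<forall>f\<in>F. r f \<le> n"
  proof
    fix f
    have "r f \<le> card {0..<n}" unfolding r_def by (intro card_mono) auto
    then show "r f \<le> n" by simp
  qed
  \<comment> \<open>Selecting exactly the identity rows gives the minor 1.\<close>
  moreover have "\<exists>f\<in>F. D f \<noteq> 0"
  proof
    let ?f = "\<lambda>i\<in>{0..<n}. n + i"
    have "mat n n (\<lambda>(i, j). R ?f i j) = 1\<^sub>m n" by (rule eq_matI) (auto simp: R_def)
    then show "D ?f \<noteq> 0" by (simp add: D_def)
    show "?f \<in> F" by (auto simp: F_def)
  qed
  moreover have "of_nat (fact n) * det (1\<^sub>m n + c \<cdot>\<^sub>m (mat_adjoint (A + z \<cdot>\<^sub>m B) * (A + z \<cdot>\<^sub>m B))) =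
       (\<Sum>f\<in>F. c ^ r f * of_real ((cmod (poly (D f) z))\<^sup>2))" for z c
  proof -
    define X where "X = A + z \<cdot>\<^sub>m B"
    have X: "X \<in> carrier_mat n n" using A B by (simp add: X_def)
    have XN: "X $$ (l, j) = N z l j" if "l < n" "j < n" for l j
      using that A B by (simp add: X_def N_def)
    \<comment> \<open>Weight c on the rows of A + zB and weight 1 on the identity rows turn the
      weighted Gram matrix into the identity plus c times \<open>mat_adjoint X * X\<close>.\<close>
    define w where "w l = (if l < n then c else 1)" for l
    have "1\<^sub>m n + c \<cdot>\<^sub>m (mat_adjoint X * X) = mat n n (\<lambda>(i, j). \<Sum>l<2 * n. w l * cnj (N z l i) * N z l j)"
    proof (rule eq_matI)
      fix i j assume "i < dim_row (mat n n (\<lambda>(i, j). \<Sum>l<2 * n. w l * cnj (N z l i) * N z l j))"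
        "j < dim_col (mat n n (\<lambda>(i, j). \<Sum>l<2 * n. w l * cnj (N z l i) * N z l j))"
      then have ij: "i < n" "j < n" by auto
      have "(\<Sum>l<2 * n. w l * cnj (N z l i) * N z l j) =
          (\<Sum>l<n. w l * cnj (N z l i) * N z l j) + (\<Sum>l=n..<2 * n. w l * cnj (N z l i) * N z l j)"
        by (simp add: lessThan_atLeast0 sum.atLeastLessThan_concat)
      also have "(\<Sum>l<n. w l * cnj (N z l i) * N z l j) = c * (\<Sum>l<n. mat_adjoint X $$ (i, l) * X $$ (l, j))"
        unfolding sum_distrib_left using ij X XN by (intro sum.cong) (auto simp: w_def mult.assoc)
      also have "(\<Sum>l<n. mat_adjoint X $$ (i, l) * X $$ (l, j)) = (mat_adjoint X * X) $$ (i, j)"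
        using X ij by (intro mat_mult_index_sum[symmetric]) auto
      also have "(\<Sum>l=n..<2 * n. w l * cnj (N z l i) * N z l j) = (\<Sum>l<n. if l = i then if i = j then 1 else 0 else 0)"
        by (rule sum.reindex_bij_witness[of _ "\<lambda>l. l + n" "\<lambda>l. l - n"]) (auto simp: w_def N_def)
      also have "\<dots> = (if i = j then 1 else 0)" using ij by simp
      finally show "(1\<^sub>m n + c \<cdot>\<^sub>m (mat_adjoint X * X)) $$ (i, j) =
          mat n n (\<lambda>(i, j). \<Sum>l<2 * n. w l * cnj (N z l i) * N z l j) $$ (i, j)"
        using ij X by simp
    qed (use X in auto)
    moreover have "(\<Prod>i\<in>{0..<n}. w (f i)) = c ^ r f" for f
    proof -
      have "(\<Prod>i\<in>{0..<n}. w (f i)) = (\<Prod>i\<in>{i \<in> {0..<n}. f i < n}. c)"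
        unfolding w_def by (rule prod.inter_filter[symmetric]) simp
      then show ?thesis by (simp add: r_def)
    qed
    ultimately show ?thesis
      using fact_mult_det_gram[where n = n and L = "2 * n" and w = w and N = "N z"] by (simp only: F_def polyD X_def)
  qed
  ultimately show ?thesis by blast
qed

text \<open>Serves the identity for the product of the 1 - w \<nu>_j, which is computed for w < 1,
  where 1 - w can be inverted; infinitely many points determine the polynomial.\<close>

lemma poly_eqI_less:
  fixes p q :: "real poly"
  assumes "\<And>w. w < a \<Longrightarrow> poly p w = poly q w"
  shows "p = q"
proof (rule ccontr)
  assume "p \<noteq> q"
  then have "finite {w. poly (p - q) w = 0}" by (intro poly_roots_finite) simp
  moreover have "{..<a} \<subseteq> {w. poly (p - q) w = 0}" using assms by auto
  ultimately show False using infinite_Iio finite_subset by blast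
qed

text \<open>At $z = 0$ the division yields \<open>\<nu> k 0 j = 1\<close> for $k > 0$; only punctured neighbourhoods matter.\<close>

lemma singular_window_expansion:
  fixes A B :: "complex mat" and x :: "complex \<Rightarrow> nat \<Rightarrow> real"
  assumes A: "A \<in> carrier_mat n n" and B: "B \<in> carrier_mat n n"
    and x0: "\<And>z j. x z j \<ge> 0"
    and x: "\<And>z c. det (1\<^sub>m n + c \<cdot>\<^sub>m (mat_adjoint (A + z \<cdot>\<^sub>m B) * (A + z \<cdot>\<^sub>m B))) =
              (\<Prod>j<n. 1 + c * of_real (x z j))"
  defines "\<nu> \<equiv> \<lambda>k z j. inverse (1 + x z j / norm z ^ (2 * k))"
  shows "\<forall>\<^sub>F a in at_right 0.
    (\<exists>c. even_expansion (\<lambda>z. \<Sum>j<n. if \<nu> k z j \<in> {a..1 - a} then ((1 - \<nu> k z j) / \<nu> k z j) powr \<beta> else 0) c) \<and>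
    (\<exists>K. \<forall>\<^sub>F z in at 0. \<forall>j<n. \<nu> k z j \<in> {a..1 - a} \<or> \<nu> k z j \<le> K * norm z ^ 2 \<or> 1 - \<nu> k z j \<le> K * norm z ^ 2)"
proof (rule window_sum_expansion)
  have pos: "1 + x z j / norm z ^ (2 * k) > 0" for z j using x0[of z j] by (simp add: add_pos_nonneg)
  have ge1: "1 + x z j / norm z ^ (2 * k) \<ge> 1" for z j using x0[of z j] by simp
  show "\<nu> k z j \<in> {0..1}" for z j
    using pos[of z j] inverse_le_1_iff[of "1 + x z j / norm z ^ (2 * k)"] ge1[of z j]
    unfolding \<nu>_def by (auto simp: less_imp_le)
  from det_pencil_expansion[OF A B, unfolded x] obtain F :: "(nat \<Rightarrow> nat) set" and r D where F: "finite F" "\<And>f. f \<in> F \<Longrightarrow> r f \<le> n" "\<exists>f\<in>F. D f \<noteq> 0"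
    and eq: "\<And>z c. of_nat (fact n) * (\<Prod>j<n. 1 + c * of_real (x z j)) =
       (\<Sum>f\<in>F. c ^ r f * complex_of_real ((cmod (poly (D f) z))\<^sup>2))" by blast
  have eq_real: "fact n * (\<Prod>j<n. 1 + c * x z j) = (\<Sum>f\<in>F. c ^ r f * (cmod (poly (D f) z))\<^sup>2)" for c z
  proof -
    have "complex_of_real (fact n * (\<Prod>j<n. 1 + c * x z j)) =
        complex_of_real (\<Sum>f\<in>F. c ^ r f * (cmod (poly (D f) z))\<^sup>2)"
      using eq[of "of_real c" z] by simp
    then show ?thesis by (simp only: of_real_eq_iff)
  qed
  \<comment> \<open>The substitution c = y / |z|^{2k} is cleared by the factor |z|^{2kn}. What
    remains on a minor with r rows from A + zB is |z|^{2k(n - r)}, the squared modulus of z^{k(n -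
    r)}, so every term is still a squared modulus of a polynomial.\<close>
  define E where "E f = [:0, 1:] ^ (k * (n - r f)) * D f" for f
  from F(3) obtain f0 where "f0 \<in> F" "E f0 \<noteq> 0" by (auto simp: E_def)
  from factor_common_power[of f0 F E, OF this] obtain d P where dP: "\<And>f. f \<in> F \<Longrightarrow> E f = [:0, 1:] ^ d * P f"
    and P0: "\<exists>f\<in>F. poly (P f) 0 \<noteq> 0" by blast
  \<comment> \<open>The right-hand sum at y = 1: up to scaling it is the product of the 1 + x_j /
    |z|^{2k}, that is, of the 1 / \<nu>_j.\<close>
  define S where "S z = (\<Sum>f\<in>F. (cmod (poly (P f) z))\<^sup>2)" for z
  have main: "fact n * norm z ^ (2 * k * n) * (\<Prod>j<n. 1 + y * (x z j / norm z ^ (2 * k))) =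
      norm z ^ (2 * d) * (\<Sum>f\<in>F. y ^ r f * (cmod (poly (P f) z))\<^sup>2)" if z: "z \<noteq> 0" for z y
  proof -
    have "norm z ^ (2 * k * n) * (fact n * (\<Prod>j<n. 1 + (y / norm z ^ (2 * k)) * x z j)) =
        (\<Sum>f\<in>F. norm z ^ (2 * k * n) * ((y / norm z ^ (2 * k)) ^ r f * (cmod (poly (D f) z))\<^sup>2))"
      unfolding eq_real sum_distrib_left ..
    also have "\<dots> = (\<Sum>f\<in>F. y ^ r f * (cmod (poly (E f) z))\<^sup>2)"
    proof (intro sum.cong refl)
      fix f assume f: "f \<in> F"
      have "2 * k * n = 2 * k * r f + k * (n - r f) * 2"
        using F(2)[OF f] by (simp add: algebra_simps diff_mult_distrib2)
      then have "norm z ^ (2 * k * n) = (norm z ^ (2 * k)) ^ r f * (norm z ^ (k * (n - r f)))\<^sup>2"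
        by (simp only: power_add power_mult)
      then show "norm z ^ (2 * k * n) * ((y / norm z ^ (2 * k)) ^ r f * (cmod (poly (D f) z))\<^sup>2) =
          y ^ r f * (cmod (poly (E f) z))\<^sup>2"
        using z by (simp add: E_def poly_power norm_mult norm_power power_mult_distrib power_divide)
    qed
    also have "\<dots> = (\<Sum>f\<in>F. norm z ^ (2 * d) * (y ^ r f * (cmod (poly (P f) z))\<^sup>2))"
      by (intro sum.cong refl)
        (simp add: dP poly_power norm_mult norm_power power_mult_distrib power_even_eq)
    finally show ?thesis by (simp add: sum_distrib_left mult_ac)
  qed
  have Spos: "S z > 0" if z: "z \<noteq> 0" for z
  proof -
    have "0 < fact n * norm z ^ (2 * k * n) * (\<Prod>j<n. 1 + 1 * (x z j / norm z ^ (2 * k)))"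
      using z pos by (intro mult_pos_pos prod_pos) auto
    then have "norm z ^ (2 * d) * S z > 0" unfolding main[OF z] by (simp add: S_def)
    then show ?thesis using z by (simp add: zero_less_mult_iff)
  qed
  have S0: "S 0 > 0" unfolding S_def using P0 F(1) by (auto intro: sum_pos2)
  \<comment> \<open>With y = 1 / (1 - w) and \<mu> = x_j / |z|^{2k}, each factor satisfies (1 - w)
    (1 + y \<mu>) \<nu> = 1 - w \<nu>. On the right, z enters only through the |P f|^2 and S, which
    have even expansions.\<close>
  have coeffs: "(\<Prod>j<n. [:1, - \<nu> k z j:]) =
      (\<Sum>f\<in>F. Polynomial.smult ((cmod (poly (P f) z))\<^sup>2 * inverse (S z)) ([:1, -1:] ^ (n - r f)))"
    if z: "z \<noteq> 0" for z
  proof (rule poly_eqI_less[of 1])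
    fix w :: real assume w: "w < 1"
    define C where "C = fact n * norm z ^ (2 * k * n) / norm z ^ (2 * d)"
    have C: "C > 0" using z by (simp add: C_def)
    have main': "(\<Sum>f\<in>F. y ^ r f * (cmod (poly (P f) z))\<^sup>2) = C * (\<Prod>j<n. 1 + y * (x z j / norm z ^ (2 * k)))" for y
      using main[OF z, of y] z by (simp add: C_def field_simps)
    have "poly (\<Sum>f\<in>F. Polynomial.smult ((cmod (poly (P f) z))\<^sup>2 * inverse (S z)) ([:1, -1:] ^ (n - r f))) w =
        inverse (S z) * (\<Sum>f\<in>F. (1 - w) ^ (n - r f) * (cmod (poly (P f) z))\<^sup>2)"
      by (simp add: poly_sum poly_power sum_distrib_left mult_ac)
    also have "(\<Sum>f\<in>F. (1 - w) ^ (n - r f) * (cmod (poly (P f) z))\<^sup>2) =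
        (1 - w) ^ n * (\<Sum>f\<in>F. inverse (1 - w) ^ r f * (cmod (poly (P f) z))\<^sup>2)"
      unfolding sum_distrib_left
      using F(2) w by (intro sum.cong refl) (simp add: power_diff power_inverse divide_inverse)
    also have "\<dots> = (1 - w) ^ n * (C * (\<Prod>j<n. 1 + inverse (1 - w) * (x z j / norm z ^ (2 * k))))"
      by (subst main') rule
    also have "\<dots> = C * (\<Prod>j<n. (1 - w) * (1 + inverse (1 - w) * (x z j / norm z ^ (2 * k))))"
      by (simp add: prod.distrib)
    also have "\<dots> = C * (\<Prod>j<n. (1 - w) + x z j / norm z ^ (2 * k))"
      using w by (simp add: distrib_left mult.assoc[symmetric])
    also have "inverse (S z) * (C * (\<Prod>j<n. (1 - w) + x z j / norm z ^ (2 * k))) =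
        (\<Prod>j<n. ((1 - w) + x z j / norm z ^ (2 * k)) * \<nu> k z j)"
    proof -
      have "S z = C * (\<Prod>j<n. 1 + x z j / norm z ^ (2 * k))" using main'[of 1] by (simp add: S_def)
      moreover have "(\<Prod>j<n. \<nu> k z j) = inverse (\<Prod>j<n. 1 + x z j / norm z ^ (2 * k))"
        unfolding \<nu>_def by (rule prod_inversef[unfolded o_def])
      ultimately show ?thesis using C by (simp add: prod.distrib)
    qed
    also have "\<dots> = (\<Prod>j<n. 1 - w * \<nu> k z j)"
    proof (intro prod.cong refl)
      fix j
      show "((1 - w) + x z j / norm z ^ (2 * k)) * \<nu> k z j = 1 - w * \<nu> k z j"
        using pos[of z j] by (simp add: \<nu>_def divide_simps) (simp add: algebra_simps)?
    qed
    finally show "poly (\<Prod>j<n. [:1, - \<nu> k z j:]) w =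
        poly (\<Sum>f\<in>F. Polynomial.smult ((cmod (poly (P f) z))\<^sup>2 * inverse (S z)) ([:1, -1:] ^ (n - r f))) w"
      by (simp add: poly_prod)
  qed
  have "\<exists>c. even_expansion (\<lambda>z. poly.coeff (\<Prod>j<n. [:1, - \<nu> k z j:]) i) c" for i
  proof -
    have "even_expansion (\<lambda>z. \<Sum>f\<in>F. (cmod (poly (P f) z))\<^sup>2 * inverse (S z) * poly.coeff ([:1, -1:] ^ (n - r f)) i)
        (\<Sum>f\<in>F. (cmod (poly (P f) 0))\<^sup>2 * inverse (S 0) * poly.coeff ([:1, -1:] ^ (n - r f)) i)"
      unfolding S_def using S0
      by (intro even_expansion_sum even_expansion_mult even_expansion_inverse even_expansion_norm_square
          even_expansion_const) (simp add: S_def)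
    from even_expansion_cong[OF this, of "\<lambda>z. poly.coeff (\<Prod>j<n. [:1, - \<nu> k z j:]) i"]
    show ?thesis by (auto simp: coeffs coeff_sum)
  qed
  then show "\<exists>c. even_expansion (\<lambda>z. \<Sum>j<n. \<nu> k z j ^ m) c" for m
    by (intro even_expansion_power_sum) auto
qed

section \<open>Decomposition into windows\<close>

lemma window_iff:
  fixes a \<mu> :: real
  assumes a: "0 < a" "a < 1 / 2" and \<mu>: "\<mu> \<ge> 0"
  shows "inverse (1 + \<mu>) \<in> {a..1 - a} \<longleftrightarrow> a / (1 - a) \<le> \<mu> \<and> \<mu> \<le> (1 - a) / a"
proof -
  have "a \<le> inverse (1 + \<mu>) \<longleftrightarrow> \<mu> \<le> (1 - a) / a"
    using a \<mu> by (simp add: field_simps)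
  moreover have "inverse (1 + \<mu>) \<le> 1 - a \<longleftrightarrow> a / (1 - a) \<le> \<mu>"
    using a \<mu> by (simp add: field_simps)
  ultimately show ?thesis by auto
qed

text \<open>A value x lies in at most one window, because t is below a / (1 - a), and the term of
  its window equals x^\<beta>. A value in no window up to K has dropped to order t^{2K+2}, since
  \<open>dich\<close> excludes intermediate orders.\<close>

lemma window_decomposition:
  fixes x t a L R \<beta> :: real
  assumes a: "0 < a" "a < 1 / 2" and \<beta>: "\<beta> > 0" and t: "0 < t" "t < a / (1 - a)"
    and x: "0 \<le> x" "x \<le> R" and LR: "L > 0" "R > 0"
    and small: "L * t ^ 2 \<le> 1 / 2" "2 * L * max R (2 * L) * t ^ 2 < 1"
    and dich: "\<And>k. k \<le> K \<Longrightarrow> inverse (1 + x / t ^ (2 * k)) \<in> {a..1 - a} \<or>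
      inverse (1 + x / t ^ (2 * k)) \<le> L * t ^ 2 \<or> 1 - inverse (1 + x / t ^ (2 * k)) \<le> L * t ^ 2"
  shows "\<bar>x powr \<beta> - (\<Sum>k\<le>K. t powr (2 * real k * \<beta>) *
      (if inverse (1 + x / t ^ (2 * k)) \<in> {a..1 - a} then
        ((1 - inverse (1 + x / t ^ (2 * k))) / inverse (1 + x / t ^ (2 * k))) powr \<beta> else 0))\<bar>
    \<le> max R (2 * L) powr \<beta> * t powr (2 * real (Suc K) * \<beta>)"
proof -
  \<comment> \<open>\<open>R\<close> starts the induction on k below, and 2L is the constant that
    its step produces.\<close>
  define C where "C = max R (2 * L)"
  have C: "C > 0" "R \<le> C" "2 * L \<le> C" using LR by (auto simp: C_def)
  define \<rho> where "\<rho> = a / (1 - a)"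
  have \<rho>: "0 < \<rho>" "\<rho> < 1" using a by (auto simp: \<rho>_def)
  have \<rho>': "(1 - a) / a = 1 / \<rho>" using a by (simp add: \<rho>_def)
  have t1: "t < \<rho>" "t < 1" using t \<rho> by (auto simp: \<rho>_def)
  define I where "I k \<longleftrightarrow> inverse (1 + x / t ^ (2 * k)) \<in> {a..1 - a}" for k
  have \<mu>0: "x / t ^ (2 * k) \<ge> 0" for k using x t by simp
  have I: "I k \<longleftrightarrow> \<rho> * t ^ (2 * k) \<le> x \<and> x \<le> t ^ (2 * k) / \<rho>" for k
    unfolding I_def window_iff[OF a \<mu>0] \<rho>_def[symmetric] \<rho>' using t(1) by (simp add: field_simps)
  \<comment> \<open>A singular value that misses the windows $0, \dots, k-1$ has already dropped to order $t^{2k}$.\<close>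
  have chain: "(\<exists>j<k. I j) \<or> x \<le> C * t ^ (2 * k)" if "k \<le> Suc K" for k
    using that
  proof (induction k)
    case 0
    show ?case using x C by simp
  next
    case (Suc k)
    show ?case
    proof (cases "\<exists>j<k. I j")
      case True
      then show ?thesis using less_SucI by blast
    next
      case False
      with Suc have xk: "x \<le> C * t ^ (2 * k)" by auto
      define \<mu> where "\<mu> = x / t ^ (2 * k)"
      have m: "\<mu> \<ge> 0" "\<mu> \<le> C" using xk x t by (auto simp: \<mu>_def field_simps)
      consider "I k" | "inverse (1 + \<mu>) \<le> L * t ^ 2" | "1 - inverse (1 + \<mu>) \<le> L * t ^ 2"
        using dich[of k] Suc.prems unfolding I_def \<mu>_def by auto
      then show ?thesis
      proof cases
        case 2
        \<comment> \<open>This case is contradictory: \<mu> \<le> C keeps 1 / (1 + \<mu>) away from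
          0, and the smallness of t leads to 1 < 1.\<close>
        then have "1 \<le> L * t ^ 2 * (1 + \<mu>)" using m by (simp add: field_simps)
        also have "\<dots> = L * t ^ 2 + L * t ^ 2 * \<mu>" by (simp add: algebra_simps)
        also have "\<dots> \<le> 1 / 2 + L * t ^ 2 * C" using small m LR by (intro add_mono mult_left_mono) auto
        finally show ?thesis using small(2) by (simp add: C_def algebra_simps)
      next
        case 3
        then have "\<mu> \<le> L * t ^ 2 * (1 + \<mu>)" using m by (simp add: field_simps)
        also have "\<dots> = L * t ^ 2 + L * t ^ 2 * \<mu>" by (simp add: algebra_simps)
        also have "\<dots> \<le> L * t ^ 2 + 1 / 2 * \<mu>" using small m by (intro add_left_mono mult_right_mono) auto
        finally have "\<mu> \<le> 2 * L * t ^ 2" by simp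
        also have "\<dots> \<le> C * t ^ 2" using C by (intro mult_right_mono) auto
        finally have "x \<le> C * t ^ 2 * t ^ (2 * k)" using t by (simp add: \<mu>_def field_simps)
        then show ?thesis by (simp add: power2_eq_square mult.assoc)
      qed auto
    qed
  qed
  \<comment> \<open>Consecutive scales differ by the factor t^2, which is smaller than \<rho>^2, the
    ratio of the lower to the upper edge of a window.\<close>
  have disjoint: False if "I j" "I k" "j < k" for j k
  proof -
    have "\<rho> * t ^ (2 * j) \<le> t ^ (2 * k) / \<rho>" using that I by force
    also have "\<dots> \<le> t ^ (2 * j + 2) / \<rho>"
      using that t t1 \<rho> by (intro divide_right_mono power_decreasing) auto
    finally have "\<rho> * \<rho> * t ^ (2 * j) \<le> t ^ 2 * t ^ (2 * j)" using \<rho> by (simp add: field_simps power2_eq_square)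
    then have "\<rho> ^ 2 \<le> t ^ 2" using t by (simp add: power2_eq_square)
    then show False using t1 t \<rho> by (simp add: power2_le_iff_abs_le)
  qed
  have pw: "t powr (2 * real k * \<beta>) = (t ^ (2 * k)) powr \<beta>" for k
    using t by (simp add: powr_powr flip: powr_realpow)
  let ?s = "\<lambda>k. t powr (2 * real k * \<beta>) * (if inverse (1 + x / t ^ (2 * k)) \<in> {a..1 - a} then
        ((1 - inverse (1 + x / t ^ (2 * k))) / inverse (1 + x / t ^ (2 * k))) powr \<beta> else 0)"
  have s: "?s k = (if I k then x powr \<beta> else 0)" for k
  proof -
    have "(1 - inverse (1 + \<mu>)) / inverse (1 + \<mu>) = \<mu>" if "\<mu> \<ge> 0" for \<mu> :: real
      using that by (simp add: field_simps)
    from this[OF \<mu>0]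
    have "(1 - inverse (1 + x / t ^ (2 * k))) / inverse (1 + x / t ^ (2 * k)) = x / t ^ (2 * k)" .
    then show ?thesis unfolding I_def[symmetric] pw using x t by (simp add: powr_divide)
  qed
  show ?thesis
  proof (cases "\<exists>j\<le>K. I j")
    case True
    then obtain j where j: "j \<le> K" "I j" by blast
    have "(\<Sum>k\<le>K. ?s k) = (\<Sum>k\<le>K. if k = j then x powr \<beta> else 0)"
      unfolding s using disjoint j by (intro sum.cong refl) (metis linorder_neqE_nat)
    also have "\<dots> = x powr \<beta>" using j by simp
    finally show ?thesis by simp
  next
    case False
    then have "(\<Sum>k\<le>K. ?s k) = 0" unfolding s by (intro sum.neutral) auto
    moreover have "x \<le> C * t ^ (2 * Suc K)" using chain[of "Suc K"] False by (auto simp: less_Suc_eq_le)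
    then have "x powr \<beta> \<le> (C * t ^ (2 * Suc K)) powr \<beta>" using x \<beta> by (intro powr_mono2) auto
    moreover have "(C * t ^ (2 * Suc K)) powr \<beta> = C powr \<beta> * t powr (2 * real (Suc K) * \<beta>)"
      unfolding pw using C t by (simp add: powr_mult)
    ultimately show ?thesis by (simp add: C_def)
  qed
qed

lemma window_sum_decomposition:
  fixes x :: "complex \<Rightarrow> nat \<Rightarrow> real" and \<beta> a R :: real
  defines "\<nu> \<equiv> \<lambda>k z j. inverse (1 + x z j / norm z ^ (2 * k))"
  assumes a: "0 < a" "a < 1 / 2" and \<beta>: "\<beta> > 0"
    and x0: "\<And>z j. x z j \<ge> 0" and R: "\<forall>\<^sub>F z in at 0. \<forall>j<n. x z j \<le> R"
    and dich: "\<And>k. k \<le> K \<Longrightarrow> \<exists>L. \<forall>\<^sub>F z in at 0. \<forall>j<n. \<nu> k z j \<in> {a..1 - a} \<or> \<nu> k z j \<le> L * norm z ^ 2 \<or> 1 - \<nu> k z j \<le> L * norm z ^ 2"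
  shows "(\<lambda>z. (\<Sum>j<n. x z j powr \<beta>) - (\<Sum>k\<le>K. norm z powr (2 * real k * \<beta>) *
      (\<Sum>j<n. if \<nu> k z j \<in> {a..1 - a} then ((1 - \<nu> k z j) / \<nu> k z j) powr \<beta> else 0)))
      \<in> O[at 0](\<lambda>z. norm z powr (2 * real (Suc K) * \<beta>))"
proof -
  define P where "P k L \<longleftrightarrow> (\<forall>\<^sub>F z in at 0. \<forall>j<n. \<nu> k z j \<in> {a..1 - a} \<or> \<nu> k z j \<le> L * norm z ^ 2 \<or> 1 - \<nu> k z j \<le> L * norm z ^ 2)" for k L
  have "\<forall>k\<in>{..K}. \<exists>L. P k L" using dich by (simp add: P_def)
  from bchoice[OF this] obtain L where "\<forall>k\<in>{..K}. P k (L k)" ..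
  then have L: "\<And>k. k \<le> K \<Longrightarrow> \<forall>\<^sub>F z in at 0. \<forall>j<n. \<nu> k z j \<in> {a..1 - a} \<or> \<nu> k z j \<le> L k * norm z ^ 2 \<or> 1 - \<nu> k z j \<le> L k * norm z ^ 2"
    by (simp add: P_def)
  define L' where "L' = 1 + (\<Sum>k\<le>K. \<bar>L k\<bar>)"
  have L'k: "L k \<le> L'" if "k \<le> K" for k
  proof -
    have "\<bar>L k\<bar> \<le> (\<Sum>k\<le>K. \<bar>L k\<bar>)" using that by (intro member_le_sum) auto
    then show ?thesis by (simp add: L'_def)
  qed
  have L'0: "L' > 0" unfolding L'_def by (intro add_pos_nonneg sum_nonneg) auto
  define R' where "R' = max R 1"
  have tend: "((\<lambda>z::complex. norm z) \<longlongrightarrow> 0) (at 0)" by (intro tendsto_norm_zero tendsto_ident_at)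
  have small: "\<forall>\<^sub>F z::complex in at 0. c * norm z ^ 2 < e" if "e > 0" for c e
  proof -
    have "((\<lambda>z::complex. c * norm z ^ 2) \<longlongrightarrow> c * 0 ^ 2) (at 0)" by (intro tendsto_intros tend)
    then show ?thesis using that by (intro order_tendstoD(2)) auto
  qed
  have small1: "\<forall>\<^sub>F z::complex in at 0. 2 * L' * max R' (2 * L') * norm z ^ 2 < 1"
    and small2: "\<forall>\<^sub>F z::complex in at 0. L' * norm z ^ 2 < 1 / 2" by (intro small, simp)+
  have "\<forall>\<^sub>F z in at 0. \<forall>k\<in>{..K}. \<forall>j<n. \<nu> k z j \<in> {a..1 - a} \<or> \<nu> k z j \<le> L k * norm z ^ 2 \<or> 1 - \<nu> k z j \<le> L k * norm z ^ 2"
    using L by (intro eventually_ball_finite) auto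
  moreover have "\<forall>\<^sub>F z in at (0::complex). norm z < a / (1 - a)" using a by (intro order_tendstoD(2)[OF tend]) auto
  moreover have "\<forall>\<^sub>F z in at (0::complex). z \<noteq> 0" by (simp add: eventually_at_filter)
  ultimately have "\<forall>\<^sub>F z in at 0. norm ((\<Sum>j<n. x z j powr \<beta>) - (\<Sum>k\<le>K. norm z powr (2 * real k * \<beta>) *
      (\<Sum>j<n. if \<nu> k z j \<in> {a..1 - a} then ((1 - \<nu> k z j) / \<nu> k z j) powr \<beta> else 0)))
      \<le> (real n * max R' (2 * L') powr \<beta>) * norm (norm z powr (2 * real (Suc K) * \<beta>))"
    using small1 small2 R
  proof eventually_elim
    case (elim z)
    let ?s = "\<lambda>k j. norm z powr (2 * real k * \<beta>) *
       (if \<nu> k z j \<in> {a..1 - a} then ((1 - \<nu> k z j) / \<nu> k z j) powr \<beta> else 0)"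
    have eq: "(\<Sum>j<n. x z j powr \<beta>) - (\<Sum>k\<le>K. norm z powr (2 * real k * \<beta>) *
      (\<Sum>j<n. if \<nu> k z j \<in> {a..1 - a} then ((1 - \<nu> k z j) / \<nu> k z j) powr \<beta> else 0)) =
      (\<Sum>j<n. x z j powr \<beta> - (\<Sum>k\<le>K. ?s k j))"
      unfolding sum_subtractf sum_distrib_left by (subst (2) sum.swap) rule
    have "\<bar>\<Sum>j<n. x z j powr \<beta> - (\<Sum>k\<le>K. ?s k j)\<bar> \<le> (\<Sum>j<n. max R' (2 * L') powr \<beta> * norm z powr (2 * real (Suc K) * \<beta>))"
    proof (rule sum_abs[THEN order_trans], rule sum_mono)
      fix j assume j: "j \<in> {..<n}"
      show "\<bar>x z j powr \<beta> - (\<Sum>k\<le>K. ?s k j)\<bar> \<le> max R' (2 * L') powr \<beta> * norm z powr (2 * real (Suc K) * \<beta>)"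
        unfolding \<nu>_def
      proof (rule window_decomposition[OF a \<beta>])
        fix k assume k: "k \<le> K"
        have "L k * norm z ^ 2 \<le> L' * norm z ^ 2" using L'k[OF k] by (intro mult_right_mono) auto
        then show "inverse (1 + x z j / norm z ^ (2 * k)) \<in> {a..1 - a} \<or>
            inverse (1 + x z j / norm z ^ (2 * k)) \<le> L' * norm z ^ 2 \<or>
            1 - inverse (1 + x z j / norm z ^ (2 * k)) \<le> L' * norm z ^ 2"
          using bspec[OF elim(1), of k] k j unfolding \<nu>_def by force
      next
        have "x z j \<le> R" using elim(6) j by simp
        then show "x z j \<le> R'" by (simp add: R'_def)
        show "0 < norm z" "norm z < a / (1 - a)" using elim(2,3) by simp_all
        show "0 \<le> x z j" "0 < L'" "0 < R'" using x0 L'0 by (simp_all add: R'_def)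
        show "L' * norm z ^ 2 \<le> 1 / 2" "2 * L' * max R' (2 * L') * norm z ^ 2 < 1"
          using elim(4,5) by (simp_all only: less_imp_le)
      qed
    qed
    also have "\<dots> = (real n * max R' (2 * L') powr \<beta>) * norm (norm z powr (2 * real (Suc K) * \<beta>))"
      by simp
    finally show ?case unfolding eq real_norm_def .
  qed
  then show ?thesis by (rule bigoI)
qed

section \<open>Averaging over the fourth roots of unity\<close>

text \<open>
  The mean over the fourth roots of unity annihilates $z$, $\bar z$, $z^2$ and $\bar z^2$ and keeps
  $|z|^2$, so that the second-order terms can be averaged pointwise, before any integration.
\<close>

definition four_mean :: "(complex \<Rightarrow> real) \<Rightarrow> complex \<Rightarrow> real" where
  "four_mean F z = (F z + F (\<i> * z) + F (- z) + F (- (\<i> * z))) / 4"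

lemma bigo_rotate:
  fixes f :: "complex \<Rightarrow> real"
  assumes "f \<in> O[at 0](\<lambda>z. g (norm z))" and u: "norm u = 1"
  shows "(\<lambda>z. f (u * z)) \<in> O[at 0](\<lambda>z. g (norm z))"
proof -
  have "u \<noteq> 0" using u by auto
  then have "filterlim (\<lambda>z. u * z) (at 0) (at 0)"
    unfolding filterlim_at by (auto intro!: tendsto_eq_intros simp: eventually_at_filter)
  from landau_o.big.compose[OF assms(1) this] show ?thesis by (simp add: norm_mult u)
qed

lemma bigo_four_mean:
  assumes "f \<in> O[at 0](\<lambda>z. g (norm z))"
  shows "four_mean f \<in> O[at 0](\<lambda>z. g (norm z))"
proof -
  have "(\<lambda>z. f (u * z)) \<in> O[at 0](\<lambda>z. g (norm z))" if "u \<in> {1, \<i>, -1, - \<i>}" for u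
    using that by (intro bigo_rotate[OF assms]) auto
  from this[of 1] this[of \<i>] this[of "-1"] this[of "- \<i>"]
  have "(\<lambda>z. (f z + f (\<i> * z) + f (- z) + f (- (\<i> * z))) / 4) \<in> O[at 0](\<lambda>z. g (norm z))"
    by (auto intro!: sum_in_bigo)
  then show ?thesis by (simp add: four_mean_def[abs_def])
qed

text \<open>The four points form two antipodal pairs, and each pair alone has mean c up to
  O(|z|^2).\<close>

lemma even_expansion_four_mean:
  fixes F :: "complex \<Rightarrow> real"
  assumes F: "even_expansion F c"
  shows "(\<lambda>z. four_mean F z - c) \<in> O[at 0](\<lambda>z. norm z ^ 2)"
proof -
  have 1: "(\<lambda>z. F z + F (-z) - 2 * c) \<in> O[at 0](\<lambda>z. norm z ^ 2)"
    using F by (simp add: even_expansion_def)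
  have 2: "(\<lambda>z. F (\<i> * z) + F (- (\<i> * z)) - 2 * c) \<in> O[at 0](\<lambda>z. norm z ^ 2)"
    using bigo_rotate[of _ "\<lambda>t. t ^ 2" \<i>, OF 1] by simp
  have "(\<lambda>z. ((F z + F (-z) - 2 * c) + (F (\<i> * z) + F (- (\<i> * z)) - 2 * c)) / 4) \<in> O[at 0](\<lambda>z. norm z ^ 2)"
    using sum_in_bigo(1)[OF 1 2] by simp
  then show ?thesis by (simp add: four_mean_def algebra_simps add_divide_distrib diff_divide_distrib)
qed

lemma powr_norm_smallo:
  assumes "r > 2"
  shows "(\<lambda>z::complex. norm z powr r) \<in> o[at 0](\<lambda>z. norm z ^ 2)"
proof (rule smalloI_tendsto)
  have "((\<lambda>z::complex. norm z powr (r - 2)) \<longlongrightarrow> 0 powr (r - 2)) (at 0)"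
    using assms by (intro tendsto_powr' tendsto_norm_zero tendsto_ident_at tendsto_const) auto
  moreover have "\<forall>\<^sub>F z in at (0::complex). norm z powr (r - 2) = norm z powr r / norm z ^ 2"
    by (auto simp: eventually_at_filter powr_diff intro!: always_eventually)
  ultimately show "((\<lambda>z::complex. norm z powr r / norm z ^ 2) \<longlongrightarrow> 0) (at 0)"
    by (simp add: tendsto_cong)
qed (auto simp: eventually_at_filter)

lemma sum_in_smallo_finite:
  fixes f :: "'b \<Rightarrow> 'a \<Rightarrow> real"
  assumes "\<And>i. i \<in> I \<Longrightarrow> f i \<in> o[F](g)"
  shows "(\<lambda>z. \<Sum>i\<in>I. f i z) \<in> o[F](g)"
  using assms by (induction I rule: infinite_finite_induct) (auto intro: sum_in_smallo)

text \<open>Powers of |z| are constant on the four points, so they factor out of the mean, and each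
  window with k \<ge> 1 only contributes its limit c k up to o(|z|^2). The condition on K makes the
  remainder negligible.\<close>

lemma four_mean_expansion:
  fixes F :: "complex \<Rightarrow> real" and \<Phi> :: "nat \<Rightarrow> complex \<Rightarrow> real" and p b c0 :: real
  assumes p: "p > 0" "real (Suc K) * p > 2"
    and F: "(\<lambda>z. F z - (\<Sum>k\<le>K. norm z powr (real k * p) * \<Phi> k z)) \<in> O[at 0](\<lambda>z. norm z powr (real (Suc K) * p))"
    and \<Phi>0: "(\<lambda>z. four_mean (\<Phi> 0) z - (c0 + b * norm z ^ 2)) \<in> o[at 0](\<lambda>z. norm z ^ 2)"
    and \<Phi>: "\<And>k. \<lbrakk>1 \<le> k; k \<le> K\<rbrakk> \<Longrightarrow> even_expansion (\<Phi> k) (c k)"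
  shows "(\<lambda>z. four_mean F z - (c0 + (\<Sum>k=1..K. c k * norm z powr (real k * p)) + b * norm z ^ 2))
     \<in> o[at 0](\<lambda>z. norm z ^ 2)"
proof -
  have "four_mean (\<lambda>z. F z - (\<Sum>k\<le>K. norm z powr (real k * p) * \<Phi> k z)) \<in> O[at 0](\<lambda>z. norm z powr (real (Suc K) * p))"
    using bigo_four_mean[of _ "\<lambda>t. t powr (real (Suc K) * p)", OF F] .
  from landau_o.big_small_trans[OF this powr_norm_smallo[OF p(2)]]
  have 1: "four_mean (\<lambda>z. F z - (\<Sum>k\<le>K. norm z powr (real k * p) * \<Phi> k z)) \<in> o[at 0](\<lambda>z. norm z ^ 2)" .
  have 2: "(\<lambda>z. norm z powr (real k * p) * (four_mean (\<Phi> k) z - c k)) \<in> o[at 0](\<lambda>z. norm z ^ 2)"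
    if k: "1 \<le> k" "k \<le> K" for k
  proof -
    have "real k * p > 0" using k p by simp
    then have "((\<lambda>z::complex. norm z powr (real k * p)) \<longlongrightarrow> 0 powr (real k * p)) (at 0)"
      by (intro tendsto_powr' tendsto_norm_zero tendsto_ident_at tendsto_const) auto
    then have "(\<lambda>z::complex. norm z powr (real k * p)) \<in> o[at 0](\<lambda>_. 1)"
      by (intro smalloI_tendsto) auto
    from landau_o.small_big_mult[OF this even_expansion_four_mean[OF \<Phi>[OF k]]] show ?thesis by simp
  qed
  have 3: "(\<lambda>z. \<Sum>k=1..K. norm z powr (real k * p) * (four_mean (\<Phi> k) z - c k)) \<in> o[at 0](\<lambda>z. norm z ^ 2)"
    using 2 by (intro sum_in_smallo_finite) auto
  have eq: "four_mean F z - (c0 + (\<Sum>k=1..K. c k * norm z powr (real k * p)) + b * norm z ^ 2) =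
      four_mean (\<lambda>z. F z - (\<Sum>k\<le>K. norm z powr (real k * p) * \<Phi> k z)) z +
      (four_mean (\<Phi> 0) z - (c0 + b * norm z ^ 2)) +
      (\<Sum>k=1..K. norm z powr (real k * p) * (four_mean (\<Phi> k) z - c k))" if "z \<noteq> 0" for z
  proof -
    have "four_mean (\<lambda>z. F z - (\<Sum>k\<le>K. norm z powr (real k * p) * \<Phi> k z)) z =
        four_mean F z - (\<Sum>k\<le>K. norm z powr (real k * p) * four_mean (\<Phi> k) z)"
      by (simp add: four_mean_def norm_mult sum.distrib sum_divide_distrib[symmetric] distrib_left
          diff_divide_distrib add_divide_distrib)
    \<comment> \<open>\<open>0 powr 0\<close> is 0, so the term k = 0 has coefficient 1 only for z
      \<noteq> 0.\<close>
    also have "(\<Sum>k\<le>K. norm z powr (real k * p) * four_mean (\<Phi> k) z) =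
        four_mean (\<Phi> 0) z + (\<Sum>k=1..K. norm z powr (real k * p) * four_mean (\<Phi> k) z)"
      using that by (simp add: atMost_atLeast0 sum.atLeast_Suc_atMost)
    finally show ?thesis by (simp add: algebra_simps sum_subtractf)
  qed
  have "(\<lambda>z. four_mean (\<lambda>z. F z - (\<Sum>k\<le>K. norm z powr (real k * p) * \<Phi> k z)) z +
      (four_mean (\<Phi> 0) z - (c0 + b * norm z ^ 2)) +
      (\<Sum>k=1..K. norm z powr (real k * p) * (four_mean (\<Phi> k) z - c k))) \<in> o[at 0](\<lambda>z. norm z ^ 2)"
    by (intro sum_in_smallo(1) 1 3 \<Phi>0)
  moreover have "\<forall>\<^sub>F z in at 0. four_mean F z - (c0 + (\<Sum>k=1..K. c k * norm z powr (real k * p)) + b * norm z ^ 2) =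
      four_mean (\<lambda>z. F z - (\<Sum>k\<le>K. norm z powr (real k * p) * \<Phi> k z)) z +
      (four_mean (\<Phi> 0) z - (c0 + b * norm z ^ 2)) +
      (\<Sum>k=1..K. norm z powr (real k * p) * (four_mean (\<Phi> k) z - c k))"
    unfolding eventually_at_filter using eq by (intro always_eventually) auto
  ultimately show ?thesis by (simp only: landau_o.small.in_cong)
qed

section \<open>Second-order expansion of traces of powers\<close>

text \<open>The coefficients of z^2 and of the squared conjugate stay existential because the mean
  over the fourth roots of unity removes them. The linear coefficients are recorded because their
  products enter \<open>c11\<close> when functions are multiplied.\<close>

definition second_order :: "(complex \<Rightarrow> complex) \<Rightarrow> complex \<Rightarrow> complex \<Rightarrow> complex \<Rightarrow> complex \<Rightarrow> bool" where
  "second_order F c0 c1 c2 c11 \<longleftrightarrow> (\<exists>c20 c02.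
     (\<lambda>z. F z - (c0 + (c1 * z + c2 * cnj z) + (c11 * (z * cnj z) + c20 * z ^ 2 + c02 * cnj z ^ 2)))
       \<in> O[at 0](\<lambda>z. of_real (norm z) ^ 3))"

lemma second_order_exact:
  assumes "\<And>z. F z = c0 + (c1 * z + c2 * cnj z) + c11 * (z * cnj z)"
  shows "second_order F c0 c1 c2 c11"
  unfolding second_order_def using assms by (intro exI[of _ 0]) simp

lemma second_order_add:
  assumes "second_order F c0 c1 c2 c11" "second_order G d0 d1 d2 d11"
  shows "second_order (\<lambda>z. F z + G z) (c0 + d0) (c1 + d1) (c2 + d2) (c11 + d11)"
proof -
  from assms obtain c20 c02 d20 d02 where
    F: "(\<lambda>z. F z - (c0 + (c1 * z + c2 * cnj z) + (c11 * (z * cnj z) + c20 * z ^ 2 + c02 * cnj z ^ 2)))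
       \<in> O[at 0](\<lambda>z. of_real (norm z) ^ 3)" and
    G: "(\<lambda>z. G z - (d0 + (d1 * z + d2 * cnj z) + (d11 * (z * cnj z) + d20 * z ^ 2 + d02 * cnj z ^ 2)))
       \<in> O[at 0](\<lambda>z. of_real (norm z) ^ 3)"
    unfolding second_order_def by blast
  show ?thesis
    unfolding second_order_def
    by (rule exI[of _ "c20 + d20"], rule exI[of _ "c02 + d02"])
      (use sum_in_bigo(1)[OF F G] in \<open>simp add: algebra_simps\<close>)
qed

lemma second_order_zero: "second_order (\<lambda>_. 0) 0 0 0 0"
  by (rule second_order_exact) simp

lemma second_order_sum:
  assumes "\<And>i. i \<in> I \<Longrightarrow> second_order (F i) (c0 i) (c1 i) (c2 i) (c11 i)"
  shows "second_order (\<lambda>z. \<Sum>i\<in>I. F i z) (sum c0 I) (sum c1 I) (sum c2 I) (sum c11 I)"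
  using assms
  by (induction I rule: infinite_finite_induct) (auto intro: second_order_zero second_order_add)

lemma norm_power_bigo:
  fixes m k :: nat
  assumes "k \<le> m"
  shows "(\<lambda>z::complex. complex_of_real (norm z) ^ m) \<in> O[at 0](\<lambda>z. of_real (norm z) ^ k)"
proof (rule bigoI[where c = 1])
  have "\<forall>\<^sub>F z in at (0::complex). norm z < 1"
    using eventually_at_ball[of 1 "0::complex" UNIV] by (auto elim!: eventually_mono)
  then show "\<forall>\<^sub>F z in at (0::complex). norm (complex_of_real (norm z) ^ m) \<le> 1 * norm (complex_of_real (norm z) ^ k)"
    by eventually_elim (use assms in \<open>simp add: norm_power power_decreasing\<close>)
qed

lemma linear_bigo: "(\<lambda>z. c1 * z + c2 * cnj z) \<in> O[at 0](\<lambda>z. complex_of_real (norm z))"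
proof -
  have "(\<lambda>z. z) \<in> O[at 0](\<lambda>z. complex_of_real (norm z))" "cnj \<in> O[at 0](\<lambda>z. complex_of_real (norm z))"
    by (auto intro!: bigoI[where c = 1])
  then show ?thesis by (intro sum_in_bigo) auto
qed

lemma quadratic_bigo:
  "(\<lambda>z. c11 * (z * cnj z) + c20 * z ^ 2 + c02 * cnj z ^ 2) \<in> O[at 0](\<lambda>z. complex_of_real (norm z) ^ 2)"
proof -
  have "(\<lambda>z. z * cnj z) \<in> O[at 0](\<lambda>z. complex_of_real (norm z) ^ 2)"
    "(\<lambda>z. z ^ 2) \<in> O[at 0](\<lambda>z. complex_of_real (norm z) ^ 2)"
    "(\<lambda>z. cnj z ^ 2) \<in> O[at 0](\<lambda>z. complex_of_real (norm z) ^ 2)"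
    by (auto intro!: bigoI[where c = 1] simp: norm_mult norm_power power2_eq_square)
  then show ?thesis by (intro sum_in_bigo) auto
qed

lemma second_order_mult:
  assumes "second_order F c0 c1 c2 c11" "second_order G d0 d1 d2 d11"
  shows "second_order (\<lambda>z. F z * G z) (c0 * d0) (c0 * d1 + c1 * d0) (c0 * d2 + c2 * d0)
    (c0 * d11 + c11 * d0 + c1 * d2 + c2 * d1)"
proof -
  let ?n = "\<lambda>z::complex. complex_of_real (norm z)"
  from assms obtain c20 c02 d20 d02 where
    F: "(\<lambda>z. F z - (c0 + (c1 * z + c2 * cnj z) + (c11 * (z * cnj z) + c20 * z ^ 2 + c02 * cnj z ^ 2)))
       \<in> O[at 0](\<lambda>z. ?n z ^ 3)" and
    G: "(\<lambda>z. G z - (d0 + (d1 * z + d2 * cnj z) + (d11 * (z * cnj z) + d20 * z ^ 2 + d02 * cnj z ^ 2)))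
       \<in> O[at 0](\<lambda>z. ?n z ^ 3)"
    unfolding second_order_def by blast
  define lF qF lG qG where "lF z = c1 * z + c2 * cnj z" and "qF z = c11 * (z * cnj z) + c20 * z ^ 2 + c02 * cnj z ^ 2"
    and "lG z = d1 * z + d2 * cnj z" and "qG z = d11 * (z * cnj z) + d20 * z ^ 2 + d02 * cnj z ^ 2" for z
  define f g where "f z = F z - (c0 + lF z + qF z)" and "g z = G z - (d0 + lG z + qG z)" for z
  have f: "f \<in> O[at 0](\<lambda>z. ?n z ^ 3)" and g: "g \<in> O[at 0](\<lambda>z. ?n z ^ 3)"
    using F G unfolding f_def g_def lF_def qF_def lG_def qG_def by simp_all
  have l: "lF \<in> O[at 0](?n)" "lG \<in> O[at 0](?n)"
    unfolding lF_def[abs_def] lG_def[abs_def] by (rule linear_bigo)+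
  have q: "qF \<in> O[at 0](\<lambda>z. ?n z ^ 2)" "qG \<in> O[at 0](\<lambda>z. ?n z ^ 2)"
    unfolding qF_def[abs_def] qG_def[abs_def] by (rule quadratic_bigo)+
  have one: "(\<lambda>z. c + l z + q z) \<in> O[at 0](\<lambda>_. 1 :: complex)"
    if "l \<in> O[at 0](?n)" "q \<in> O[at 0](\<lambda>z. ?n z ^ 2)" for l q and c :: complex
    using that norm_power_bigo[of 0 1] norm_power_bigo[of 0 2]
    by (intro sum_in_bigo) (auto intro: landau_o.big_trans)
  have lq: "(\<lambda>z. l z * q z) \<in> O[at 0](\<lambda>z. ?n z ^ 3)" "(\<lambda>z. q z * l z) \<in> O[at 0](\<lambda>z. ?n z ^ 3)"
    if "l \<in> O[at 0](?n)" "q \<in> O[at 0](\<lambda>z. ?n z ^ 2)" for l q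
    using landau_o.big.mult[OF that] by (simp_all add: power3_eq_cube power2_eq_square mult_ac)
  have qq: "(\<lambda>z. qF z * qG z) \<in> O[at 0](\<lambda>z. ?n z ^ 3)"
  proof -
    have "(\<lambda>z. ?n z ^ 2 * ?n z ^ 2) = (\<lambda>z. ?n z ^ 4)" by (simp only: power_add[symmetric]) simp
    from landau_o.big_trans[OF landau_o.big.mult[OF q, unfolded this] norm_power_bigo] show ?thesis by simp
  qed
  have fG: "(\<lambda>z. f z * (d0 + lG z + qG z)) \<in> O[at 0](\<lambda>z. ?n z ^ 3)"
    using landau_o.big.mult[OF f one[OF l(2) q(2)]] by simp
  have Fg: "(\<lambda>z. (c0 + lF z + qF z) * g z) \<in> O[at 0](\<lambda>z. ?n z ^ 3)"
    using landau_o.big.mult[OF one[OF l(1) q(1)] g] by simp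
  have fg: "(\<lambda>z. f z * g z) \<in> O[at 0](\<lambda>z. ?n z ^ 3)"
  proof -
    have "(\<lambda>z. ?n z ^ 3 * ?n z ^ 3) = (\<lambda>z. ?n z ^ 6)" by (simp only: power_add[symmetric]) simp
    from landau_o.big_trans[OF landau_o.big.mult[OF f g, unfolded this] norm_power_bigo] show ?thesis by simp
  qed
  \<comment> \<open>These are exactly the parts of the expanded product that have order at least
    three.\<close>
  have "(\<lambda>z. f z * (d0 + lG z + qG z) + (c0 + lF z + qF z) * g z + f z * g z + lF z * qG z + qF z * lG z + qF z * qG z)
      \<in> O[at 0](\<lambda>z. ?n z ^ 3)"
    by (intro sum_in_bigo(1) fG Fg fg qq lq l q)
  moreover have eq: "F z * G z - (c0 * d0 + ((c0 * d1 + c1 * d0) * z + (c0 * d2 + c2 * d0) * cnj z) +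
      ((c0 * d11 + c11 * d0 + c1 * d2 + c2 * d1) * (z * cnj z) + (c0 * d20 + c20 * d0 + c1 * d1) * z ^ 2 +
       (c0 * d02 + c02 * d0 + c2 * d2) * cnj z ^ 2)) =
     f z * (d0 + lG z + qG z) + (c0 + lF z + qF z) * g z + f z * g z + lF z * qG z + qF z * lG z + qF z * qG z" for z
  proof -
    have FG: "F z = f z + (c0 + lF z + qF z)" "G z = g z + (d0 + lG z + qG z)" by (simp_all add: f_def g_def)
    have ll: "lF z * lG z = c1 * d1 * z ^ 2 + c2 * d2 * cnj z ^ 2 + (c1 * d2 + c2 * d1) * (z * cnj z)"
      by (simp add: lF_def lG_def algebra_simps power2_eq_square)
    have "F z * G z = f z * (d0 + lG z + qG z) + (c0 + lF z + qF z) * g z + f z * g z + lF z * qG z + qF z * lG z +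
        qF z * qG z + c0 * d0 + c0 * lG z + lF z * d0 + lF z * lG z + c0 * qG z + qF z * d0"
      unfolding FG by (simp add: algebra_simps)
    then show ?thesis
      unfolding ll by (simp add: lF_def lG_def qF_def qG_def) (simp add: algebra_simps)
  qed
  ultimately show ?thesis
    unfolding second_order_def
    by (intro exI[of _ "c0 * d20 + c20 * d0 + c1 * d1"] exI[of _ "c0 * d02 + c02 * d0 + c2 * d2"])
      (simp only: eq)
qed

lemma second_order_four_mean:
  fixes G :: "complex \<Rightarrow> real"
  assumes "second_order (\<lambda>z. of_real (G z)) c0 c1 c2 c11"
  shows "(\<lambda>z. four_mean G z - (Re c0 + Re c11 * norm z ^ 2)) \<in> O[at 0](\<lambda>z. norm z ^ 3)"
proof -
  from assms obtain c20 c02 where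
    F: "(\<lambda>z. of_real (G z) - (c0 + (c1 * z + c2 * cnj z) + (c11 * (z * cnj z) + c20 * z ^ 2 + c02 * cnj z ^ 2)))
       \<in> O[at 0](\<lambda>z. of_real (norm z) ^ 3)" unfolding second_order_def by blast
  define r where "r z = of_real (G z) - (c0 + (c1 * z + c2 * cnj z) + (c11 * (z * cnj z) + c20 * z ^ 2 + c02 * cnj z ^ 2))" for z
  from F obtain K where K: "\<forall>\<^sub>F z in at 0. norm (r z) \<le> K * norm (complex_of_real (norm z) ^ 3)"
    unfolding r_def by (elim landau_o.bigE)
  then have "\<forall>\<^sub>F z in at 0. norm (Re (r z)) \<le> K * norm (norm z ^ 3)"
    by eventually_elim (use abs_Re_le_cmod order_trans in \<open>auto simp: norm_power\<close>)
  then have "(\<lambda>z. Re (r z)) \<in> O[at 0](\<lambda>z. norm z ^ 3)" by (rule bigoI)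
  from bigo_four_mean[of _ "\<lambda>t. t ^ 3", OF this]
  have "four_mean (\<lambda>z. Re (r z)) \<in> O[at 0](\<lambda>z. norm z ^ 3)" .
  moreover have "four_mean (\<lambda>z. Re (r z)) = (\<lambda>z. four_mean G z - (Re c0 + Re c11 * norm z ^ 2))"
  proof
    fix z
    have nsq: "complex_of_real (norm z ^ 2) = z * cnj z" by (rule complex_norm_square)
    have "r z + r (\<i> * z) + r (- z) + r (- (\<i> * z)) =
        of_real (G z + G (\<i> * z) + G (- z) + G (- (\<i> * z))) - 4 * c0 - 4 * c11 * of_real (norm z ^ 2)"
      unfolding nsq by (simp add: r_def algebra_simps power2_eq_square)
    from arg_cong[OF this, of Re]
    show "four_mean (\<lambda>z. Re (r z)) z = four_mean G z - (Re c0 + Re c11 * norm z ^ 2)" by (simp add: four_mean_def field_simps)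
  qed
  ultimately show ?thesis by simp
qed

lemma second_order_tendsto:
  assumes "second_order F c0 c1 c2 c11"
  shows "(F \<longlongrightarrow> c0) (at 0)"
proof -
  let ?n = "\<lambda>z::complex. complex_of_real (norm z)"
  from assms obtain c20 c02 where
    F: "(\<lambda>z. F z - (c0 + (c1 * z + c2 * cnj z) + (c11 * (z * cnj z) + c20 * z ^ 2 + c02 * cnj z ^ 2)))
       \<in> O[at 0](\<lambda>z. of_real (norm z) ^ 3)" unfolding second_order_def by blast
  have "(\<lambda>z. ?n z ^ 3) \<in> o[at 0](\<lambda>_. 1)" by (intro smalloI_tendsto) (auto intro!: tendsto_eq_intros)
  from smalloD_tendsto[OF landau_o.big_small_trans[OF F this]]
  have "((\<lambda>z. F z - (c0 + (c1 * z + c2 * cnj z) + (c11 * (z * cnj z) + c20 * z ^ 2 + c02 * cnj z ^ 2))) \<longlongrightarrow> 0) (at 0)" by simp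
  moreover have "((\<lambda>z. c0 + (c1 * z + c2 * cnj z) + (c11 * (z * cnj z) + c20 * z ^ 2 + c02 * cnj z ^ 2)) \<longlongrightarrow> c0) (at 0)"
    by (auto intro!: tendsto_eq_intros)
  ultimately show ?thesis using tendsto_add by fastforce
qed

text \<open>The divided difference of u^m, which equals the sum of x^a y^b over a + b = m - 1. For m
  = 0 and x = y the factor \<open>of_nat m\<close> makes it 0.\<close>

definition power_quotient :: "nat \<Rightarrow> 'a::field \<Rightarrow> 'a \<Rightarrow> 'a" where
  "power_quotient m x y = (if x = y then of_nat m * x ^ (m - 1) else (x ^ m - y ^ m) / (x - y))"

lemma power_quotient_0 [simp]: "power_quotient 0 x y = 0"
  by (simp add: power_quotient_def)

lemma power_quotient_sym: "power_quotient m x y = power_quotient m y x"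
  unfolding power_quotient_def by (auto simp: divide_simps) (simp add: algebra_simps)

lemma power_quotient_Suc: "power_quotient (Suc m) x y = x ^ m + y * power_quotient m x y"
  unfolding power_quotient_def
  by (cases m) (auto simp: field_simps)

text \<open>
  With $h_m$ for \<open>power_quotient m\<close>, this is $\sum_{a+b=m-1} x^a h_b(x, y)$, which collects the second-order
  contributions to a diagonal entry of $H^m$.
\<close>

fun power_quotient_sum :: "nat \<Rightarrow> 'a::field \<Rightarrow> 'a \<Rightarrow> 'a" where
  "power_quotient_sum 0 x y = 0"
| "power_quotient_sum (Suc m) x y = x * power_quotient_sum m x y + power_quotient m x y"

text \<open>Since (x - y) h_b = x^b - y^b, multiplying the sum by x - y collapses it to m x^{m-1} -
  h_m. The further factor x avoids the exponent m - 1 at m = 0.\<close>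

lemma power_quotient_sum_closed:
  "x * (x - y) * power_quotient_sum m x y = of_nat m * x ^ m - x * power_quotient m x y"
proof (induction m)
  case (Suc m)
  have "x * (x - y) * power_quotient_sum (Suc m) x y =
      x * (x * (x - y) * power_quotient_sum m x y) + x * (x - y) * power_quotient m x y"
    by (simp add: algebra_simps)
  also have "\<dots> = of_nat (Suc m) * x ^ Suc m - x * power_quotient (Suc m) x y"
    unfolding Suc power_quotient_Suc by (simp add: algebra_simps)
  finally show ?case .
qed simp

text \<open>At x = y the closed form reduces to 0 = 0, so this case has an induction of its
  own.\<close>

lemma power_quotient_sum_diag:
  "2 * x * power_quotient_sum m x x = (of_nat m - 1) * power_quotient m x x"
proof (induction m)
  case (Suc m)
  have "2 * x * power_quotient_sum (Suc m) x x = x * (2 * x * power_quotient_sum m x x) + 2 * x * power_quotient m x x"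
    by (simp add: algebra_simps)
  also have "\<dots> = (of_nat (Suc m) - 1) * power_quotient (Suc m) x x"
    unfolding Suc by (cases m) (simp_all add: power_quotient_def algebra_simps)
  finally show ?case .
qed simp

text \<open>\<open>power_quotient_sum m x y\<close> is the x-derivative of h_m(x, y), a form of
  degree m - 1. So this is Euler's identity for h_m, plus the one h_m released by the successor
  step.\<close>

lemma power_quotient_sum_swap:
  "power_quotient_sum (Suc m) y x + x * power_quotient_sum m x y = of_nat m * power_quotient m x y"
proof (cases "x = y")
  case True
  then show ?thesis using power_quotient_sum_diag[of x m] by (simp add: algebra_simps)
next
  case False
  have "(x - y) * (y * power_quotient_sum m y x + x * power_quotient_sum m x y) =
      x * (x - y) * power_quotient_sum m x y - y * (y - x) * power_quotient_sum m y x"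
    by (simp add: algebra_simps)
  also have "\<dots> = of_nat m * (x ^ m - y ^ m) - (x - y) * power_quotient m x y"
    unfolding power_quotient_sum_closed power_quotient_sym[of m y x] by (simp add: algebra_simps)
  also have "x ^ m - y ^ m = (x - y) * power_quotient m x y"
    using False by (simp add: power_quotient_def)
  finally have "(x - y) * (y * power_quotient_sum m y x + x * power_quotient_sum m x y) =
      (x - y) * ((of_nat m - 1) * power_quotient m x y)" by (simp add: algebra_simps)
  then have "y * power_quotient_sum m y x + x * power_quotient_sum m x y = (of_nat m - 1) * power_quotient m x y"
    using False by (simp only: mult_cancel_left right_minus_eq) simp
  then show ?thesis by (simp add: power_quotient_sym[of m y x] algebra_simps)
qed

text \<open>Induction on m, multiplying H^m by H. The off-diagonal second-order coefficients
  \<kappa> can stay anonymous: they meet only the diagonal zeroth-order part of H and keep their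
  position, so the diagonal ones obey a recurrence of their own.\<close>

lemma second_order_trace_power:
  fixes \<tau> :: "nat \<Rightarrow> complex" and B :: "complex mat"
  assumes B: "B \<in> carrier_mat n n"
  defines "H \<equiv> \<lambda>z. mat_adjoint (mat_diag n \<tau> + z \<cdot>\<^sub>m B) * (mat_diag n \<tau> + z \<cdot>\<^sub>m B)"
    and "\<mu> \<equiv> \<lambda>i. \<tau> i * cnj (\<tau> i)"
  shows "\<exists>c1 c2. second_order (\<lambda>z. mat_trace n (H z ^\<^sub>m m)) (\<Sum>i<n. \<mu> i ^ m) c1 c2
    (\<Sum>i<n. \<Sum>l<n. B $$ (i, l) * cnj (B $$ (i, l)) * (of_nat m * power_quotient m (\<mu> i) (\<mu> l)))"
proof -
  define b where "b i l = B $$ (i, l) * cnj (B $$ (i, l))" for i l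
  define D where "D i j = (\<Sum>l<n. cnj (B $$ (l, i)) * B $$ (l, j))" for i j
  have Hc: "H z \<in> carrier_mat n n" for z
    unfolding H_def using B by (intro mult_carrier_mat[of _ n n]) auto
  have Hij: "H z $$ (i, j) = (if i = j then \<mu> i else 0) + (cnj (\<tau> i) * B $$ (i, j) * z + cnj (B $$ (j, i)) * \<tau> j * cnj z)
      + D i j * (z * cnj z)" if "i < n" "j < n" for i j z
  proof -
    have "H z $$ (i, j) = (\<Sum>l<n. mat_adjoint (mat_diag n \<tau> + z \<cdot>\<^sub>m B) $$ (i, l) * (mat_diag n \<tau> + z \<cdot>\<^sub>m B) $$ (l, j))"
      unfolding H_def using B that by (intro mat_mult_index_sum) auto
    also have "\<dots> = (\<Sum>l<n. (if l = i then cnj (\<tau> i) * ((if i = j then \<tau> j else 0) + z * B $$ (i, j)) else 0) +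
        ((if l = j then cnj z * cnj (B $$ (j, i)) * \<tau> j else 0) + z * cnj z * (cnj (B $$ (l, i)) * B $$ (l, j))))"
      using B that by (intro sum.cong refl) (auto simp: mat_diag_def algebra_simps)
    also have "\<dots> = cnj (\<tau> i) * ((if i = j then \<tau> j else 0) + z * B $$ (i, j)) +
        (cnj z * cnj (B $$ (j, i)) * \<tau> j + z * cnj z * D i j)"
      unfolding sum.distrib using that by (simp add: D_def sum_distrib_left)
    finally show ?thesis by (simp add: \<mu>_def algebra_simps)
  qed
  have H2: "second_order (\<lambda>z. H z $$ (i, j)) (if i = j then \<mu> i else 0) (cnj (\<tau> i) * B $$ (i, j))
      (cnj (B $$ (j, i)) * \<tau> j) (D i j)" if "i < n" "j < n" for i j
    using Hij[OF that] by (intro second_order_exact)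
  let ?h = "\<lambda>m i j. power_quotient m (\<mu> i) (\<mu> j)"
  have "\<exists>\<kappa>. (\<forall>i<n. \<forall>j<n. second_order (\<lambda>z. (H z ^\<^sub>m m) $$ (i, j)) (if i = j then \<mu> i ^ m else 0)
        (?h m i j * (cnj (\<tau> i) * B $$ (i, j))) (?h m i j * (cnj (B $$ (j, i)) * \<tau> j)) (\<kappa> i j)) \<and>
      (\<forall>i<n. \<kappa> i i = (\<Sum>l<n. b l i * power_quotient_sum (Suc m) (\<mu> i) (\<mu> l) +
          b i l * (\<mu> i * power_quotient_sum m (\<mu> i) (\<mu> l))))"
  proof (induction m)
    case 0
    have "second_order (\<lambda>z. (H z ^\<^sub>m 0) $$ (i, j)) (if i = j then \<mu> i ^ 0 else 0)
        (?h 0 i j * (cnj (\<tau> i) * B $$ (i, j))) (?h 0 i j * (cnj (B $$ (j, i)) * \<tau> j)) 0" if "i < n" "j < n" for i j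
      using that by (intro second_order_exact) (auto simp: carrier_matD[OF Hc])
    then show ?case by (intro exI[of _ "\<lambda>_ _. 0"]) simp
  next
    case (Suc m)
    then obtain \<kappa> where \<kappa>: "\<And>i j. \<lbrakk>i < n; j < n\<rbrakk> \<Longrightarrow> second_order (\<lambda>z. (H z ^\<^sub>m m) $$ (i, j)) (if i = j then \<mu> i ^ m else 0)
        (?h m i j * (cnj (\<tau> i) * B $$ (i, j))) (?h m i j * (cnj (B $$ (j, i)) * \<tau> j)) (\<kappa> i j)"
      and \<kappa>d: "\<And>i. i < n \<Longrightarrow> \<kappa> i i = (\<Sum>l<n. b l i * power_quotient_sum (Suc m) (\<mu> i) (\<mu> l) +
          b i l * (\<mu> i * power_quotient_sum m (\<mu> i) (\<mu> l)))" by blast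
    define \<kappa>' where "\<kappa>' i j = \<mu> i ^ m * D i j + \<kappa> i j * \<mu> j +
       (\<Sum>l<n. ?h m i l * (cnj (\<tau> i) * B $$ (i, l)) * (cnj (B $$ (j, l)) * \<tau> j) +
             ?h m i l * (cnj (B $$ (l, i)) * \<tau> l) * (cnj (\<tau> l) * B $$ (l, j)))" for i j
    have "second_order (\<lambda>z. (H z ^\<^sub>m Suc m) $$ (i, j)) (if i = j then \<mu> i ^ Suc m else 0)
        (?h (Suc m) i j * (cnj (\<tau> i) * B $$ (i, j))) (?h (Suc m) i j * (cnj (B $$ (j, i)) * \<tau> j)) (\<kappa>' i j)"
      if ij: "i < n" "j < n" for i j
    proof -
      have entry: "(H z ^\<^sub>m Suc m) $$ (i, j) = (\<Sum>l<n. (H z ^\<^sub>m m) $$ (i, l) * H z $$ (l, j))" for z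
        using mat_mult_index_sum[OF pow_carrier_mat[OF Hc] Hc ij] by simp
      have delta: "(\<Sum>l<n. (if i = l then u l else 0) * v l) = u i * v i"
        "(\<Sum>l<n. u l * (if l = j then v l else 0)) = u j * v j" for u v :: "nat \<Rightarrow> complex"
        using ij by (simp_all add: if_distrib[of "\<lambda>x. x * _"] if_distrib[of "\<lambda>x. _ * x"] cong: if_cong)
      have "second_order (\<lambda>z. \<Sum>l<n. (H z ^\<^sub>m m) $$ (i, l) * H z $$ (l, j))
        (\<Sum>l<n. (if i = l then \<mu> i ^ m else 0) * (if l = j then \<mu> l else 0))
        (\<Sum>l<n. (if i = l then \<mu> i ^ m else 0) * (cnj (\<tau> l) * B $$ (l, j)) +
           ?h m i l * (cnj (\<tau> i) * B $$ (i, l)) * (if l = j then \<mu> l else 0))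
        (\<Sum>l<n. (if i = l then \<mu> i ^ m else 0) * (cnj (B $$ (j, l)) * \<tau> j) +
           ?h m i l * (cnj (B $$ (l, i)) * \<tau> l) * (if l = j then \<mu> l else 0))
        (\<Sum>l<n. (if i = l then \<mu> i ^ m else 0) * D l j + \<kappa> i l * (if l = j then \<mu> l else 0) +
           ?h m i l * (cnj (\<tau> i) * B $$ (i, l)) * (cnj (B $$ (j, l)) * \<tau> j) +
           ?h m i l * (cnj (B $$ (l, i)) * \<tau> l) * (cnj (\<tau> l) * B $$ (l, j)))"
        using ij by (intro second_order_sum second_order_mult \<kappa> H2) auto
      moreover have "(\<Sum>l<n. (if i = l then \<mu> i ^ m else 0) * (if l = j then \<mu> l else 0)) = (if i = j then \<mu> i ^ Suc m else 0)"
        unfolding delta by auto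
      ultimately show ?thesis
        unfolding entry sum.distrib delta \<kappa>'_def power_quotient_Suc
        by (simp add: algebra_simps)
    qed
    moreover have "\<kappa>' i i = (\<Sum>l<n. b l i * power_quotient_sum (Suc (Suc m)) (\<mu> i) (\<mu> l) +
          b i l * (\<mu> i * power_quotient_sum (Suc m) (\<mu> i) (\<mu> l)))" if "i < n" for i
    proof -
      have "\<kappa>' i i = (\<Sum>l<n. \<mu> i ^ m * b l i + \<mu> i * (b l i * power_quotient_sum (Suc m) (\<mu> i) (\<mu> l) +
          b i l * (\<mu> i * power_quotient_sum m (\<mu> i) (\<mu> l))) + (?h m i l * \<mu> i * b i l + ?h m i l * \<mu> l * b l i))"
      proof -
        have "\<mu> i ^ m * D i i = (\<Sum>l<n. \<mu> i ^ m * b l i)"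
          by (simp add: D_def sum_distrib_left b_def mult_ac)
        moreover have "\<kappa> i i * \<mu> i = (\<Sum>l<n. \<mu> i * (b l i * power_quotient_sum (Suc m) (\<mu> i) (\<mu> l) +
            b i l * (\<mu> i * power_quotient_sum m (\<mu> i) (\<mu> l))))"
          unfolding \<kappa>d[OF that] sum_distrib_right by (intro sum.cong refl) (rule mult.commute)
        moreover have "(\<Sum>l<n. ?h m i l * (cnj (\<tau> i) * B $$ (i, l)) * (cnj (B $$ (i, l)) * \<tau> i) +
             ?h m i l * (cnj (B $$ (l, i)) * \<tau> l) * (cnj (\<tau> l) * B $$ (l, i))) =
            (\<Sum>l<n. ?h m i l * \<mu> i * b i l + ?h m i l * \<mu> l * b l i)"
          by (intro sum.cong refl) (simp add: b_def \<mu>_def mult_ac)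
        ultimately show ?thesis unfolding \<kappa>'_def by (simp only: sum.distrib)
      qed
      also have "\<dots> = (\<Sum>l<n. b l i * power_quotient_sum (Suc (Suc m)) (\<mu> i) (\<mu> l) +
          b i l * (\<mu> i * power_quotient_sum (Suc m) (\<mu> i) (\<mu> l)))"
        by (intro sum.cong refl) (simp add: power_quotient_Suc algebra_simps)
      finally show ?thesis .
    qed
    ultimately show ?case by blast
  qed
  then obtain \<kappa> where \<kappa>: "\<And>i j. \<lbrakk>i < n; j < n\<rbrakk> \<Longrightarrow> second_order (\<lambda>z. (H z ^\<^sub>m m) $$ (i, j)) (if i = j then \<mu> i ^ m else 0)
        (?h m i j * (cnj (\<tau> i) * B $$ (i, j))) (?h m i j * (cnj (B $$ (j, i)) * \<tau> j)) (\<kappa> i j)"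
      and \<kappa>d: "\<And>i. i < n \<Longrightarrow> \<kappa> i i = (\<Sum>l<n. b l i * power_quotient_sum (Suc m) (\<mu> i) (\<mu> l) +
          b i l * (\<mu> i * power_quotient_sum m (\<mu> i) (\<mu> l)))" by blast
  have "second_order (\<lambda>z. \<Sum>i<n. (H z ^\<^sub>m m) $$ (i, i)) (\<Sum>i<n. \<mu> i ^ m)
      (\<Sum>i<n. ?h m i i * (cnj (\<tau> i) * B $$ (i, i))) (\<Sum>i<n. ?h m i i * (cnj (B $$ (i, i)) * \<tau> i)) (\<Sum>i<n. \<kappa> i i)"
  proof (rule second_order_sum)
    fix i assume "i \<in> {..<n}"
    then have i: "i < n" by simp
    show "second_order (\<lambda>z. (H z ^\<^sub>m m) $$ (i, i)) (\<mu> i ^ m)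
      (?h m i i * (cnj (\<tau> i) * B $$ (i, i))) (?h m i i * (cnj (B $$ (i, i)) * \<tau> i)) (\<kappa> i i)"
      using \<kappa>[OF i i] by (simp only: if_True refl)
  qed
  \<comment> \<open>Exchanging i and l in the part with \<open>b l i\<close> collects everything on
    \<open>b i l\<close>, where \<open>power_quotient_sum_swap\<close> applies.\<close>
  moreover have trace_eq: "(\<Sum>i<n. \<kappa> i i) = (\<Sum>i<n. \<Sum>l<n. b i l * (of_nat m * power_quotient m (\<mu> i) (\<mu> l)))"
  proof -
    have "(\<Sum>i<n. \<Sum>l<n. b l i * power_quotient_sum (Suc m) (\<mu> i) (\<mu> l)) =
        (\<Sum>i<n. \<Sum>l<n. b i l * power_quotient_sum (Suc m) (\<mu> l) (\<mu> i))" by (rule sum.swap)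
    moreover have "(\<Sum>i<n. \<kappa> i i) = (\<Sum>i<n. \<Sum>l<n. b l i * power_quotient_sum (Suc m) (\<mu> i) (\<mu> l)) +
        (\<Sum>i<n. \<Sum>l<n. b i l * (\<mu> i * power_quotient_sum m (\<mu> i) (\<mu> l)))"
      unfolding sum.distrib[symmetric] by (intro sum.cong refl) (simp only: \<kappa>d lessThan_iff)
    moreover have "(\<Sum>i<n. \<Sum>l<n. b i l * power_quotient_sum (Suc m) (\<mu> l) (\<mu> i)) +
        (\<Sum>i<n. \<Sum>l<n. b i l * (\<mu> i * power_quotient_sum m (\<mu> i) (\<mu> l))) =
        (\<Sum>i<n. \<Sum>l<n. b i l * (power_quotient_sum (Suc m) (\<mu> l) (\<mu> i) + \<mu> i * power_quotient_sum m (\<mu> i) (\<mu> l)))"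
      by (simp only: sum.distrib distrib_left)
    ultimately show ?thesis by (simp only: power_quotient_sum_swap)
  qed
  ultimately show ?thesis unfolding mat_trace_def b_def[symmetric] trace_eq by (intro exI)
qed

section \<open>The leading window\<close>

definition divided_difference :: "real poly \<Rightarrow> real \<Rightarrow> real \<Rightarrow> real" where
  "divided_difference r x y = (if x = y then poly (pderiv r) x else (poly r x - poly r y) / (x - y))"

text \<open>m u^m is the image of u^m under u d/du, so by linearity the weights m h_m add up to the
  divided difference of u q'(u).\<close>

lemma sum_power_quotient:
  fixes q :: "real poly"
  shows "(\<Sum>m\<le>degree q. poly.coeff q m * (real m * power_quotient m x y)) =
    divided_difference ([:0, 1:] * pderiv q) x y"
proof -
  define N where "N = degree q"
  have r: "[:0, 1:] * pderiv q = (\<Sum>m\<le>N. Polynomial.monom (poly.coeff q m * real m) m)"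
  proof (rule poly_eqI)
    fix k
    have "poly.coeff ([:0, 1:] * pderiv q) k = real k * poly.coeff q k"
      by (cases k) (simp_all add: coeff_pderiv)
    also have "\<dots> = poly.coeff (\<Sum>m\<le>N. Polynomial.monom (poly.coeff q m * real m) m) k"
      by (auto simp: coeff_sum N_def coeff_eq_0)
    finally show "poly.coeff ([:0, 1:] * pderiv q) k =
      poly.coeff (\<Sum>m\<le>N. Polynomial.monom (poly.coeff q m * real m) m) k" .
  qed
  have eval: "poly ([:0, 1:] * pderiv q) u = (\<Sum>m\<le>N. poly.coeff q m * real m * u ^ m)" for u
    unfolding r by (simp add: poly_sum poly_monom)
  have deriv: "poly (pderiv ([:0, 1:] * pderiv q)) u = (\<Sum>m\<le>N. poly.coeff q m * real m * (real m * u ^ (m - 1)))" for u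
    unfolding r higher_pderiv_sum[of 1, simplified] by (simp add: poly_sum poly_monom pderiv_monom pderiv_sum mult_ac)
  show ?thesis
  proof (cases "x = y")
    case True
    then show ?thesis
      unfolding divided_difference_def deriv by (simp add: power_quotient_def N_def mult_ac)
  next
    case False
    have "divided_difference ([:0, 1:] * pderiv q) x y =
        ((\<Sum>m\<le>N. poly.coeff q m * real m * x ^ m) - (\<Sum>m\<le>N. poly.coeff q m * real m * y ^ m)) / (x - y)"
      unfolding divided_difference_def eval using False by simp
    also have "\<dots> = (\<Sum>m\<le>N. poly.coeff q m * (real m * ((x ^ m - y ^ m) / (x - y))))"
      unfolding sum_subtractf[symmetric] sum_divide_distrib by (intro sum.cong refl) (simp add: algebra_simps)
    finally show ?thesis using False by (simp add: power_quotient_def N_def)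
  qed
qed

lemma power_quotient_of_real:
  "power_quotient m (of_real x) (of_real y :: 'a::real_field) = of_real (power_quotient m x y)"
  by (simp add: power_quotient_def)

text \<open>By linearity in q this reduces to the traces of powers.\<close>

lemma second_order_spectral_sum:
  fixes \<tau> :: "nat \<Rightarrow> complex" and B :: "complex mat" and x :: "complex \<Rightarrow> nat \<Rightarrow> real"
  assumes B: "B \<in> carrier_mat n n"
    and x: "\<And>z m. mat_trace n ((mat_adjoint (mat_diag n \<tau> + z \<cdot>\<^sub>m B) * (mat_diag n \<tau> + z \<cdot>\<^sub>m B)) ^\<^sub>m m) =
              of_real (\<Sum>j<n. x z j ^ m)"
  defines "\<mu> \<equiv> \<lambda>i. (cmod (\<tau> i))\<^sup>2"
  shows "\<exists>c1 c2. second_order (\<lambda>z. of_real (\<Sum>j<n. poly q (x z j))) (of_real (\<Sum>i<n. poly q (\<mu> i))) c1 c2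
    (of_real (\<Sum>i<n. \<Sum>l<n. (cmod (B $$ (i, l)))\<^sup>2 * divided_difference ([:0, 1:] * pderiv q) (\<mu> i) (\<mu> l)))"
proof -
  let ?c = "\<lambda>m. complex_of_real (poly.coeff q m)"
  let ?d = "\<lambda>m. complex_of_real (\<Sum>i<n. \<Sum>l<n. (cmod (B $$ (i, l)))\<^sup>2 * (real m * power_quotient m (\<mu> i) (\<mu> l)))"
  have pq: "power_quotient m (\<tau> i * cnj (\<tau> i)) (\<tau> l * cnj (\<tau> l)) = of_real (power_quotient m (\<mu> i) (\<mu> l))" for m i l
    unfolding \<mu>_def complex_norm_square[symmetric] by (rule power_quotient_of_real)
  have "\<exists>c1 c2. second_order (\<lambda>z. of_real (\<Sum>j<n. x z j ^ m)) (of_real (\<Sum>i<n. \<mu> i ^ m)) c1 c2 (?d m)" for m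
  proof -
    from second_order_trace_power[OF B, of \<tau> m, unfolded x pq]
    moreover have "(\<Sum>i<n. (\<tau> i * cnj (\<tau> i)) ^ m) = of_real (\<Sum>i<n. \<mu> i ^ m)"
      by (simp only: \<mu>_def complex_norm_square[symmetric] of_real_power of_real_sum)
    moreover have "(\<Sum>i<n. \<Sum>l<n. B $$ (i, l) * cnj (B $$ (i, l)) * (of_nat m * complex_of_real (power_quotient m (\<mu> i) (\<mu> l)))) = ?d m"
      by (simp only: complex_norm_square[symmetric] of_real_mult of_real_sum of_real_of_nat_eq)
    ultimately show ?thesis by (simp only:)
  qed
  then have "\<forall>m. \<exists>c. second_order (\<lambda>z. of_real (\<Sum>j<n. x z j ^ m)) (of_real (\<Sum>i<n. \<mu> i ^ m)) (fst c) (snd c) (?d m)"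
    by simp
  from choice[OF this] obtain c12 where
    c12: "\<forall>m. second_order (\<lambda>z. of_real (\<Sum>j<n. x z j ^ m)) (of_real (\<Sum>i<n. \<mu> i ^ m)) (fst (c12 m)) (snd (c12 m)) (?d m)" ..
  define c1 c2 where "c1 m = fst (c12 m)" and "c2 m = snd (c12 m)" for m
  have c: "second_order (\<lambda>z. of_real (\<Sum>j<n. x z j ^ m)) (of_real (\<Sum>i<n. \<mu> i ^ m)) (c1 m) (c2 m) (?d m)" for m
    using c12 by (simp only: c1_def c2_def)
  have const: "second_order (\<lambda>_. c) c 0 0 0" for c by (rule second_order_exact) simp
  have "second_order (\<lambda>z. \<Sum>m\<le>degree q. ?c m * of_real (\<Sum>j<n. x z j ^ m))
     (\<Sum>m\<le>degree q. ?c m * of_real (\<Sum>i<n. \<mu> i ^ m))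
     (\<Sum>m\<le>degree q. ?c m * c1 m + 0 * of_real (\<Sum>i<n. \<mu> i ^ m))
     (\<Sum>m\<le>degree q. ?c m * c2 m + 0 * of_real (\<Sum>i<n. \<mu> i ^ m))
     (\<Sum>m\<le>degree q. ?c m * ?d m + 0 * of_real (\<Sum>i<n. \<mu> i ^ m) + 0 * c2 m + 0 * c1 m)"
    by (intro second_order_sum second_order_mult const c)
  moreover have "(\<Sum>m\<le>degree q. ?c m * of_real (\<Sum>j<n. u j ^ m)) = complex_of_real (\<Sum>j<n. poly q (u j))" for u :: "nat \<Rightarrow> real"
  proof -
    have "(\<Sum>j<n. poly q (u j)) = (\<Sum>m\<le>degree q. poly.coeff q m * (\<Sum>j<n. u j ^ m))"
      by (simp add: poly_altdef sum_distrib_left) (rule sum.swap)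
    then show ?thesis by simp
  qed
  moreover have "(\<Sum>m\<le>degree q. ?c m * ?d m + 0 * of_real (\<Sum>i<n. \<mu> i ^ m) + 0 * c2 m + 0 * c1 m) =
    of_real (\<Sum>i<n. \<Sum>l<n. (cmod (B $$ (i, l)))\<^sup>2 * divided_difference ([:0, 1:] * pderiv q) (\<mu> i) (\<mu> l))"
  proof -
    have "(\<Sum>i<n. \<Sum>l<n. (cmod (B $$ (i, l)))\<^sup>2 * divided_difference ([:0, 1:] * pderiv q) (\<mu> i) (\<mu> l)) =
       (\<Sum>i<n. \<Sum>l<n. \<Sum>m\<le>degree q. poly.coeff q m * ((cmod (B $$ (i, l)))\<^sup>2 * (real m * power_quotient m (\<mu> i) (\<mu> l))))"
      unfolding sum_power_quotient[symmetric] sum_distrib_left by (simp add: mult_ac)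
    also have "\<dots> = (\<Sum>i<n. \<Sum>m\<le>degree q. \<Sum>l<n. poly.coeff q m * ((cmod (B $$ (i, l)))\<^sup>2 * (real m * power_quotient m (\<mu> i) (\<mu> l))))"
      by (intro sum.cong refl sum.swap)
    also have "\<dots> = (\<Sum>m\<le>degree q. \<Sum>i<n. \<Sum>l<n. poly.coeff q m * ((cmod (B $$ (i, l)))\<^sup>2 * (real m * power_quotient m (\<mu> i) (\<mu> l))))"
      by (rule sum.swap)
    finally have "(\<Sum>i<n. \<Sum>l<n. (cmod (B $$ (i, l)))\<^sup>2 * divided_difference ([:0, 1:] * pderiv q) (\<mu> i) (\<mu> l)) =
       (\<Sum>m\<le>degree q. poly.coeff q m * (\<Sum>i<n. \<Sum>l<n. (cmod (B $$ (i, l)))\<^sup>2 * (real m * power_quotient m (\<mu> i) (\<mu> l))))"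
      unfolding sum_distrib_left .
    then show ?thesis by (simp only: of_real_sum of_real_mult mult_zero_left add_0_right)
  qed
  ultimately show ?thesis by (simp only:) blast
qed

text \<open>The divided difference of \<beta> u^\<beta>, which is u f'(u) for f(u) = u^\<beta>. At x
  = y = 0 the convention \<open>0 powr (\<beta> - 1) = 0\<close> gives 0, also for \<beta> \<le> 1,
  in accordance with cutting f off near 0.\<close>

definition powr_divided_difference :: "real \<Rightarrow> real \<Rightarrow> real \<Rightarrow> real" where
  "powr_divided_difference \<beta> x y =
     (if x = y then \<beta>\<^sup>2 * x powr (\<beta> - 1) else \<beta> * (x powr \<beta> - y powr \<beta>) / (x - y))"

lemma powr_divided_difference_nonneg:
  assumes \<beta>: "\<beta> > 0" and "x \<ge> 0" "y \<ge> 0"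
  shows "powr_divided_difference \<beta> x y \<ge> 0"
    and "powr_divided_difference \<beta> x y = 0 \<longleftrightarrow> x = 0 \<and> y = 0"
proof -
  have less: "u powr \<beta> < v powr \<beta>" if "0 \<le> u" "u < v" for u v :: real
    using that \<beta> by (intro powr_less_mono2) auto
  consider "x < y" | "x = y" | "y < x" by linarith
  then have "powr_divided_difference \<beta> x y \<ge> 0 \<and> (powr_divided_difference \<beta> x y = 0 \<longleftrightarrow> x = 0 \<and> y = 0)"
  proof cases
    case 1
    with less[of x y] assms show ?thesis
      by (auto simp: powr_divided_difference_def divide_simps intro!: mult_nonneg_nonpos)
  next
    case 2
    with assms show ?thesis by (auto simp: powr_divided_difference_def)
  next
    case 3
    with less[of y x] assms show ?thesis
      by (auto simp: powr_divided_difference_def divide_simps)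
  qed
  then show "powr_divided_difference \<beta> x y \<ge> 0"
    "powr_divided_difference \<beta> x y = 0 \<longleftrightarrow> x = 0 \<and> y = 0" by auto
qed

lemma triple_root_derivs:
  fixes d :: "real poly"
  assumes "[:-c, 1:] ^ 3 dvd d"
  shows "poly d c = 0" "poly (pderiv d) c = 0" "poly (pderiv (pderiv d)) c = 0"
proof -
  from assms obtain s where d: "d = [:-c, 1:] ^ 3 * s" by (auto elim!: dvdE)
  have e: "[:-c, 1:] ^ 3 = [:-c, 1:] * ([:-c, 1:] * [:-c, 1:])" by (simp only: power3_eq_cube mult.assoc)
  have X: "pderiv [:-c, 1:] = 1" by (simp add: pderiv_pCons)
  have X0: "poly [:-c, 1:] c = 0" by simp
  show "poly d c = 0" "poly (pderiv d) c = 0" "poly (pderiv (pderiv d)) c = 0"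
    unfolding d e by (simp_all only: pderiv_mult pderiv_add X poly_mult poly_add X0 mult_zero_left mult_zero_right add_0_right)
qed

text \<open>The sum of the \<open>x z j\<close> is the trace of the Gram matrix, which converges as
  z tends to 0, and every summand is nonnegative.\<close>

lemma singular_values_bounded:
  fixes \<tau> :: "nat \<Rightarrow> complex" and B :: "complex mat" and x :: "complex \<Rightarrow> nat \<Rightarrow> real"
  assumes B: "B \<in> carrier_mat n n"
    and x: "\<And>z m. mat_trace n ((mat_adjoint (mat_diag n \<tau> + z \<cdot>\<^sub>m B) * (mat_diag n \<tau> + z \<cdot>\<^sub>m B)) ^\<^sub>m m) =
              of_real (\<Sum>j<n. x z j ^ m)"
    and x0: "\<And>z j. x z j \<ge> 0"
  shows "\<forall>\<^sub>F z in at 0. \<forall>j<n. x z j \<le> (\<Sum>i<n. (cmod (\<tau> i))\<^sup>2) + 1"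
proof -
  from second_order_spectral_sum[OF B x, of "[:0, 1:]"] obtain c1 c2 c11 where
    "second_order (\<lambda>z. of_real (\<Sum>j<n. x z j)) (of_real (\<Sum>i<n. (cmod (\<tau> i))\<^sup>2)) c1 c2 c11" by auto
  from tendsto_Re[OF second_order_tendsto[OF this]]
  have "((\<lambda>z. \<Sum>j<n. x z j) \<longlongrightarrow> (\<Sum>i<n. (cmod (\<tau> i))\<^sup>2)) (at 0)" by (simp only: Re_complex_of_real)
  then have "\<forall>\<^sub>F z in at 0. (\<Sum>j<n. x z j) < (\<Sum>i<n. (cmod (\<tau> i))\<^sup>2) + 1"
    by (intro order_tendstoD(2)) auto
  then show ?thesis
  proof eventually_elim
    case (elim z)
    show ?case
    proof (intro allI impI)
      fix j assume "j < n"
      then have "x z j \<le> (\<Sum>j<n. x z j)" using x0 by (intro member_le_sum) auto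
      with elim show "x z j \<le> (\<Sum>i<n. (cmod (\<tau> i))\<^sup>2) + 1" by linarith
    qed
  qed
qed

text \<open>
  The interpolating polynomial $q$ agrees with $\lambda^\beta$ to third order at the nonzero $\mu_i$ and
  vanishes to third order at $0$; hence \<open>powr_divided_difference \<beta>\<close> is the value of
  \<open>divided_difference\<close> at the $\mu_i$ even when one of them is $0$.
\<close>

lemma leading_window_expansion:
  fixes \<tau> :: "nat \<Rightarrow> complex" and B :: "complex mat" and x :: "complex \<Rightarrow> nat \<Rightarrow> real" and \<beta> :: real
  assumes B: "B \<in> carrier_mat n n"
    and x: "\<And>z m. mat_trace n ((mat_adjoint (mat_diag n \<tau> + z \<cdot>\<^sub>m B) * (mat_diag n \<tau> + z \<cdot>\<^sub>m B)) ^\<^sub>m m) =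
              of_real (\<Sum>j<n. x z j ^ m)"
    and x0: "\<And>z j. x z j \<ge> 0" and \<beta>: "\<beta> > 0"
  defines "\<mu> \<equiv> \<lambda>i. (cmod (\<tau> i))\<^sup>2"
  shows "\<forall>\<^sub>F a in at_right 0.
    (\<lambda>z. four_mean (\<lambda>z. \<Sum>j<n. if inverse (1 + x z j) \<in> {a..1 - a} then
        ((1 - inverse (1 + x z j)) / inverse (1 + x z j)) powr \<beta> else 0) z -
      ((\<Sum>i<n. \<mu> i powr \<beta>) +
       (\<Sum>i<n. \<Sum>l<n. (cmod (B $$ (i, l)))\<^sup>2 * powr_divided_difference \<beta> (\<mu> i) (\<mu> l)) * norm z ^ 2))
    \<in> o[at 0](\<lambda>z. norm z ^ 2)"
proof -
  define R where "R = (\<Sum>i<n. \<mu> i) + 1"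
  have \<mu>0: "\<mu> i \<ge> 0" for i by (simp add: \<mu>_def)
  have \<mu>_eq: "(cmod (\<tau> i))\<^sup>2 = \<mu> i" for i by (simp add: \<mu>_def)
  have \<mu>R: "\<mu> i < R" if "i < n" for i
  proof -
    have "\<mu> i \<le> (\<Sum>i<n. \<mu> i)" using that \<mu>0 by (intro member_le_sum) auto
    then show ?thesis by (simp add: R_def)
  qed
  have R: "\<forall>\<^sub>F z in at 0. \<forall>j<n. x z j \<le> R"
    using singular_values_bounded[OF B x x0] by (simp add: R_def \<mu>_def)
  have R0: "R > 0" unfolding R_def using \<mu>0 by (intro add_nonneg_pos sum_nonneg) auto
  \<comment> \<open>0 is always a node, so that the interpolation also controls the values that tend
    to 0.\<close>
  define C where "C = insert 0 (\<mu> ` {..<n})"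
  have finC: "finite C" by (simp add: C_def)
  have CR: "0 \<le> c \<and> c < R" if "c \<in> C" for c using that \<mu>0 \<mu>R R0 by (auto simp: C_def)
  \<comment> \<open>Squares make \<open>w\<close> nonnegative on the whole line, so the sum W of the
    w(x_j) is nonnegative with limit 0, which forces W = O(|z|^2).\<close>
  define w where "w = (\<Prod>c\<in>C. [:-c, 1:] ^ 2)"
  have w: "poly w u = (\<Prod>c\<in>C. (u - c) ^ 2)" for u by (simp add: w_def poly_prod poly_power)
  have w0: "poly w u \<ge> 0" for u unfolding w by (intro prod_nonneg) auto
  have wC: "poly w c = 0" if "c \<in> C" for c using that finC by (auto simp: w)
  define W where "W z = (\<Sum>j<n. poly w (x z j))" for z
  have W0: "W z \<ge> 0" for z unfolding W_def using w0 by (intro sum_nonneg) auto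
  have "(\<Sum>i<n. poly w (\<mu> i)) = 0" by (intro sum.neutral ballI wC) (auto simp: C_def)
  with second_order_spectral_sum[OF B x, of w] obtain c1 c2 c11 where
    "second_order (\<lambda>z. of_real (W z)) 0 c1 c2 c11" unfolding W_def \<mu>_def by auto
  from second_order_four_mean[OF this]
  have 1: "(\<lambda>z. four_mean W z - Re c11 * norm z ^ 2) \<in> O[at 0](\<lambda>z. norm z ^ 3)" by simp
  have 32: "(\<lambda>z::complex. norm z ^ 3) \<in> o[at 0](\<lambda>z. norm z ^ 2)"
    using powr_norm_smallo[of 3] by (simp add: landau_o.small.in_cong[of "\<lambda>z::complex. norm z powr 3" "\<lambda>z. norm z ^ 3"]
      eventually_at_filter powr_numeral)
  have "(\<lambda>z. (four_mean W z - Re c11 * norm z ^ 2) + Re c11 * norm z ^ 2) \<in> O[at 0](\<lambda>z. norm z ^ 2)"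
    using landau_o.small_imp_big[OF landau_o.big_small_trans[OF 1 32]] by (rule sum_in_bigo(1)) simp
  then have "four_mean W \<in> O[at 0](\<lambda>z. norm z ^ 2)" by simp
  \<comment> \<open>Nonnegativity bounds W by four times its mean, in which the linear terms have
    cancelled.\<close>
  moreover have "W z \<le> 4 * four_mean W z" for z
    using W0[of "\<i> * z"] W0[of "- z"] W0[of "- (\<i> * z)"] by (simp add: four_mean_def)
  then have "W \<in> O[at 0](four_mean W)"
    using W0 by (intro bigoI[where c = 4] always_eventually allI) (simp add: order_trans[OF W0] abs_of_nonneg, smt (verit))
  ultimately have "W \<in> O[at 0](\<lambda>z. norm z ^ 2)" by (rule landau_o.big_trans[rotated])
  then obtain L0 where "\<forall>\<^sub>F z in at 0. norm (W z) \<le> L0 * norm (norm z ^ 2)" by (elim landau_o.bigE)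
  then have WL: "\<forall>\<^sub>F z in at 0. W z \<le> \<bar>L0\<bar> * norm z ^ 2"
  proof eventually_elim
    case (elim z)
    have "W z \<le> L0 * norm z ^ 2" using elim by simp
    also have "\<dots> \<le> \<bar>L0\<bar> * norm z ^ 2" by (intro mult_right_mono) auto
    finally show ?case .
  qed
  \<comment> \<open>The bound |L0| |z|^2 on W bounds the product of the |x - c| over the nodes by L
    |z|; the cube of that product is the interpolation weight, hence O(|z|^3).\<close>
  define L where "L = sqrt \<bar>L0\<bar>"

  have good: "(\<lambda>z. four_mean (\<lambda>z. \<Sum>j<n. if inverse (1 + x z j) \<in> {a..1 - a} then
        ((1 - inverse (1 + x z j)) / inverse (1 + x z j)) powr \<beta> else 0) z -
      ((\<Sum>i<n. \<mu> i powr \<beta>) +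
       (\<Sum>i<n. \<Sum>l<n. (cmod (B $$ (i, l)))\<^sup>2 * powr_divided_difference \<beta> (\<mu> i) (\<mu> l)) * norm z ^ 2))
    \<in> o[at 0](\<lambda>z. norm z ^ 2)"
    if a: "0 < a" "a < 1 / 2" and aC: "\<And>c. c \<in> C \<Longrightarrow> c \<noteq> 0 \<Longrightarrow> a / (1 - a) < c \<and> c < (1 - a) / a" for a
  proof -
    define \<rho> \<sigma> where "\<rho> = a / (1 - a)" and "\<sigma> = (1 - a) / a"
    have \<rho>0: "\<rho> > 0" using a by (simp add: \<rho>_def)
    define g where "g u = (if \<rho> \<le> u \<and> u \<le> \<sigma> then u powr \<beta> else 0)" for u
    have window: "(if inverse (1 + u) \<in> {a..1 - a} then ((1 - inverse (1 + u)) / inverse (1 + u)) powr \<beta> else 0) = g u"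
      if "u \<ge> 0" for u
    proof -
      have "(1 - inverse (1 + u)) / inverse (1 + u) = u" using that by (simp add: field_simps)
      then show ?thesis unfolding window_iff[OF a that] g_def \<rho>_def \<sigma>_def by simp
    qed
    have gG: "\<bar>g u\<bar> \<le> R powr \<beta>" if "u \<in> {0..R}" for u
      using that \<beta> by (auto simp: g_def intro!: powr_mono2)
    \<comment> \<open>A second factor with exponent 0 brings u^\<beta> under the Taylor lemma for a
      product of two powers; R + 1 exceeds every node.\<close>
    define f where "f u = u powr \<beta> * ((R + 1) - u) powr 0" for u
    define T where "T c = (if c = 0 then 0 else [:f c:] + Polynomial.smult (f c * (\<beta> / c - 0 / ((R + 1) - c))) [:-c, 1:] +
        Polynomial.smult (f c * ((\<beta> / c - 0 / ((R + 1) - c)) ^ 2 + (- \<beta> / c ^ 2 - 0 / ((R + 1) - c) ^ 2)) / 2) ([:-c, 1:] ^ 2))" for c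
    have fg: "f u = g u" if "\<rho> \<le> u" "u \<le> \<sigma>" "u < R + 1" for u
      using that by (simp add: f_def g_def)
    have "\<exists>\<delta>>0. \<exists>K. \<forall>u. \<bar>u - c\<bar> < \<delta> \<longrightarrow> \<bar>g u - poly (T c) u\<bar> \<le> K * \<bar>u - c\<bar> ^ 3" if c: "c \<in> C" for c
    proof (cases "c = 0")
      case True
      then have "\<forall>u. \<bar>u - c\<bar> < \<rho> \<longrightarrow> \<bar>g u - poly (T c) u\<bar> \<le> 0 * \<bar>u - c\<bar> ^ 3"
        by (auto simp: g_def T_def)
      then show ?thesis using \<rho>0 by blast
    next
      case False
      have c': "\<rho> < c" "c < \<sigma>" "0 < c" "c < R + 1" using aC[OF c False] CR[OF c] \<rho>0 by (auto simp: \<rho>_def \<sigma>_def)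
      have T_eq: "T c = [:f c:] + Polynomial.smult (f c * (\<beta> / c - 0 / ((R + 1) - c))) [:-c, 1:] +
        Polynomial.smult (f c * ((\<beta> / c - 0 / ((R + 1) - c)) ^ 2 + (- \<beta> / c ^ 2 - 0 / ((R + 1) - c) ^ 2)) / 2) ([:-c, 1:] ^ 2)"
        using False by (simp only: T_def if_False)
      from powr_mult_powr_taylor[OF c'(3,4), of \<beta> 0, folded f_def, folded T_eq]
      obtain \<delta> K where K: "\<delta> > 0" "\<And>u. \<bar>u - c\<bar> < \<delta> \<Longrightarrow> \<bar>f u - poly (T c) u\<bar> \<le> K * \<bar>u - c\<bar> ^ 3" by blast
      define \<delta>' where "\<delta>' = min \<delta> (min (min (c - \<rho>) (\<sigma> - c)) (R + 1 - c))"
      have "\<bar>g u - poly (T c) u\<bar> \<le> K * \<bar>u - c\<bar> ^ 3" if u: "\<bar>u - c\<bar> < \<delta>'" for u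
      proof -
        have "\<rho> \<le> u" "u \<le> \<sigma>" "u < R + 1" "\<bar>u - c\<bar> < \<delta>" using u unfolding \<delta>'_def by linarith+
        then show ?thesis using K(2)[of u] fg[of u] by simp
      qed
      moreover have "\<delta>' > 0" using K(1) c' by (simp add: \<delta>'_def)
      ultimately show ?thesis by blast
    qed
    from hermite_interpolation_bound[OF finC gG this]
    obtain q K where q: "\<And>c. c \<in> C \<Longrightarrow> [:-c, 1:] ^ 3 dvd q - T c" and K: "K \<ge> 0"
      "\<And>u. u \<in> {0..R} \<Longrightarrow> \<bar>g u - poly q u\<bar> \<le> K * (\<Prod>c\<in>C. \<bar>u - c\<bar> ^ 3)" by blast
    have q0: "poly q 0 = 0" "poly (pderiv q) 0 = 0" "poly (pderiv (pderiv q)) 0 = 0"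
      using triple_root_derivs[OF q[of 0]] by (auto simp: C_def T_def)
    have qc: "poly q c = c powr \<beta>" "poly (pderiv q) c = c powr \<beta> * (\<beta> / c)"
      "poly (pderiv (pderiv q)) c = c powr \<beta> * ((\<beta> / c) ^ 2 - \<beta> / c ^ 2)" if "c \<in> C" "c \<noteq> 0" for c
    proof -
      have fc: "f c = c powr \<beta>" using CR[OF that(1)] by (simp add: f_def)
      have X: "pderiv [:-c, 1:] = 1" by (simp add: pderiv_pCons)
      have X0: "poly [:-c, 1:] c = 0" by simp
      have T: "T c = [:c powr \<beta>:] + Polynomial.smult (c powr \<beta> * (\<beta> / c)) [:-c, 1:] +
        Polynomial.smult (c powr \<beta> * ((\<beta> / c) ^ 2 - \<beta> / c ^ 2) / 2) ([:-c, 1:] * [:-c, 1:])"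
        using that by (simp add: T_def fc power2_eq_square del: mult_pCons_left mult_pCons_right)
      have "poly (T c) c = c powr \<beta>" "poly (pderiv (T c)) c = c powr \<beta> * (\<beta> / c)"
        "poly (pderiv (pderiv (T c))) c = c powr \<beta> * ((\<beta> / c) ^ 2 - \<beta> / c ^ 2)"
        unfolding T
        by (simp_all only: pderiv_add pderiv_smult pderiv_mult X poly_add poly_smult poly_mult X0
            mult_zero_left mult_zero_right) (simp_all add: pderiv_pCons)
      then show "poly q c = c powr \<beta>" "poly (pderiv q) c = c powr \<beta> * (\<beta> / c)"
        "poly (pderiv (pderiv q)) c = c powr \<beta> * ((\<beta> / c) ^ 2 - \<beta> / c ^ 2)"
        using triple_root_derivs[OF q[OF that(1)]] by (simp_all add: pderiv_diff)
    qed
    have qval: "poly q c = c powr \<beta>" if "c \<in> C" for c using qc(1)[OF that] q0 by (cases "c = 0") auto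
    have rval: "poly ([:0, 1:] * pderiv q) c = \<beta> * c powr \<beta>" if "c \<in> C" for c
      using qc(2)[OF that] q0 by (cases "c = 0") auto
    have rderiv: "poly (pderiv ([:0, 1:] * pderiv q)) c = \<beta>\<^sup>2 * c powr (\<beta> - 1)" if "c \<in> C" for c
    proof (cases "c = 0")
      case True
      then show ?thesis using q0 by (simp add: pderiv_mult pderiv_pCons)
    next
      case False
      then have "c > 0" using CR[OF that] by simp
      have "poly (pderiv ([:0, 1:] * pderiv q)) c = c powr \<beta> * (\<beta> / c) + c * (c powr \<beta> * ((\<beta> / c) ^ 2 - \<beta> / c ^ 2))"
        using qc[OF that False] by (simp add: pderiv_mult pderiv_pCons)
      also have "\<dots> = \<beta>\<^sup>2 * (c powr \<beta> / c)" using False by (simp add: field_simps power2_eq_square)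
      finally show ?thesis using \<open>c > 0\<close> by (simp add: powr_diff)
    qed
    have dd: "divided_difference ([:0, 1:] * pderiv q) (\<mu> i) (\<mu> l) = powr_divided_difference \<beta> (\<mu> i) (\<mu> l)"
      if "i < n" "l < n" for i l
    proof -
      have "\<mu> i \<in> C" "\<mu> l \<in> C" using that by (auto simp: C_def)
      then show ?thesis
        unfolding divided_difference_def powr_divided_difference_def by (simp only: rval rderiv right_diff_distrib)
    qed
    from second_order_spectral_sum[OF B x, of q, unfolded \<mu>_eq] obtain c1 c2 where S:
      "second_order (\<lambda>z. of_real (\<Sum>j<n. poly q (x z j))) (of_real (\<Sum>i<n. poly q (\<mu> i))) c1 c2
       (of_real (\<Sum>i<n. \<Sum>l<n. (cmod (B $$ (i, l)))\<^sup>2 * divided_difference ([:0, 1:] * pderiv q) (\<mu> i) (\<mu> l)))"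
      by (elim exE) (rule that)
    have S1: "(\<Sum>i<n. poly q (\<mu> i)) = (\<Sum>i<n. \<mu> i powr \<beta>)"
      by (intro sum.cong refl qval) (auto simp: C_def)
    have S2: "(\<Sum>i<n. \<Sum>l<n. (cmod (B $$ (i, l)))\<^sup>2 * divided_difference ([:0, 1:] * pderiv q) (\<mu> i) (\<mu> l)) =
       (\<Sum>i<n. \<Sum>l<n. (cmod (B $$ (i, l)))\<^sup>2 * powr_divided_difference \<beta> (\<mu> i) (\<mu> l))"
      by (intro sum.cong refl) (simp only: dd lessThan_iff)
    have Q: "(\<lambda>z. four_mean (\<lambda>z. \<Sum>j<n. poly q (x z j)) z - ((\<Sum>i<n. \<mu> i powr \<beta>) +
       (\<Sum>i<n. \<Sum>l<n. (cmod (B $$ (i, l)))\<^sup>2 * powr_divided_difference \<beta> (\<mu> i) (\<mu> l)) * norm z ^ 2)) \<in> O[at 0](\<lambda>z. norm z ^ 3)"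
      using second_order_four_mean[OF S[unfolded S1 S2]] by (simp only: Re_complex_of_real)
    have "\<forall>\<^sub>F z in at 0. norm ((\<Sum>j<n. g (x z j)) - (\<Sum>j<n. poly q (x z j))) \<le> (real n * K * L ^ 3) * norm (norm z ^ 3)"
      using WL R
    proof eventually_elim
      case (elim z)
      have "\<bar>(\<Sum>j<n. g (x z j)) - (\<Sum>j<n. poly q (x z j))\<bar> \<le> (\<Sum>j<n. \<bar>g (x z j) - poly q (x z j)\<bar>)"
        unfolding sum_subtractf[symmetric] by (rule sum_abs)
      also have "\<dots> \<le> (\<Sum>j<n. K * (L * norm z) ^ 3)"
      proof (rule sum_mono)
        fix j assume "j \<in> {..<n}"
        then have j: "j < n" by simp
        have "poly w (x z j) \<le> W z" unfolding W_def using j w0 by (intro member_le_sum) auto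
        with elim have "poly w (x z j) \<le> \<bar>L0\<bar> * norm z ^ 2" by linarith
        then have "sqrt (poly w (x z j)) \<le> sqrt (\<bar>L0\<bar> * norm z ^ 2)" by (rule real_sqrt_le_mono)
        also have "\<dots> = L * norm z" by (simp add: L_def real_sqrt_mult)
        finally have "sqrt (poly w (x z j)) \<le> L * norm z" .
        then have "sqrt (poly w (x z j)) ^ 3 \<le> (L * norm z) ^ 3" using w0 by (intro power_mono) auto
        moreover have "sqrt (poly w (x z j)) = (\<Prod>c\<in>C. \<bar>x z j - c\<bar>)"
          by (intro real_sqrt_unique) (auto simp: w prod_power_distrib intro!: prod_nonneg)
        ultimately have "(\<Prod>c\<in>C. \<bar>x z j - c\<bar> ^ 3) \<le> (L * norm z) ^ 3" by (simp add: prod_power_distrib)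
        then show "\<bar>g (x z j) - poly q (x z j)\<bar> \<le> K * (L * norm z) ^ 3"
          using K(2)[of "x z j"] K(1) elim(2) j x0 by (meson atLeastAtMost_iff mult_left_mono order_trans)
      qed
      also have "\<dots> = (real n * K * L ^ 3) * norm (norm z ^ 3)" by (simp add: power_mult_distrib)
      finally show ?case by simp
    qed
    then have "(\<lambda>z. (\<Sum>j<n. g (x z j)) - (\<Sum>j<n. poly q (x z j))) \<in> O[at 0](\<lambda>z. norm z ^ 3)" by (rule bigoI)
    from bigo_four_mean[of _ "\<lambda>t. t ^ 3", OF this]
    have "(\<lambda>z. four_mean (\<lambda>z. (\<Sum>j<n. g (x z j)) - (\<Sum>j<n. poly q (x z j))) z) \<in> O[at 0](\<lambda>z. norm z ^ 3)" .
    from sum_in_bigo(1)[OF this Q]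
    have "(\<lambda>z. four_mean (\<lambda>z. \<Sum>j<n. g (x z j)) z - ((\<Sum>i<n. \<mu> i powr \<beta>) +
       (\<Sum>i<n. \<Sum>l<n. (cmod (B $$ (i, l)))\<^sup>2 * powr_divided_difference \<beta> (\<mu> i) (\<mu> l)) * norm z ^ 2)) \<in> O[at 0](\<lambda>z. norm z ^ 3)"
      by (simp add: four_mean_def diff_divide_distrib add_divide_distrib algebra_simps)
    from landau_o.big_small_trans[OF this 32]
    show ?thesis by (simp only: window[OF x0])
  qed
  have "\<forall>\<^sub>F a in at_right 0. \<forall>c\<in>C. c \<noteq> 0 \<longrightarrow> a / (1 - a) < c \<and> c < (1 - a) / a"
  proof (intro eventually_ball_finite finC ballI)
    fix c assume c: "c \<in> C"
    show "\<forall>\<^sub>F a in at_right 0. c \<noteq> 0 \<longrightarrow> a / (1 - a) < c \<and> c < (1 - a) / a"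
    proof (cases "c = 0")
      case False
      then have "c > 0" using CR[OF c] by simp
      \<comment> \<open>These bounds on a are a / (1 - a) < c and c < (1 - a) / a, solved for
        a.\<close>
      then have "0 < min (c / (1 + c)) (1 / (1 + c))" by simp
      from eventually_at_right_real[OF this] show ?thesis
      proof eventually_elim
        case (elim a)
        have "c / (1 + c) < 1" "1 / (1 + c) < 1" using \<open>c > 0\<close> by simp_all
        with elim have a1: "0 < a" "a < 1" "a < c / (1 + c)" "a < 1 / (1 + c)" by auto
        then have "a * (1 + c) < c" "a * (1 + c) < 1" using \<open>c > 0\<close> by (simp_all add: field_simps)
        then show ?case using a1 \<open>c > 0\<close> by (simp add: field_simps)
      qed
    qed simp
  qed
  moreover have "\<forall>\<^sub>F a in at_right 0. (0::real) < a \<and> a < 1 / 2"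
    by (auto simp: eventually_at_right_field intro!: exI[of _ "1/2"])
  ultimately show ?thesis
  proof eventually_elim
    case (elim a)
    from elim(2) have a: "0 < a" "a < 1 / 2" by auto
    have "a / (1 - a) < c \<and> c < (1 - a) / a" if "c \<in> C" "c \<noteq> 0" for c
      using bspec[OF elim(1) that(1)] that(2) by (rule mp)
    from good[OF a this] show ?case .
  qed
qed

section \<open>Singular value decomposition\<close>

lemma cscalar_prod_sum:
  fixes v w :: "complex vec"
  assumes "w \<in> carrier_vec n"
  shows "v \<bullet>c w = (\<Sum>i<n. v $ i * cnj (w $ i))"
  using assms by (simp add: scalar_prod_def lessThan_atLeast0)

lemma mult_carrier_square:
  "A \<in> carrier_mat n n \<Longrightarrow> B \<in> carrier_mat n n \<Longrightarrow> A * B \<in> carrier_mat n n"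
  by (rule mult_carrier_mat)

lemma unitary_matI:
  assumes "U \<in> carrier_mat n n" "mat_adjoint U * U = 1\<^sub>m n"
  shows "unitary_mat n U"
  using assms mat_mult_left_right_inverse[of "mat_adjoint U" n U] by (simp add: unitary_mat_def)

lemma unitary_matD:
  assumes "unitary_mat n U"
  shows "U \<in> carrier_mat n n" "mat_adjoint U \<in> carrier_mat n n"
    "mat_adjoint U * U = 1\<^sub>m n" "U * mat_adjoint U = 1\<^sub>m n"
  using assms by (simp_all add: unitary_mat_def)

lemma unitary_mat_mult:
  assumes U: "unitary_mat n U" and V: "unitary_mat n V"
  shows "unitary_mat n (U * V)"
proof (rule unitary_matI)
  note u = unitary_matD[OF U] and v = unitary_matD[OF V]
  show "U * V \<in> carrier_mat n n" using u v by (intro mult_carrier_mat[of _ n n])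
  have "mat_adjoint (U * V) * (U * V) = mat_adjoint V * (mat_adjoint U * (U * V))"
    unfolding mat_adjoint_mult[OF u(1) v(1)] using u v
    by (intro assoc_mult_mat[of _ n n _ n _ n] mult_carrier_mat[of _ n n])
  also have "mat_adjoint U * (U * V) = (mat_adjoint U * U) * V"
    using u v by (intro assoc_mult_mat[symmetric, of _ n n _ n _ n])
  also have "\<dots> = V" unfolding u(3) using v(1) by (rule left_mult_one_mat)
  also have "mat_adjoint V * V = 1\<^sub>m n" by (rule v(3))
  finally show "mat_adjoint (U * V) * (U * V) = 1\<^sub>m n" .
qed

lemma det_adjoint:
  fixes A :: "complex mat"
  assumes A: "A \<in> carrier_mat n n"
  shows "det (mat_adjoint A) = cnj (det A)"
proof -
  interpret cnj: comm_ring_hom cnj by unfold_locales auto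
  have "mat_adjoint A = transpose_mat (map_mat cnj A)" by (rule eq_matI) auto
  then show ?thesis using A by (simp add: det_transpose[of _ n] cnj.hom_det)
qed

text \<open>Gram-Schmidt applied to a basis that starts with v keeps v in first place. The
  orthogonal vectors are then normalised, which does not change v because it has norm 1.\<close>

lemma unitary_with_first_column:
  fixes v :: "complex vec"
  assumes v: "v \<in> carrier_vec n" and n: "n > 0" and unit: "v \<bullet>c v = 1"
  shows "\<exists>W. unitary_mat n W \<and> (\<forall>i<n. W $$ (i, 0) = v $ i)"
proof -
  interpret cof_vec_space n "TYPE(complex)" .
  have v0: "v \<noteq> 0\<^sub>v n" using unit v by auto
  define b where "b = basis_completion v"
  note b = basis_completion[OF v v0, folded b_def]
  define ws where "ws = gram_schmidt n b"
  from gram_schmidt_result[OF b(2) b(4) b(5) ws_def]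
  have ws: "corthogonal ws" "set ws \<subseteq> carrier_vec n" "length ws = n" using b(6) by auto
  obtain b' where b': "b = v # b'" using b(6,7) n by (cases b) auto
  have "hd ws = v" unfolding ws_def b' using v by simp
  then have ws0: "ws ! 0 = v" using ws(3) n by (cases ws) auto
  have wc: "ws ! j \<in> carrier_vec n" if "j < n" for j using ws that by auto
  define N where "N j = sqrt (\<Sum>k<n. (cmod (ws ! j $ k))\<^sup>2)" for j
  have self: "ws ! j \<bullet>c ws ! j = of_real (N j ^ 2)" if "j < n" for j
  proof -
    have "N j ^ 2 = (\<Sum>k<n. (cmod (ws ! j $ k))\<^sup>2)" unfolding N_def by (intro real_sqrt_pow2 sum_nonneg) auto
    then show ?thesis
      unfolding cscalar_prod_sum[OF wc[OF that]] by (simp only: of_real_sum complex_norm_square)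
  qed
  have N0: "N j \<noteq> 0" if "j < n" for j
    using self[OF that] corthogonalD[OF ws(1), of j j] ws(3) that by auto
  have N1: "N 0 = 1"
  proof -
    have "complex_of_real (N 0 ^ 2) = 1" using self[OF n] unit ws0 by simp
    then have "N 0 ^ 2 = 1" by (simp only: of_real_eq_1_iff)
    moreover have "N 0 \<ge> 0" unfolding N_def by (intro real_sqrt_ge_zero sum_nonneg) auto
    ultimately show ?thesis by (simp add: power2_eq_1_iff)
  qed
  define W where "W = mat n n (\<lambda>(i, j). ws ! j $ i / of_real (N j))"
  have W: "W \<in> carrier_mat n n" by (simp add: W_def)
  have "mat_adjoint W * W = 1\<^sub>m n"
  proof (rule eq_matI)
    fix i j assume "i < dim_row (1\<^sub>m n)" "j < dim_col (1\<^sub>m n)"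
    then have ij: "i < n" "j < n" by auto
    have "(mat_adjoint W * W) $$ (i, j) = (\<Sum>k<n. mat_adjoint W $$ (i, k) * W $$ (k, j))"
      using W ij by (intro mat_mult_index_sum) auto
    also have "\<dots> = (\<Sum>k<n. ws ! j $ k * cnj (ws ! i $ k)) / (of_real (N i) * of_real (N j))"
      unfolding sum_divide_distrib using ij by (intro sum.cong refl) (simp add: W_def mult_ac)
    also have "(\<Sum>k<n. ws ! j $ k * cnj (ws ! i $ k)) = ws ! j \<bullet>c ws ! i"
      by (rule cscalar_prod_sum[OF wc[OF ij(1)], symmetric])
    also have "\<dots> / (of_real (N i) * of_real (N j)) = 1\<^sub>m n $$ (i, j)"
    proof (cases "i = j")
      case True
      then show ?thesis using self[OF ij(1)] N0[OF ij(1)] ij by (simp add: power2_eq_square)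
    next
      case False
      then show ?thesis using corthogonalD[OF ws(1), of j i] ws(3) ij by simp
    qed
    finally show "(mat_adjoint W * W) $$ (i, j) = 1\<^sub>m n $$ (i, j)" .
  qed (use W in auto)
  with W have "unitary_mat n W" by (rule unitary_matI)
  moreover have "W $$ (i, 0) = v $ i" if "i < n" for i using that n by (simp add: W_def N1 ws0)
  ultimately show ?thesis by blast
qed

section \<open>Singular pairs and deflation\<close>

lemma cscalar_prod_adjoint:
  fixes A :: "complex mat"
  assumes A: "A \<in> carrier_mat n n" and v: "v \<in> carrier_vec n" and w: "w \<in> carrier_vec n"
  shows "(A *\<^sub>v v) \<bullet>c w = v \<bullet>c (mat_adjoint A *\<^sub>v w)"
proof -
  have "(A *\<^sub>v v) \<bullet>c w = (\<Sum>i<n. (\<Sum>k<n. A $$ (i, k) * v $ k) * cnj (w $ i))"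
    unfolding cscalar_prod_sum[OF w] using A v by (intro sum.cong refl) (simp add: scalar_prod_def lessThan_atLeast0)
  also have "\<dots> = (\<Sum>k<n. v $ k * cnj (\<Sum>i<n. cnj (A $$ (i, k)) * w $ i))"
    unfolding sum_distrib_right by (subst sum.swap) (simp add: sum_distrib_left mult_ac)
  also have "\<dots> = (\<Sum>k<n. v $ k * cnj ((mat_adjoint A *\<^sub>v w) $ k))"
    using A w by (intro sum.cong refl) (simp add: scalar_prod_def lessThan_atLeast0)
  also have "\<dots> = v \<bullet>c (mat_adjoint A *\<^sub>v w)"
    using A w by (intro cscalar_prod_sum[symmetric] mult_mat_vec_carrier[of _ n n]) auto
  finally show ?thesis .
qed

lemma normalized_vector:
  fixes v :: "complex vec"
  assumes v: "v \<in> carrier_vec n" "v \<noteq> 0\<^sub>v n"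
  shows "\<exists>c. c \<noteq> 0 \<and> (c \<cdot>\<^sub>v v) \<bullet>c (c \<cdot>\<^sub>v v) = 1"
proof -
  define N where "N = (\<Sum>k<n. (cmod (v $ k))\<^sup>2)"
  have vv: "v \<bullet>c v = of_real N"
    unfolding cscalar_prod_sum[OF v(1)] N_def by (simp only: of_real_sum complex_norm_square)
  have "\<exists>i<n. v $ i \<noteq> 0" using v by (metis carrier_vecD eq_vecI index_zero_vec)
  then have "N > 0" unfolding N_def by (auto intro!: sum_pos2)
  define c where "c = complex_of_real (1 / sqrt N)"
  have "(c \<cdot>\<^sub>v v) \<bullet>c (c \<cdot>\<^sub>v v) = (\<Sum>k<n. (c * v $ k) * cnj (c * v $ k))"
    using v(1) by (subst cscalar_prod_sum[of _ n]) auto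
  also have "\<dots> = c * cnj c * (v \<bullet>c v)"
    unfolding cscalar_prod_sum[OF v(1)] sum_distrib_left by (simp add: mult_ac)
  also have "c * cnj c = of_real (1 / N)"
    unfolding c_def using \<open>N > 0\<close> by (simp flip: of_real_mult add: real_sqrt_mult_self)
  finally have "(c \<cdot>\<^sub>v v) \<bullet>c (c \<cdot>\<^sub>v v) = 1" unfolding vv using \<open>N > 0\<close> by simp
  moreover have "c \<noteq> 0" using \<open>N > 0\<close> by (simp add: c_def)
  ultimately show ?thesis by blast
qed

lemma unit_kernel_vector:
  fixes A :: "complex mat"
  assumes A: "A \<in> carrier_mat n n" "det A = 0"
  shows "\<exists>v\<in>carrier_vec n. v \<bullet>c v = 1 \<and> A *\<^sub>v v = 0\<^sub>v n"
proof -
  from A obtain v where v: "v \<in> carrier_vec n" "v \<noteq> 0\<^sub>v n" "A *\<^sub>v v = 0\<^sub>v n"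
    using det_0_iff_vec_prod_zero_field[OF A(1)] by auto
  from normalized_vector[OF v(1,2)] obtain c where "(c \<cdot>\<^sub>v v) \<bullet>c (c \<cdot>\<^sub>v v) = 1" by blast
  moreover have "A *\<^sub>v (c \<cdot>\<^sub>v v) = 0\<^sub>v n"
    unfolding mult_mat_vec[OF A(1) v(1)] v(3) by (rule eq_vecI) auto
  ultimately show ?thesis using v(1) by (intro bexI[of _ "c \<cdot>\<^sub>v v"]) auto
qed

text \<open>For invertible A take an eigenvector v of the Gram matrix and u = Av / s, where s is the
  square root of its eigenvalue. For singular A that s may be 0; there kernel vectors of A and of
  its adjoint serve, with \<tau> = 0.\<close>

lemma singular_pair_exists:
  fixes A :: "complex mat"
  assumes A: "A \<in> carrier_mat n n" and n: "n > 0"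
  shows "\<exists>u\<in>carrier_vec n. \<exists>v\<in>carrier_vec n. \<exists>\<tau>. u \<bullet>c u = 1 \<and> v \<bullet>c v = 1 \<and>
    A *\<^sub>v v = \<tau> \<cdot>\<^sub>v u \<and> mat_adjoint A *\<^sub>v u = cnj \<tau> \<cdot>\<^sub>v v"
proof (cases "det A = 0")
  case True
  have Ad: "mat_adjoint A \<in> carrier_mat n n" using A by simp
  have "det (mat_adjoint A) = 0" using det_adjoint[OF A] True by simp
  from unit_kernel_vector[OF Ad this] unit_kernel_vector[OF A True] obtain u v where
    "u \<in> carrier_vec n" "u \<bullet>c u = 1" "mat_adjoint A *\<^sub>v u = 0\<^sub>v n"
    "v \<in> carrier_vec n" "v \<bullet>c v = 1" "A *\<^sub>v v = 0\<^sub>v n" by blast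
  then show ?thesis
    by (intro bexI[of _ u] bexI[of _ v] exI[of _ 0]) auto
next
  case False
  define H where "H = mat_adjoint A * A"
  have H: "H \<in> carrier_mat n n" unfolding H_def using A by (intro mult_carrier_mat[of _ n n]) auto
  have detH: "det H \<noteq> 0" unfolding H_def using A False det_adjoint[OF A] by (simp add: det_mult[of _ n])
  from char_poly_factorized[OF H] obtain es where es: "char_poly H = (\<Prod>a\<leftarrow>es. [:-a, 1:])" "length es = n" by blast
  then obtain e es' where "es = e # es'" using n by (cases es) auto
  then have ev: "eigenvalue H e" unfolding eigenvalue_root_char_poly[OF H] es(1) by simp
  note e = adjoint_mult_self_eigenvalue_nonneg[OF A ev[unfolded H_def]]
  from ev H obtain v0 where v0: "v0 \<in> carrier_vec n" "v0 \<noteq> 0\<^sub>v n" "H *\<^sub>v v0 = e \<cdot>\<^sub>v v0"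
    unfolding eigenvalue_def eigenvector_def by auto
  from normalized_vector[OF v0(1,2)] obtain c where c: "(c \<cdot>\<^sub>v v0) \<bullet>c (c \<cdot>\<^sub>v v0) = 1" by blast
  define v where "v = c \<cdot>\<^sub>v v0"
  have v: "v \<in> carrier_vec n" "v \<bullet>c v = 1" using v0 c by (auto simp: v_def)
  have Hv: "H *\<^sub>v v = e \<cdot>\<^sub>v v"
    unfolding v_def mult_mat_vec[OF H v0(1)] v0(3) by (simp add: smult_smult_assoc mult.commute)
  have "e \<noteq> 0"
  proof
    assume "e = 0"
    with v0 have "H *\<^sub>v v0 = 0\<^sub>v n" by auto
    with v0 detH show False using det_0_iff_vec_prod_zero_field[OF H] by blast
  qed
  define s where "s = sqrt (Re e)"
  have "Re e \<noteq> 0" using e(1) \<open>e \<noteq> 0\<close> by auto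
  then have s: "s > 0" using e(2) by (simp add: s_def)
  have es2: "e = of_real s * of_real s" using e by (simp add: s_def flip: of_real_mult)
  define y where "y = A *\<^sub>v v"
  have y: "y \<in> carrier_vec n" using A v by (simp add: y_def)
  have Ay: "mat_adjoint A *\<^sub>v y = e \<cdot>\<^sub>v v"
    using Hv A v unfolding y_def H_def by (simp add: assoc_mult_mat_vec[of _ n n _ n])
  define u where "u = of_real (1 / s) \<cdot>\<^sub>v y"
  have u: "u \<in> carrier_vec n" using y by (simp add: u_def)
  have "y \<bullet>c y = v \<bullet>c (e \<cdot>\<^sub>v v)"
    using cscalar_prod_adjoint[OF A v(1) y] Ay by (simp add: y_def)
  also have "\<dots> = cnj e * (v \<bullet>c v)"
    using v(1) by (subst (1 2) cscalar_prod_sum[of _ n]) (auto simp: sum_distrib_left mult_ac)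
  finally have yy: "y \<bullet>c y = of_real s * of_real s" using v(2) es2 by simp
  have "u \<bullet>c u = of_real (1 / s) * of_real (1 / s) * (y \<bullet>c y)"
    unfolding u_def using y by (subst (1 2) cscalar_prod_sum[of _ n]) (auto simp: sum_distrib_left mult_ac)
  then have "u \<bullet>c u = 1" unfolding yy using s by simp
  moreover have "A *\<^sub>v v = of_real s \<cdot>\<^sub>v u"
    unfolding u_def y_def[symmetric] using s by (simp add: smult_smult_assoc)
  moreover have "mat_adjoint A *\<^sub>v u = cnj (of_real s) \<cdot>\<^sub>v v"
  proof -
    have "mat_adjoint A *\<^sub>v u = of_real (1 / s) \<cdot>\<^sub>v (e \<cdot>\<^sub>v v)"
      unfolding u_def Ay[symmetric] using A y by (intro mult_mat_vec[of _ n n]) auto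
    then show ?thesis using s es2 by (simp add: smult_smult_assoc)
  qed
  ultimately show ?thesis using u v by blast
qed


text \<open>The block diagonal sum of the scalar \<open>c\<close> and the matrix
  \<open>U\<close>.\<close>

definition bordered :: "nat \<Rightarrow> complex \<Rightarrow> complex mat \<Rightarrow> complex mat" where
  "bordered n c U = mat (Suc n) (Suc n) (\<lambda>(i, j).
     if i = 0 \<and> j = 0 then c else if i = 0 \<or> j = 0 then 0 else U $$ (i - 1, j - 1))"

lemma bordered_carrier [simp]: "bordered n c U \<in> carrier_mat (Suc n) (Suc n)"
  by (simp add: bordered_def)

lemma bordered_mult:
  assumes U: "U \<in> carrier_mat n n" and V: "V \<in> carrier_mat n n"
  shows "bordered n c U * bordered n d V = bordered n (c * d) (U * V)"
proof (rule eq_matI)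
  fix i j assume "i < dim_row (bordered n (c * d) (U * V))" "j < dim_col (bordered n (c * d) (U * V))"
  then have ij: "i < Suc n" "j < Suc n" by (auto simp: bordered_def)
  have "(bordered n c U * bordered n d V) $$ (i, j) =
      (\<Sum>l<Suc n. bordered n c U $$ (i, l) * bordered n d V $$ (l, j))"
    using ij by (intro mat_mult_index_sum) auto
  also have "\<dots> = bordered n (c * d) (U * V) $$ (i, j)"
  proof (cases "i = 0 \<or> j = 0")
    case True
    then show ?thesis using ij by (auto simp: bordered_def sum.lessThan_Suc_shift simp del: sum.lessThan_Suc)
  next
    case False
    then have "(U * V) $$ (i - 1, j - 1) = (\<Sum>l<n. U $$ (i - 1, l) * V $$ (l, j - 1))"
      using ij by (intro mat_mult_index_sum[OF U V]) auto
    then show ?thesis using ij False by (simp add: bordered_def sum.lessThan_Suc_shift del: sum.lessThan_Suc)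
  qed
  finally show "(bordered n c U * bordered n d V) $$ (i, j) = bordered n (c * d) (U * V) $$ (i, j)" .
qed (auto simp: bordered_def)

lemma bordered_adjoint:
  assumes U: "U \<in> carrier_mat n n"
  shows "mat_adjoint (bordered n c U) = bordered n (cnj c) (mat_adjoint U)"
  by (rule eq_matI) (use U in \<open>auto simp: bordered_def\<close>)

lemma bordered_one: "bordered n 1 (1\<^sub>m n) = 1\<^sub>m (Suc n)"
  by (rule eq_matI) (auto simp: bordered_def)

lemma unitary_bordered:
  assumes U: "unitary_mat n U"
  shows "unitary_mat (Suc n) (bordered n 1 U)"
  by (rule unitary_matI)
    (simp_all add: bordered_adjoint[OF unitary_matD(1)[OF U]] bordered_mult unitary_matD[OF U] bordered_one)

text \<open>Deflation: in unitary bases that start with a singular pair, the two equations of the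
  pair clear the first column and the first row except for \<tau>0, and a smaller matrix is left.
  The \<tau> may be complex and come in any order; later conclusions involve only their moduli and
  their zeros.\<close>

lemma svd_exists:
  fixes A :: "complex mat"
  assumes "A \<in> carrier_mat n n"
  shows "\<exists>U V \<tau>. unitary_mat n U \<and> unitary_mat n V \<and> A = U * mat_diag n \<tau> * mat_adjoint V"
  using assms
proof (induction n arbitrary: A)
  case 0
  have "unitary_mat 0 (1\<^sub>m 0)" by (rule unitary_matI) (auto intro!: eq_matI)
  moreover have "A = 1\<^sub>m 0 * mat_diag 0 (\<lambda>_. 0) * mat_adjoint (1\<^sub>m 0)"
    using 0 by (auto intro!: eq_matI)
  ultimately show ?case by blast
next
  case (Suc n)
  let ?N = "Suc n"
  from singular_pair_exists[OF Suc.prems] obtain u v \<tau>0 where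
    u: "u \<in> carrier_vec ?N" "u \<bullet>c u = 1" and v: "v \<in> carrier_vec ?N" "v \<bullet>c v = 1"
    and Av: "A *\<^sub>v v = \<tau>0 \<cdot>\<^sub>v u" and Au: "mat_adjoint A *\<^sub>v u = cnj \<tau>0 \<cdot>\<^sub>v v" by blast
  from unitary_with_first_column[OF u(1) _ u(2)] obtain P where
    P: "unitary_mat ?N P" "\<And>i. i < ?N \<Longrightarrow> P $$ (i, 0) = u $ i" by auto
  from unitary_with_first_column[OF v(1) _ v(2)] obtain Q where
    Q: "unitary_mat ?N Q" "\<And>i. i < ?N \<Longrightarrow> Q $$ (i, 0) = v $ i" by auto
  note p = unitary_matD[OF P(1)] and q = unitary_matD[OF Q(1)]
  define X where "X = mat_adjoint P * (A * Q)"
  have AQ: "A * Q \<in> carrier_mat ?N ?N" using Suc.prems q by (intro mult_carrier_mat)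
  have X: "X \<in> carrier_mat ?N ?N" unfolding X_def by (rule mult_carrier_square[OF p(2) AQ])
  have Avi: "(\<Sum>l<?N. A $$ (i, l) * v $ l) = \<tau>0 * u $ i" if "i < ?N" for i
    using arg_cong[OF Av, of "\<lambda>w. w $ i"] that Suc.prems u v by (simp add: scalar_prod_def lessThan_atLeast0)
  have Aui: "(\<Sum>l<?N. cnj (A $$ (l, i)) * u $ l) = cnj \<tau>0 * v $ i" if "i < ?N" for i
    using arg_cong[OF Au, of "\<lambda>w. w $ i"] that Suc.prems u v by (simp add: scalar_prod_def lessThan_atLeast0)
  have col0: "X $$ (i, 0) = (if i = 0 then \<tau>0 else 0)" if i: "i < ?N" for i
  proof -
    have "X $$ (i, 0) = (\<Sum>k<?N. mat_adjoint P $$ (i, k) * (A * Q) $$ (k, 0))"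
      unfolding X_def by (rule mat_mult_index_sum[OF p(2) AQ i]) simp
    also have "\<dots> = (\<Sum>k<?N. mat_adjoint P $$ (i, k) * (\<tau>0 * P $$ (k, 0)))"
    proof (intro sum.cong refl)
      fix k assume "k \<in> {..<?N}"
      then have "(A * Q) $$ (k, 0) = (\<Sum>l<?N. A $$ (k, l) * v $ l)"
        using mat_mult_index_sum[OF Suc.prems q(1), of k 0] Q(2) by simp
      then show "mat_adjoint P $$ (i, k) * (A * Q) $$ (k, 0) = mat_adjoint P $$ (i, k) * (\<tau>0 * P $$ (k, 0))"
        using Avi[of k] P(2)[of k] \<open>k \<in> {..<?N}\<close> by simp
    qed
    also have "\<dots> = \<tau>0 * (mat_adjoint P * P) $$ (i, 0)"
      using mat_mult_index_sum[OF p(2) p(1) i, of 0] by (simp add: sum_distrib_left mult_ac del: sum.lessThan_Suc)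
    finally show ?thesis using i by (simp add: p(3))
  qed
  have row0: "X $$ (0, j) = (if j = 0 then \<tau>0 else 0)" if j: "j < ?N" for j
  proof -
    have "X $$ (0, j) = (\<Sum>k<?N. mat_adjoint P $$ (0, k) * (A * Q) $$ (k, j))"
      unfolding X_def by (rule mat_mult_index_sum[OF p(2) AQ _ j]) simp
    also have "\<dots> = (\<Sum>k<?N. cnj (u $ k) * (\<Sum>l<?N. A $$ (k, l) * Q $$ (l, j)))"
    proof (intro sum.cong refl)
      fix k assume "k \<in> {..<?N}"
      then show "mat_adjoint P $$ (0, k) * (A * Q) $$ (k, j) = cnj (u $ k) * (\<Sum>l<?N. A $$ (k, l) * Q $$ (l, j))"
        using mat_mult_index_sum[OF Suc.prems q(1) _ j, of k] p P(2)[of k] by (simp del: sum.lessThan_Suc)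
    qed
    also have "\<dots> = (\<Sum>l<?N. cnj (\<Sum>k<?N. cnj (A $$ (k, l)) * u $ k) * Q $$ (l, j))"
      unfolding sum_distrib_left cnj_sum sum_distrib_right
      by (subst sum.swap) (simp add: mult_ac del: sum.lessThan_Suc)
    also have "\<dots> = (\<Sum>l<?N. \<tau>0 * (mat_adjoint Q $$ (0, l) * Q $$ (l, j)))"
      using q Q(2) Aui by (intro sum.cong refl) (simp del: sum.lessThan_Suc)
    also have "\<dots> = \<tau>0 * (mat_adjoint Q * Q) $$ (0, j)"
      using mat_mult_index_sum[OF q(2) q(1) _ j, of 0] by (simp add: sum_distrib_left del: sum.lessThan_Suc)
    finally show ?thesis using j by (auto simp: q(3))
  qed
  define A' where "A' = mat n n (\<lambda>(i, j). X $$ (Suc i, Suc j))"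
  have XA': "X = bordered n \<tau>0 A'"
    by (rule eq_matI) (use X col0 row0 in \<open>auto simp: bordered_def A'_def\<close>)
  have "A' \<in> carrier_mat n n" by (simp add: A'_def)
  from Suc.IH[OF this] obtain U V \<tau> where UV: "unitary_mat n U" "unitary_mat n V"
    "A' = U * mat_diag n \<tau> * mat_adjoint V" by blast
  note uu = unitary_matD[OF UV(1)] and vv = unitary_matD[OF UV(2)]
  define \<tau>' where "\<tau>' i = (case i of 0 \<Rightarrow> \<tau>0 | Suc i \<Rightarrow> \<tau> i)" for i
  have D: "mat_diag ?N \<tau>' = bordered n \<tau>0 (mat_diag n \<tau>)"
    by (rule eq_matI) (auto simp: mat_diag_def bordered_def \<tau>'_def split: nat.split)
  let ?U = "bordered n 1 U" and ?V = "bordered n 1 V"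
  have UD: "U * mat_diag n \<tau> \<in> carrier_mat n n" using uu by (intro mult_carrier_mat[of _ n n]) auto
  have X_eq: "X = ?U * mat_diag ?N \<tau>' * mat_adjoint ?V"
    unfolding XA' D UV(3) bordered_adjoint[OF vv(1)]
    using uu vv UD by (simp add: bordered_mult)
  have "P * X = A * Q"
    unfolding X_def using assoc_mult_mat[OF p(1) p(2) AQ] by (simp only: p(4) left_mult_one_mat[OF AQ])
  then have "A = P * X * mat_adjoint Q"
    using assoc_mult_mat[OF Suc.prems q(1) q(2)] q(4) Suc.prems by simp
  also have "\<dots> = (P * ?U) * mat_diag ?N \<tau>' * mat_adjoint (Q * ?V)"
    unfolding X_eq mat_adjoint_mult[OF q(1) bordered_carrier]
    using p q by (simp add: assoc_mult_mat[of _ ?N ?N _ ?N _ ?N] mult_carrier_square)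
  finally show ?case
    using unitary_mat_mult[OF P(1) unitary_bordered[OF UV(1)]] unitary_mat_mult[OF Q(1) unitary_bordered[OF UV(2)]]
    by blast
qed

section \<open>Circle means\<close>

text \<open>The single \<open>x \<theta> j\<close> are not assumed continuous, only their power
  sums. Weierstrass approximation of u^\<beta> on a common interval [0,R] exhibits the sum as a
  uniform limit of combinations of power sums.\<close>

lemma continuous_powr_sum:
  fixes x :: "'a::topological_space \<Rightarrow> nat \<Rightarrow> real"
  assumes S: "compact S" and x0: "\<And>\<theta> j. x \<theta> j \<ge> 0" and \<beta>: "\<beta> > 0"
    and ps: "\<And>m. continuous_on S (\<lambda>\<theta>. \<Sum>j<n. x \<theta> j ^ m)"
  shows "continuous_on S (\<lambda>\<theta>. \<Sum>j<n. x \<theta> j powr \<beta>)"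
proof -
  have "bounded ((\<lambda>\<theta>. \<Sum>j<n. x \<theta> j ^ 1) ` S)"
    by (intro compact_imp_bounded compact_continuous_image ps S)
  then obtain R where R: "\<And>\<theta>. \<theta> \<in> S \<Longrightarrow> \<bar>\<Sum>j<n. x \<theta> j\<bar> \<le> R"
    unfolding bounded_iff by auto
  have xR: "x \<theta> j \<in> {0..R}" if "\<theta> \<in> S" "j < n" for \<theta> j
  proof -
    have "x \<theta> j \<le> (\<Sum>j<n. x \<theta> j)" using that x0 by (intro member_le_sum) auto
    with R[OF that(1)] x0 show ?thesis by auto
  qed
  have cont: "continuous_on {0..R} (\<lambda>u. u powr \<beta>)"
    using \<beta> by (intro continuous_on_powr' continuous_intros) auto
  have "\<forall>k. \<exists>q. real_polynomial_function q \<and> (\<forall>u\<in>{0..R}. \<bar>u powr \<beta> - q u\<bar> < inverse (real (Suc k)))"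
    proof
    fix k
    have "0 < inverse (real (Suc k))" by simp
    then show "\<exists>q. real_polynomial_function q \<and> (\<forall>u\<in>{0..R}. \<bar>u powr \<beta> - q u\<bar> < inverse (real (Suc k)))"
      by (rule Stone_Weierstrass_real_polynomial_function[OF compact_Icc cont]) (rule exI, rule conjI, assumption, rule ballI)
  qed
  from choice[OF this] obtain q where
    "\<forall>k. real_polynomial_function (q k) \<and> (\<forall>u\<in>{0..R}. \<bar>u powr \<beta> - q k u\<bar> < inverse (real (Suc k)))" ..
  then have q: "\<And>k. real_polynomial_function (q k)"
    "\<And>k u. u \<in> {0..R} \<Longrightarrow> \<bar>u powr \<beta> - q k u\<bar> < inverse (real (Suc k))" by simp_all
  have cont_q: "continuous_on S (\<lambda>\<theta>. \<Sum>j<n. q k (x \<theta> j))" for k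
  proof -
    from q(1)[of k] obtain a N where a: "q k = (\<lambda>u. \<Sum>i\<le>N. a i * u ^ i)"
      unfolding real_polynomial_function_iff_sum by blast
    have "(\<Sum>j<n. q k (x \<theta> j)) = (\<Sum>i\<le>N. a i * (\<Sum>j<n. x \<theta> j ^ i))" for \<theta>
      unfolding a sum_distrib_left by (rule sum.swap)
    then show ?thesis by (simp only:) (intro continuous_intros ps)
  qed
  have lim: "uniform_limit S (\<lambda>k \<theta>. \<Sum>j<n. q k (x \<theta> j)) (\<lambda>\<theta>. \<Sum>j<n. x \<theta> j powr \<beta>) sequentially"
  proof (rule uniform_limitI)
    fix e :: real assume "e > 0"
    have "(\<lambda>k. real n * inverse (real (Suc k))) \<longlonglongrightarrow> real n * 0"
      by (intro tendsto_intros LIMSEQ_inverse_real_of_nat)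
    then have "\<forall>\<^sub>F k in sequentially. real n * inverse (real (Suc k)) < e"
      using \<open>e > 0\<close> by (intro order_tendstoD(2)) auto
    then show "\<forall>\<^sub>F k in sequentially. \<forall>\<theta>\<in>S. dist (\<Sum>j<n. q k (x \<theta> j)) (\<Sum>j<n. x \<theta> j powr \<beta>) < e"
    proof eventually_elim
      case (elim k)
      show ?case
      proof
        fix \<theta> assume \<theta>: "\<theta> \<in> S"
        have "dist (\<Sum>j<n. q k (x \<theta> j)) (\<Sum>j<n. x \<theta> j powr \<beta>) \<le> (\<Sum>j<n. \<bar>q k (x \<theta> j) - x \<theta> j powr \<beta>\<bar>)"
          unfolding dist_real_def sum_subtractf[symmetric] by (rule sum_abs)
        also have "\<dots> \<le> (\<Sum>j<n. inverse (real (Suc k)))"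
          using q(2)[OF xR[OF \<theta>]] by (intro sum_mono) (simp add: abs_minus_commute less_imp_le)
        also have "\<dots> < e" using elim by simp
        finally show "dist (\<Sum>j<n. q k (x \<theta> j)) (\<Sum>j<n. x \<theta> j powr \<beta>) < e" .
      qed
    qed
  qed
  show ?thesis
    by (rule uniform_limit_theorem[OF _ lim trivial_limit_sequentially])
      (rule always_eventually, rule allI, rule cont_q)
qed

lemma continuous_trace_power:
  fixes A B :: "complex mat"
  assumes A: "A \<in> carrier_mat n n" and B: "B \<in> carrier_mat n n"
  shows "continuous_on UNIV (\<lambda>z. mat_trace n ((mat_adjoint (A + z \<cdot>\<^sub>m B) * (A + z \<cdot>\<^sub>m B)) ^\<^sub>m m))"
proof -
  define H where "H z = mat_adjoint (A + z \<cdot>\<^sub>m B) * (A + z \<cdot>\<^sub>m B)" for z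
  have Hc: "H z \<in> carrier_mat n n" for z unfolding H_def using A B by (intro mult_carrier_square) auto
  have H: "continuous_on UNIV (\<lambda>z. H z $$ (i, j))" if "i < n" "j < n" for i j
  proof -
    have "H z $$ (i, j) = (\<Sum>l<n. cnj (A $$ (l, i) + z * B $$ (l, i)) * (A $$ (l, j) + z * B $$ (l, j)))" for z
      unfolding H_def using A B that
      by (subst mat_mult_index_sum[of _ n n _ n]) (auto intro!: sum.cong)
    then show ?thesis by (simp only:) (intro continuous_intros)
  qed
  have "continuous_on UNIV (\<lambda>z. (H z ^\<^sub>m m) $$ (i, j))" if "i < n" "j < n" for i j
    using that
  proof (induction m arbitrary: i j)
    case 0
    then show ?case by (simp add: carrier_matD[OF Hc])
  next
    case (Suc m)
    have "(H z ^\<^sub>m Suc m) $$ (i, j) = (\<Sum>l<n. (H z ^\<^sub>m m) $$ (i, l) * H z $$ (l, j))" for z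
      using mat_mult_index_sum[OF pow_carrier_mat[OF Hc] Hc Suc.prems] by simp
    moreover have "continuous_on UNIV (\<lambda>z. \<Sum>l<n. (H z ^\<^sub>m m) $$ (i, l) * H z $$ (l, j))"
      using Suc by (intro continuous_intros H) auto
    ultimately show ?case by (simp only:)
  qed
  then show ?thesis unfolding mat_trace_def H_def[symmetric] by (intro continuous_intros) auto
qed

section \<open>Integration over the circle\<close>

lemma integral_periodic_shift:
  fixes g :: "real \<Rightarrow> real"
  assumes g: "continuous_on UNIV g" and per: "\<And>x. g (x + P) = g x" and c: "0 \<le> c" "c \<le> P"
  shows "integral {0..P} (\<lambda>x. g (x + c)) = integral {0..P} g"
proof -
  have int: "g integrable_on {a..b}" for a b
    using g by (intro integrable_continuous_real) (auto intro: continuous_on_subset)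
  have shift: "integral {a..b} (\<lambda>x. g (x + d)) = integral {a + d..b + d} g" for a b d
    using integral_shift_Icc_real[of a b g d] by (simp add: o_def add.commute)
  have "integral {0..P} (\<lambda>x. g (x + c)) = integral {c..P + c} g" using shift[of 0 P c] by simp
  also have "\<dots> = integral {c..P} g + integral {P..P + c} g"
    using Henstock_Kurzweil_Integration.integral_combine[where a = c and c = P and b = "P + c" and f = g] c int by simp
  also have "integral {P..P + c} g = integral {0..c} g"
    using shift[of 0 c P] per by (simp add: add.commute)
  also have "integral {c..P} g + integral {0..c} g = integral {0..P} g"
    using Henstock_Kurzweil_Integration.integral_combine[where a = 0 and c = c and b = P and f = g] c int by simp
  finally show ?thesis .
qed

text \<open>Multiplication by a fourth root of unity shifts \<theta> by a multiple of pi/2, which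
  leaves the integral over a full period unchanged.\<close>

lemma integral_four_mean:
  fixes F :: "complex \<Rightarrow> real"
  assumes F: "continuous_on UNIV (\<lambda>\<theta>. F (of_real t * cis \<theta>))"
  shows "integral {0..2 * pi} (\<lambda>\<theta>. F (of_real t * cis \<theta>)) =
    integral {0..2 * pi} (\<lambda>\<theta>. four_mean F (of_real t * cis \<theta>))"
proof -
  define g where "g \<theta> = F (of_real t * cis \<theta>)" for \<theta>
  have g: "continuous_on UNIV g" using F by (simp add: g_def[abs_def])
  have per: "g (\<theta> + 2 * pi) = g \<theta>" for \<theta> by (simp add: g_def cis_mult[symmetric])
  have c1: "cis (pi / 2) = \<i>" "cis pi = -1" "cis (3 * pi / 2) = - \<i>"
    using cis_mult[of pi "pi / 2"] by (simp_all add: field_simps)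
  have eq: "four_mean F (of_real t * cis \<theta>) = (g \<theta> + g (\<theta> + pi / 2) + g (\<theta> + pi) + g (\<theta> + 3 * pi / 2)) / 4" for \<theta>
    unfolding four_mean_def g_def cis_mult[symmetric] c1 by (simp add: mult_ac)
  have int: "(\<lambda>\<theta>. g (\<theta> + d)) integrable_on {0..2 * pi}" for d
    by (intro integrable_continuous_real continuous_on_compose2[OF g] continuous_intros) auto
  have sh: "integral {0..2 * pi} (\<lambda>\<theta>. g (\<theta> + d)) = integral {0..2 * pi} g" if "0 \<le> d" "d \<le> 2 * pi" for d
    using integral_periodic_shift[OF g per that] .
  have "integral {0..2 * pi} (\<lambda>\<theta>. four_mean F (of_real t * cis \<theta>)) =
    (integral {0..2 * pi} g + integral {0..2 * pi} (\<lambda>\<theta>. g (\<theta> + pi / 2)) +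
     integral {0..2 * pi} (\<lambda>\<theta>. g (\<theta> + pi)) + integral {0..2 * pi} (\<lambda>\<theta>. g (\<theta> + 3 * pi / 2))) / 4"
    unfolding eq using int int[of 0] by (simp add: integral_add integrable_add)
  also have "\<dots> = integral {0..2 * pi} g"
    using sh[of "pi / 2"] sh[of pi] sh[of "3 * pi / 2"] by simp
  finally show ?thesis by (simp add: g_def[abs_def])
qed

text \<open>An estimate o(|z|^2) at the origin of the complex plane is uniform over the circle |z| =
  t, hence survives integration over \<theta>.\<close>

lemma circle_mean_smallo:
  fixes F :: "complex \<Rightarrow> real" and E :: "real \<Rightarrow> real"
  assumes cont: "\<And>t. continuous_on UNIV (\<lambda>\<theta>. F (of_real t * cis \<theta>))"
    and FE: "(\<lambda>z. four_mean F z - E (norm z)) \<in> o[at 0](\<lambda>z. norm z ^ 2)"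
  shows "(\<lambda>t. 1 / (2 * pi) * integral {0..2 * pi} (\<lambda>\<theta>. F (of_real t * cis \<theta>)) - E t) \<in> o[at_right 0](\<lambda>t. t ^ 2)"
proof (rule landau_o.smallI)
  fix \<epsilon> :: real assume "\<epsilon> > 0"
  from landau_o.smallD[OF FE this] obtain d where d: "d > 0"
    "\<And>z. z \<noteq> 0 \<Longrightarrow> norm z < d \<Longrightarrow> \<bar>four_mean F z - E (norm z)\<bar> \<le> \<epsilon> * norm z ^ 2"
    unfolding eventually_at by (auto simp: dist_norm)
  have "norm (1 / (2 * pi) * integral {0..2 * pi} (\<lambda>\<theta>. F (of_real t * cis \<theta>)) - E t) \<le> \<epsilon> * norm (t ^ 2)"
    if t: "0 < t" "t < d" for t
  proof -
    let ?h = "\<lambda>\<theta>. four_mean F (of_real t * cis \<theta>) - E t"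
    have shift: "continuous_on UNIV (\<lambda>\<theta>. F (u * (of_real t * cis \<theta>)))" if "u = cis c" for u c
    proof -
      have "u * (of_real t * cis \<theta>) = of_real t * cis (\<theta> + c)" for \<theta>
        unfolding that cis_mult[symmetric] by (simp add: mult_ac)
      then show ?thesis
        by (simp only:) (intro continuous_on_compose2[OF cont[of t], of UNIV "\<lambda>\<theta>. \<theta> + c"] continuous_intros, auto)
    qed
    have "continuous_on UNIV (\<lambda>\<theta>. four_mean F (of_real t * cis \<theta>))"
      using shift[of \<i> "pi / 2"] shift[of "-1" pi] shift[of "- \<i>" "- (pi / 2)"] cont[of t]
      unfolding four_mean_def by (intro continuous_intros) (simp_all add: cis_minus_pi_half)
    then have int: "(\<lambda>\<theta>. four_mean F (of_real t * cis \<theta>)) integrable_on {0..2 * pi}"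
      by (intro integrable_continuous_real) (auto intro: continuous_on_subset)
    have nz: "of_real t * cis \<theta> \<noteq> 0" "norm (of_real t * cis \<theta>) = t" for \<theta>
      using t by (auto simp: norm_mult)
    have h: "norm (?h \<theta>) \<le> \<epsilon> * t ^ 2" for \<theta>
      using d(2)[OF nz(1)[of \<theta>]] t unfolding nz(2) by simp
    have "norm (integral {0..2 * pi} ?h) \<le> integral {0..2 * pi} (\<lambda>_. \<epsilon> * t ^ 2)"
      using int h by (intro integral_norm_bound_integral Henstock_Kurzweil_Integration.integrable_diff) auto
    then have "norm (integral {0..2 * pi} ?h) \<le> 2 * pi * (\<epsilon> * t ^ 2)"
      by (simp add: mult_ac)
    moreover have "integral {0..2 * pi} ?h = integral {0..2 * pi} (\<lambda>\<theta>. F (of_real t * cis \<theta>)) - 2 * pi * E t"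
      unfolding integral_four_mean[OF cont]
      by (subst Henstock_Kurzweil_Integration.integral_diff[OF int]) auto
    moreover have "1 / (2 * pi) * integral {0..2 * pi} (\<lambda>\<theta>. F (of_real t * cis \<theta>)) - E t =
       (integral {0..2 * pi} (\<lambda>\<theta>. F (of_real t * cis \<theta>)) - 2 * pi * E t) / (2 * pi)"
      by (simp add: field_simps)
    ultimately show ?thesis using t by (simp add: field_simps abs_mult)
  qed
  then show "\<forall>\<^sub>F t in at_right 0. norm (1 / (2 * pi) * integral {0..2 * pi} (\<lambda>\<theta>. F (of_real t * cis \<theta>)) - E t) \<le> \<epsilon> * norm (t ^ 2)"
    using d(1) unfolding eventually_at_right_field by blast
qed

section \<open>Conclusion\<close>

lemma unitary_cancel:
  assumes U: "unitary_mat n U" and X: "X \<in> carrier_mat n n"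
  shows "mat_adjoint U * (U * X) = X" "U * (mat_adjoint U * X) = X"
proof -
  note u = unitary_matD[OF U]
  show "mat_adjoint U * (U * X) = X"
    using assoc_mult_mat[OF u(2) u(1) X] by (simp only: u(3) left_mult_one_mat[OF X])
  show "U * (mat_adjoint U * X) = X"
    using assoc_mult_mat[OF u(1) u(2) X] by (simp only: u(4) left_mult_one_mat[OF X])
qed

lemma schatten_powr_diag:
  assumes p: "p > 0"
  shows "schatten_powr p (mat_diag n \<tau>) = (\<Sum>i<n. ((cmod (\<tau> i))\<^sup>2) powr (p / 2))"
proof -
  define H where "H = mat_adjoint (mat_diag n \<tau>) * mat_diag n \<tau>"
  have adj: "mat_adjoint (mat_diag n \<tau>) = mat_diag n (\<lambda>i. cnj (\<tau> i))"
    by (rule eq_matI) (auto simp: mat_diag_def)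
  have H: "H = mat_diag n (\<lambda>i. of_real ((cmod (\<tau> i))\<^sup>2))"
    unfolding H_def adj mat_diag_mult_left[OF mat_diag_dim] complex_norm_square
    by (intro eq_matI) (auto simp: mat_diag_def mult.commute)
  have "upper_triangular H" unfolding H by (rule upper_triangularI) (simp add: mat_diag_def)
  moreover have "H \<in> carrier_mat n n" unfolding H by simp
  ultimately have "proots (char_poly H) = mset (diag_mat H)"
    using char_poly_upper_triangular[of H n] proots_linear_factors by metis
  also have "diag_mat H = map (\<lambda>i. of_real ((cmod (\<tau> i))\<^sup>2)) [0..<n]"
    unfolding H by (simp add: diag_mat_def mat_diag_def)
  finally have "schatten_powr p (mat_diag n \<tau>) = (\<Sum>i\<leftarrow>[0..<n]. sqrt ((cmod (\<tau> i))\<^sup>2) powr p)"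
    unfolding schatten_powr_def singular_values_def H_def[symmetric]
    by (simp only: mset_map[symmetric] sum_mset_sum_list map_map o_def Re_complex_of_real)
  also have "\<dots> = (\<Sum>i<n. sqrt ((cmod (\<tau> i))\<^sup>2) powr p)"
    by (simp add: sum_list_sum_nth lessThan_atLeast0)
  also have "\<dots> = (\<Sum>i<n. ((cmod (\<tau> i))\<^sup>2) powr (p / 2))"
  proof (intro sum.cong refl)
    have r: "sqrt y powr p = y powr (p / 2)" if "y \<ge> 0" for y
      using that by (simp add: powr_half_sqrt[symmetric] powr_powr)
    show "sqrt ((cmod (\<tau> i))\<^sup>2) powr p = ((cmod (\<tau> i))\<^sup>2) powr (p / 2)" for i by (rule r) simp
  qed
  finally show ?thesis .
qed

text \<open>U cancels in the Gram matrix, which becomes that of X conjugated by V and so keeps its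
  characteristic polynomial.\<close>

lemma schatten_powr_unitary:
  assumes U: "unitary_mat n U" and V: "unitary_mat n V" and X: "X \<in> carrier_mat n n"
  shows "schatten_powr p (U * X * mat_adjoint V) = schatten_powr p X"
proof -
  note u = unitary_matD[OF U] and v = unitary_matD[OF V]
  let ?Y = "U * X * mat_adjoint V" and ?H = "mat_adjoint X * X"
  note assoc = assoc_mult_mat[of _ n n _ n _ n] mult_carrier_square
  have adj: "mat_adjoint X \<in> carrier_mat n n" using X by simp
  have UX: "U * X \<in> carrier_mat n n" by (rule mult_carrier_square[OF u(1) X])
  have Y: "?Y \<in> carrier_mat n n" by (rule mult_carrier_square[OF UX v(2)])
  have "mat_adjoint ?Y = V * (mat_adjoint X * mat_adjoint U)"
    unfolding mat_adjoint_mult[OF UX v(2)] mat_adjoint_mult[OF u(1) X] by simp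
  then have "mat_adjoint ?Y * ?Y = V * ?H * mat_adjoint V"
    using u(1,2) v(1,2) X adj by (simp add: assoc unitary_cancel[OF U])
  from similar_mat_witI[OF v(4,3) this _ _ v(1,2)]
  have "similar_mat_wit (mat_adjoint ?Y * ?Y) ?H V (mat_adjoint V)"
    using Y X adj by (simp add: mult_carrier_square)
  then have "char_poly (mat_adjoint ?Y * ?Y) = char_poly (mat_adjoint X * X)"
    by (intro char_poly_similar) (auto simp: similar_mat_def)
  then show ?thesis by (simp add: schatten_powr_def singular_values_def)
qed

lemma diagonal_circle_expansion:
  fixes p :: real and \<tau> :: "nat \<Rightarrow> complex" and B :: "complex mat"
  assumes p: "p > 0" and B: "B \<in> carrier_mat n n"
  shows "\<exists>(J :: nat set) (a :: nat \<Rightarrow> real) (b :: real).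
    finite J \<and> 0 \<notin> J \<and> (\<forall>k\<in>J. a k > 0) \<and> b \<ge> 0 \<and>
    (\<lambda>t. 1 / (2 * pi) * integral {0..2 * pi} (\<lambda>\<theta>. schatten_powr p (mat_diag n \<tau> + (complex_of_real t * cis \<theta>) \<cdot>\<^sub>m B))
        - (schatten_powr p (mat_diag n \<tau>) + (\<Sum>k | k \<in> J \<and> real k * p \<le> 2. a k * t powr (real k * p)) + b * t ^ 2))
      \<in> o[at_right 0](\<lambda>t. t ^ 2) \<and>
    (b = 0 \<longleftrightarrow> (\<forall>i<n. \<forall>j<n. \<tau> i \<noteq> 0 \<or> \<tau> j \<noteq> 0 \<longrightarrow> B $$ (i, j) = 0))"
proof -
  define X where "X z = mat_diag n \<tau> + z \<cdot>\<^sub>m B" for z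
  have D: "mat_diag n \<tau> \<in> carrier_mat n n" by simp
  have X: "X z \<in> carrier_mat n n" for z using B by (simp add: X_def)
  define good where "good z x \<longleftrightarrow> (\<forall>j. x j \<ge> 0) \<and>
    (\<forall>p>0. schatten_powr p (X z) = (\<Sum>j<n. x j powr (p / 2))) \<and>
    (\<forall>m. mat_trace n ((mat_adjoint (X z) * X z) ^\<^sub>m m) = of_real (\<Sum>j<n. x j ^ m)) \<and>
    (\<forall>c. det (1\<^sub>m n + c \<cdot>\<^sub>m (mat_adjoint (X z) * X z)) = (\<Prod>j<n. 1 + c * of_real (x j)))"
    for z and x :: "nat \<Rightarrow> real"
  have "\<forall>z. \<exists>x. good z x" unfolding good_def using squared_singular_values_exist[OF X] by blast
  from choice[OF this] obtain x where good: "\<forall>z. good z (x z)" ..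
  have x0: "x z j \<ge> 0" for z j using good unfolding good_def by blast
  define \<beta> where "\<beta> = p / 2"
  have \<beta>: "\<beta> > 0" using p by (simp add: \<beta>_def)
  define F where "F z = schatten_powr p (X z)" for z
  have F: "F z = (\<Sum>j<n. x z j powr \<beta>)" for z using good p unfolding good_def F_def \<beta>_def by blast
  have tr: "mat_trace n ((mat_adjoint (mat_diag n \<tau> + z \<cdot>\<^sub>m B) * (mat_diag n \<tau> + z \<cdot>\<^sub>m B)) ^\<^sub>m m) =
      of_real (\<Sum>j<n. x z j ^ m)" for z m
    using good unfolding good_def X_def by blast
  have dt: "det (1\<^sub>m n + c \<cdot>\<^sub>m (mat_adjoint (mat_diag n \<tau> + z \<cdot>\<^sub>m B) * (mat_diag n \<tau> + z \<cdot>\<^sub>m B))) =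
      (\<Prod>j<n. 1 + c * of_real (x z j))" for z c
    using good unfolding good_def X_def by blast
  define \<mu> where "\<mu> i = (cmod (\<tau> i))\<^sup>2" for i
  define b where "b = (\<Sum>i<n. \<Sum>l<n. (cmod (B $$ (i, l)))\<^sup>2 * powr_divided_difference \<beta> (\<mu> i) (\<mu> l))"
  define c0 where "c0 = (\<Sum>i<n. \<mu> i powr \<beta>)"
  have \<mu>0: "\<mu> i \<ge> 0" for i by (simp add: \<mu>_def)
  \<comment> \<open>From k = K + 1 on, t^{kp} is o(t^2).\<close>
  obtain K where K: "real (Suc K) * p > 2"
  proof -
    obtain N where "2 / p < real N" using reals_Archimedean2 by blast
    then have "2 < real (Suc N) * p" using p by (simp add: field_simps)
    then show thesis by (rule that)
  qed
  define \<nu> where "\<nu> k z j = inverse (1 + x z j / norm z ^ (2 * k))" for k :: nat and z :: complex and j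
  have \<nu>0: "\<nu> 0 z j = inverse (1 + x z j)" for z j by (simp add: \<nu>_def)
  define \<Phi> where "\<Phi> a k z = (\<Sum>j<n. if \<nu> k z j \<in> {a..1 - a} then ((1 - \<nu> k z j) / \<nu> k z j) powr \<beta> else 0)"
    for a k z
  define win where "win a k \<longleftrightarrow> (\<exists>c. even_expansion (\<Phi> a k) c) \<and>
    (\<exists>L. \<forall>\<^sub>F z in at 0. \<forall>j<n. \<nu> k z j \<in> {a..1 - a} \<or> \<nu> k z j \<le> L * norm z ^ 2 \<or> 1 - \<nu> k z j \<le> L * norm z ^ 2)"
    for a k
  define lead where "lead a \<longleftrightarrow> (\<lambda>z. four_mean (\<Phi> a 0) z - (c0 + b * norm z ^ 2)) \<in> o[at 0](\<lambda>z. norm z ^ 2)" for a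
  have "\<forall>\<^sub>F a in at_right 0. win a k" for k
    unfolding win_def \<Phi>_def[abs_def] \<nu>_def using singular_window_expansion[OF D B x0 dt] .
  \<comment> \<open>One \<open>a\<close> has to serve all windows k \<le> K and the second-order
    expansion of window 0; these are finitely many conditions, each valid for all small
    \<open>a\<close>.\<close>
  then have "\<forall>\<^sub>F a in at_right 0. \<forall>k\<in>{..K}. win a k" by (intro eventually_ball_finite) auto
  moreover have "\<forall>\<^sub>F a in at_right 0. lead a"
    using leading_window_expansion[OF B tr x0 \<beta>]
    unfolding lead_def \<Phi>_def[abs_def] \<nu>0 c0_def b_def \<mu>_def .
  moreover have "\<forall>\<^sub>F a in at_right 0. (0::real) < a \<and> a < 1 / 2"
    by (auto simp: eventually_at_right_field intro!: exI[of _ "1/2"])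
  ultimately have "\<forall>\<^sub>F a in at_right 0. (\<forall>k\<in>{..K}. win a k) \<and> lead a \<and> 0 < a \<and> a < 1 / 2"
    by eventually_elim simp
  then obtain a where win: "\<forall>k\<in>{..K}. win a k" and lead: "lead a" and a: "0 < a" "a < 1 / 2"
    using eventually_happens'[OF trivial_limit_at_right_real] by blast
  have "\<forall>k\<in>{..K}. \<exists>c. even_expansion (\<Phi> a k) c" using win unfolding win_def by blast
  from bchoice[OF this] obtain c where c: "\<forall>k\<in>{..K}. even_expansion (\<Phi> a k) (c k)" ..
  have c_nonneg: "c k \<ge> 0" if "k \<le> K" for k
  proof (rule tendsto_lowerbound[OF even_expansion_tendsto])
    show "even_expansion (\<Phi> a k) (c k)" using c that by simp
    show "\<forall>\<^sub>F z in at 0. 0 \<le> \<Phi> a k z" unfolding \<Phi>_def by (intro always_eventually allI sum_nonneg) auto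
  qed simp
  have two: "2 * real k * \<beta> = real k * p" for k by (simp add: \<beta>_def)
  have "(\<lambda>z. F z - (\<Sum>k\<le>K. norm z powr (real k * p) * \<Phi> a k z)) \<in> O[at 0](\<lambda>z. norm z powr (real (Suc K) * p))"
    unfolding F \<Phi>_def \<nu>_def two[symmetric]
    using win unfolding win_def \<nu>_def
    by (intro window_sum_decomposition[OF a \<beta> x0 singular_values_bounded[OF B tr x0]]) simp
  from four_mean_expansion[OF p K this lead[unfolded lead_def], of c] c
  have main: "(\<lambda>z. four_mean F z - (c0 + (\<Sum>k=1..K. c k * norm z powr (real k * p)) + b * norm z ^ 2)) \<in> o[at 0](\<lambda>z. norm z ^ 2)"
    by simp
  \<comment> \<open>Windows with limit 0 are dropped, which makes the remaining coefficients
    positive. The index 0 is excluded because window 0 supplies the constant term and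
    \<open>b\<close>.\<close>
  define J where "J = {k \<in> {1..K}. c k > 0}"
  have split: "(\<Sum>k=1..K. c k * s powr (real k * p)) =
      (\<Sum>k | k \<in> J \<and> real k * p \<le> 2. c k * s powr (real k * p)) +
      (\<Sum>k | k \<in> J \<and> real k * p > 2. c k * s powr (real k * p))" for s :: real
  proof -
    have "(\<Sum>k=1..K. c k * s powr (real k * p)) = (\<Sum>k\<in>J. c k * s powr (real k * p))"
      unfolding J_def using c_nonneg by (intro sum.mono_neutral_right) (auto simp: less_le)
    also have "J = {k. k \<in> J \<and> real k * p \<le> 2} \<union> {k. k \<in> J \<and> real k * p > 2}" by auto
    also have "(\<Sum>k\<in>\<dots>. c k * s powr (real k * p)) = (\<Sum>k | k \<in> J \<and> real k * p \<le> 2. c k * s powr (real k * p)) +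
      (\<Sum>k | k \<in> J \<and> real k * p > 2. c k * s powr (real k * p))"
      by (rule sum.union_disjoint) (auto simp: J_def)
    finally show ?thesis .
  qed
  \<comment> \<open>Terms with kp > 2 are absorbed into the error.\<close>
  have "(\<lambda>z::complex. \<Sum>k | k \<in> J \<and> real k * p > 2. c k * norm z powr (real k * p)) \<in> o[at 0](\<lambda>z. norm z ^ 2)"
    using powr_norm_smallo by (intro sum_in_smallo_finite) auto
  from sum_in_smallo(1)[OF main this]
  have E: "(\<lambda>z. four_mean F z - (c0 + (\<Sum>k | k \<in> J \<and> real k * p \<le> 2. c k * norm z powr (real k * p)) + b * norm z ^ 2))
      \<in> o[at 0](\<lambda>z. norm z ^ 2)"
    unfolding split by (simp add: algebra_simps)
  have cont: "continuous_on UNIV (\<lambda>\<theta>. F (of_real t * cis \<theta>))" for t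
  proof -
    have trc: "continuous_on S (\<lambda>\<theta>. \<Sum>j<n. x (of_real t * cis \<theta>) j ^ m)" for m and S :: "real set"
    proof -
      have "continuous_on S (\<lambda>\<theta>. Re (mat_trace n ((mat_adjoint (mat_diag n \<tau> + (of_real t * cis \<theta>) \<cdot>\<^sub>m B) *
          (mat_diag n \<tau> + (of_real t * cis \<theta>) \<cdot>\<^sub>m B)) ^\<^sub>m m)))"
        by (intro continuous_on_Re continuous_on_compose2[OF continuous_trace_power[OF D B, of m]] continuous_intros) auto
      then show ?thesis unfolding tr by simp
    qed
    \<comment> \<open>The Weierstrass argument works on compact sets, so continuity on the line is
      patched together from bounded intervals.\<close>
    have Icc: "continuous_on {-r..r} (\<lambda>\<theta>. F (of_real t * cis \<theta>))" for r
      unfolding F by (intro continuous_powr_sum x0 \<beta> trc) auto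
    have "continuous_on {-r<..<r} (\<lambda>\<theta>. F (of_real t * cis \<theta>))" for r
      by (rule continuous_on_subset[OF Icc[of r]]) auto
    then have "continuous_on (\<Union>r. {-r<..<r}) (\<lambda>\<theta>. F (of_real t * cis \<theta>))"
      by (intro continuous_on_open_UN) auto
    moreover have "(\<Union>r. {-r<..<r}) = (UNIV :: real set)"
    proof -
      have "y \<in> (\<Union>r. {-r<..<r})" for y :: real by (rule UN_I[of "\<bar>y\<bar> + 1"]) auto
      then show ?thesis by blast
    qed
    ultimately show ?thesis by simp
  qed
  have c0: "c0 = schatten_powr p (mat_diag n \<tau>)"
    unfolding schatten_powr_diag[OF p] c0_def \<mu>_def \<beta>_def ..
  have b0: "b \<ge> 0"
    unfolding b_def using powr_divided_difference_nonneg(1)[OF \<beta> \<mu>0 \<mu>0] by (intro sum_nonneg mult_nonneg_nonneg) auto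
  have b_iff: "b = 0 \<longleftrightarrow> (\<forall>i<n. \<forall>j<n. \<tau> i \<noteq> 0 \<or> \<tau> j \<noteq> 0 \<longrightarrow> B $$ (i, j) = 0)"
  proof -
    let ?f = "\<lambda>i l. (cmod (B $$ (i, l)))\<^sup>2 * powr_divided_difference \<beta> (\<mu> i) (\<mu> l)"
    have f0: "?f i l \<ge> 0" for i l using powr_divided_difference_nonneg(1)[OF \<beta> \<mu>0 \<mu>0] by simp
    have inner: "(\<Sum>l<n. ?f i l) = 0 \<longleftrightarrow> (\<forall>l\<in>{..<n}. ?f i l = 0)" for i
      by (rule sum_nonneg_eq_0_iff) (use f0 in auto)
    have "b = 0 \<longleftrightarrow> (\<forall>i\<in>{..<n}. (\<Sum>l<n. ?f i l) = 0)"
      unfolding b_def by (rule sum_nonneg_eq_0_iff) (use f0 in \<open>auto intro: sum_nonneg\<close>)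
    then have "b = 0 \<longleftrightarrow> (\<forall>i<n. \<forall>l<n. ?f i l = 0)"
      unfolding inner Ball_def lessThan_iff .
    also have "\<dots> \<longleftrightarrow> (\<forall>i<n. \<forall>j<n. \<tau> i \<noteq> 0 \<or> \<tau> j \<noteq> 0 \<longrightarrow> B $$ (i, j) = 0)"
      using powr_divided_difference_nonneg(2)[OF \<beta> \<mu>0 \<mu>0] by (auto simp: \<mu>_def)
    finally show ?thesis .
  qed
  have "(\<lambda>t. 1 / (2 * pi) * integral {0..2 * pi} (\<lambda>\<theta>. F (complex_of_real t * cis \<theta>)) -
        (c0 + (\<Sum>k | k \<in> J \<and> real k * p \<le> 2. c k * t powr (real k * p)) + b * t ^ 2)) \<in> o[at_right 0](\<lambda>t. t ^ 2)"
    by (rule circle_mean_smallo[OF cont E])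
  then show ?thesis
    unfolding F_def X_def c0
    by (intro exI[of _ J] exI[of _ c] exI[of _ b] conjI b0 b_iff) (auto simp: J_def)
qed

lemma mult_eq_zero_cancel_unitary:
  fixes X :: "complex mat"
  assumes U: "unitary_mat n U" and V: "unitary_mat n V" and X: "X \<in> carrier_mat n n"
  shows "U * X * mat_adjoint V = 0\<^sub>m n n \<longleftrightarrow> X = 0\<^sub>m n n"
proof
  note u = unitary_matD[OF U] and v = unitary_matD[OF V]
  assume eq: "U * X * mat_adjoint V = 0\<^sub>m n n"
  have "X = mat_adjoint U * (U * X * mat_adjoint V) * V"
    using u(1,2) v X by (simp add: assoc_mult_mat[of _ n n _ n _ n] mult_carrier_square unitary_cancel[OF U])
  then show "X = 0\<^sub>m n n" unfolding eq using u v by simp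
qed (use unitary_matD[OF U] unitary_matD[OF V] in simp)

text \<open>
  The support condition does not depend on the chosen singular value decomposition, since it says
  $A^* B = 0$ and $B A^* = 0$.
\<close>

lemma support_condition_intrinsic:
  fixes A B :: "complex mat"
  assumes U: "unitary_mat n U" and V: "unitary_mat n V" and B: "B \<in> carrier_mat n n"
    and A: "A = U * mat_diag n \<tau> * mat_adjoint V"
  shows "(\<forall>i<n. \<forall>j<n. \<tau> i \<noteq> 0 \<or> \<tau> j \<noteq> 0 \<longrightarrow> (mat_adjoint U * B * V) $$ (i, j) = 0) \<longleftrightarrow>
    mat_adjoint A * B = 0\<^sub>m n n \<and> B * mat_adjoint A = 0\<^sub>m n n"
proof -
  note u = unitary_matD[OF U] and v = unitary_matD[OF V]
  define B' where "B' = mat_adjoint U * B * V"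
  have UB: "mat_adjoint U * B \<in> carrier_mat n n" by (rule mult_carrier_square[OF u(2) B])
  have B': "B' \<in> carrier_mat n n" unfolding B'_def by (rule mult_carrier_square[OF UB v(1)])
  define D where "D = mat_adjoint (mat_diag n \<tau>)"
  have D: "D \<in> carrier_mat n n" by (simp add: D_def)
  have D_eq: "D = mat_diag n (\<lambda>i. cnj (\<tau> i))"
    unfolding D_def by (rule eq_matI) (auto simp: mat_diag_def)
  have UD: "U * mat_diag n \<tau> \<in> carrier_mat n n" using u by (intro mult_carrier_square) auto
  have adjA: "mat_adjoint A = V * (D * mat_adjoint U)"
    unfolding A D_def mat_adjoint_mult[OF UD v(2)] mat_adjoint_mult[OF u(1) mat_diag_dim] by simp
  have "mat_adjoint A * B = V * (D * B') * mat_adjoint V"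
  proof -
    have "V * (D * B') * mat_adjoint V = V * (D * (mat_adjoint U * (B * (V * mat_adjoint V))))"
      unfolding B'_def using u v B D by (simp add: assoc_mult_mat[of _ n n _ n _ n] mult_carrier_square)
    also have "\<dots> = V * (D * (mat_adjoint U * B))" unfolding v(4) using B by simp
    finally show ?thesis unfolding adjA using u v B D by (simp add: assoc_mult_mat[of _ n n _ n _ n] mult_carrier_square)
  qed
  then have 1: "mat_adjoint A * B = 0\<^sub>m n n \<longleftrightarrow> D * B' = 0\<^sub>m n n"
    using mult_eq_zero_cancel_unitary[OF V V] D B' by (simp add: mult_carrier_square)
  have "B * mat_adjoint A = U * (B' * D) * mat_adjoint U"
  proof -
    have "U * (B' * D) * mat_adjoint U = B * (V * (D * mat_adjoint U))"
      unfolding B'_def using u(1,2) v B D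
      by (simp add: assoc_mult_mat[of _ n n _ n _ n] mult_carrier_square unitary_cancel[OF U])
    then show ?thesis unfolding adjA by simp
  qed
  then have 2: "B * mat_adjoint A = 0\<^sub>m n n \<longleftrightarrow> B' * D = 0\<^sub>m n n"
    using mult_eq_zero_cancel_unitary[OF U U] D B' by (simp add: mult_carrier_square)
  have "D * B' = 0\<^sub>m n n \<longleftrightarrow> (\<forall>i<n. \<forall>j<n. cnj (\<tau> i) * B' $$ (i, j) = 0)"
    unfolding D_eq mat_diag_mult_left[OF B'] by (auto simp: mat_eq_iff)
  moreover have "B' * D = 0\<^sub>m n n \<longleftrightarrow> (\<forall>i<n. \<forall>j<n. B' $$ (i, j) * cnj (\<tau> j) = 0)"
    unfolding D_eq mat_diag_mult_right[OF B'] by (auto simp: mat_eq_iff)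
  ultimately show ?thesis unfolding 1 2 B'_def[symmetric] by auto
qed

theorem proposition4p3:
  fixes p :: real and n :: nat and A B :: "complex mat"
  assumes "p > 0"
    and "A \<in> carrier_mat n n" and "B \<in> carrier_mat n n"
    and "A \<noteq> 0\<^sub>m n n"
  shows "\<exists>(J :: nat set) (a :: nat \<Rightarrow> real) (b :: real).
      finite J \<and> 0 \<notin> J \<and> (\<forall>k\<in>J. a k > 0) \<and> b \<ge> 0 \<and>
      (\<lambda>t :: real.
          1 / (2 * pi) * integral {0..2 * pi}
            (\<lambda>\<theta>. schatten_powr p (A + (complex_of_real t * cis \<theta>) \<cdot>\<^sub>m B))
          - (schatten_powr p A
             + (\<Sum>k | k \<in> J \<and> real k * p \<le> 2. a k * t powr (real k * p))
             + b * t ^ 2))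
        \<in> o[at_right 0](\<lambda>t. t ^ 2) \<and>
      (\<forall>U h s V. is_svd n A U h s V \<longrightarrow>
         (b = 0 \<longleftrightarrow> supported_bottom_right n h (mat_adjoint U * B * V)))"
proof -
  from svd_exists[OF assms(2)] obtain P Q \<tau> where
    PQ: "unitary_mat n P" "unitary_mat n Q" and A: "A = P * mat_diag n \<tau> * mat_adjoint Q" by blast
  note p = unitary_matD[OF PQ(1)] and q = unitary_matD[OF PQ(2)]
  define B' where "B' = mat_adjoint P * B * Q"
  have PB: "mat_adjoint P * B \<in> carrier_mat n n" by (rule mult_carrier_square[OF p(2) assms(3)])
  have B': "B' \<in> carrier_mat n n" unfolding B'_def by (rule mult_carrier_square[OF PB q(1)])
  have B: "B = P * B' * mat_adjoint Q"
    unfolding B'_def using p(1,2) q assms(3)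
    by (simp add: assoc_mult_mat[of _ n n _ n _ n] mult_carrier_square unitary_cancel[OF PQ(1)])
  have norm_eq: "schatten_powr p (A + z \<cdot>\<^sub>m B) = schatten_powr p (mat_diag n \<tau> + z \<cdot>\<^sub>m B')" for z
  proof -
    have PB': "P * B' \<in> carrier_mat n n" "P * mat_diag n \<tau> \<in> carrier_mat n n"
      using p B' by (auto intro: mult_carrier_square)
    have "P * (mat_diag n \<tau> + z \<cdot>\<^sub>m B') = P * mat_diag n \<tau> + z \<cdot>\<^sub>m (P * B')"
      using p B' by (simp add: mult_add_distrib_mat[of _ n n _ n] mult_smult_distrib[of _ n n _ n])
    moreover have "(P * mat_diag n \<tau> + z \<cdot>\<^sub>m (P * B')) * mat_adjoint Q = A + z \<cdot>\<^sub>m B"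
      using q PB' by (subst B, subst A, subst add_mult_distrib_mat[of _ n n]) (auto simp: mult_smult_assoc_mat[of _ n n _ n])
    ultimately have "A + z \<cdot>\<^sub>m B = P * (mat_diag n \<tau> + z \<cdot>\<^sub>m B') * mat_adjoint Q" by simp
    then show ?thesis using schatten_powr_unitary[OF PQ, of "mat_diag n \<tau> + z \<cdot>\<^sub>m B'"] B' by simp
  qed
  have norm_eq0: "schatten_powr p A = schatten_powr p (mat_diag n \<tau>)"
    unfolding A by (intro schatten_powr_unitary[OF PQ]) simp
  \<comment> \<open>\<open>b\<close> comes from the decomposition by P and Q, while the claim
    concerns an arbitrary one. Both support conditions express the same identities in A and B,
    because \<sigma> i is nonzero exactly for i < h.\<close>
  have svd_iff: "(\<forall>i<n. \<forall>j<n. \<tau> i \<noteq> 0 \<or> \<tau> j \<noteq> 0 \<longrightarrow> B' $$ (i, j) = 0) \<longleftrightarrow>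
      supported_bottom_right n h (mat_adjoint U * B * V)" if svd: "is_svd n A U h s V" for U h s V
  proof -
    define \<sigma> where "\<sigma> i = (if i < h then complex_of_real (s i) else 0)" for i
    from svd have U: "unitary_mat n U" and V: "unitary_mat n V" and h: "\<forall>i<h. s i > 0"
      and AU: "A = U * mat_diag n \<sigma> * mat_adjoint V" unfolding is_svd_def \<sigma>_def by auto
    have "\<sigma> i \<noteq> 0 \<longleftrightarrow> i < h" for i using h by (auto simp: \<sigma>_def)
    then have "supported_bottom_right n h (mat_adjoint U * B * V) \<longleftrightarrow>
      mat_adjoint A * B = 0\<^sub>m n n \<and> B * mat_adjoint A = 0\<^sub>m n n"
      using support_condition_intrinsic[OF U V assms(3) AU] unfolding supported_bottom_right_def by simp
    then show ?thesis
      using support_condition_intrinsic[OF PQ assms(3) A] unfolding B'_def by simp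
  qed
  from diagonal_circle_expansion[OF assms(1) B', of \<tau>, folded norm_eq norm_eq0]
  obtain J a b where res: "finite J" "0 \<notin> J" "\<forall>k\<in>J. a k > 0" "b \<ge> 0"
    "(\<lambda>t :: real. 1 / (2 * pi) * integral {0..2 * pi}
            (\<lambda>\<theta>. schatten_powr p (A + (complex_of_real t * cis \<theta>) \<cdot>\<^sub>m B))
          - (schatten_powr p A + (\<Sum>k | k \<in> J \<and> real k * p \<le> 2. a k * t powr (real k * p)) + b * t ^ 2))
        \<in> o[at_right 0](\<lambda>t. t ^ 2)"
    "b = 0 \<longleftrightarrow> (\<forall>i<n. \<forall>j<n. \<tau> i \<noteq> 0 \<or> \<tau> j \<noteq> 0 \<longrightarrow> B' $$ (i, j) = 0)" by (elim exE conjE) (rule that)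
  have "\<forall>U h s V. is_svd n A U h s V \<longrightarrow> (b = 0 \<longleftrightarrow> supported_bottom_right n h (mat_adjoint U * B * V))"
    unfolding res(6) using svd_iff by blast
  with res(1-5) show ?thesis by blast
qed

end
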